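(* Let $\Lambda\subseteq\mathbb{R}^{2d}$ be a lattice and let $(\mathcal{W}_n)_{n\in\mathbb{N}}$ be a sequence of $w^*$-closed subspaces of $M^\infty(\mathbb{R}^d)$ such that (i) $\mathcal{W}_n\supseteq\mathcal{W}_{n+1}\ne\{0\}$ for all $n\in\mathbb{N}$, and (ii) each $\mathcal{W}_n$ is invariant under all operators $\pi(\lambda)$, $\lambda\in\Lambda$. Then $\bigcap_{n\ge1}\mathcal{W}_n\ne\{0\}$.
   Context: A lattice is $\Lambda=A_0\mathbb{Z}^{2d}$ with $A_0$ an invertible real $2d\times 2d$ matrix. For $z=(x,\omega)\in\mathbb{R}^{2d}$, $\pi(z)f(t)=e^{2\pi i\omega\cdot t}f(t-x)$ (extended to distributions by duality), and $\mathcal{V}_gf(z)=\langle f,\pi(z)g\rangle$. With $g(t)=e^{-\pi t\cdot t}$, $M^1(\mathbb{R}^d)$ is the Banach space of $f\in L^2(\mathbb{R}^d)$ with $\|f\|_{M^1}=\|\mathcal{V}_gf\|_{L^1(\mathbb{R}^{2d})}<\infty$, and $M^\infty(\mathbb{R}^d)$ is the space of tempered distributions $f$ with $\|f\|_{M^\infty}=\|\mathcal{V}_gf\|_{L^\infty(\mathbb{R}^{2d})}<\infty$; $M^\infty(\mathbb{R}^d)$ is the dual of $M^1(\mathbb{R}^d)$ and the $w^*$-topology is the one from this duality. *)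

theory Defs
  imports "HOL-Probability.Essential_Supremum"
begin

section \<open>Schwartz functions and tempered distributions\<close>

definition partial_deriv :: "'d::finite \<Rightarrow> (real ^ 'd \<Rightarrow> complex) \<Rightarrow> real ^ 'd \<Rightarrow> complex" where
  "partial_deriv i f x = frechet_derivative f (at x) (axis i 1)"

text \<open>Multi-indices are encoded as lists of coordinate directions.\<close>

definition iter_partial :: "'d::finite list \<Rightarrow> (real ^ 'd \<Rightarrow> complex) \<Rightarrow> real ^ 'd \<Rightarrow> complex" where
  "iter_partial is f = foldr partial_deriv is f"

definition smooth :: "(real ^ 'd::finite \<Rightarrow> complex) \<Rightarrow> bool" where
  "smooth f \<longleftrightarrow> (\<forall>is x. iter_partial is f differentiable (at x))"

definition schwartz_space :: "(real ^ 'd::finite \<Rightarrow> complex) set" where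
  "schwartz_space = {f. smooth f \<and>
     (\<forall>k is. bdd_above (range (\<lambda>x. (1 + norm x) ^ k * norm (iter_partial is f x))))}"

definition schwartz_seminorm :: "nat \<Rightarrow> 'd::finite list \<Rightarrow> (real ^ 'd \<Rightarrow> complex) \<Rightarrow> real" where
  "schwartz_seminorm k is f = (SUP x. (1 + norm x) ^ k * norm (iter_partial is f x))"

definition schwartz_topology :: "(real ^ 'd::finite \<Rightarrow> complex) topology" where
  "schwartz_topology = topology_generated_by
     {{\<psi> \<in> schwartz_space. schwartz_seminorm k is (\<lambda>t. \<psi> t - \<phi> t) < e} |
        \<phi> k is e. \<phi> \<in> schwartz_space}"

text \<open>A tempered distribution is a continuous linear functional on the Schwartz space. As a
  function on all of \<open>real ^ 'd \<Rightarrow> complex\<close> it is set to zero outside the Schwartz space, so that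
  equality of distributions is equality of HOL functions.\<close>

type_synonym 'd dist = "(real ^ 'd \<Rightarrow> complex) \<Rightarrow> complex"

definition tempered_distributions :: "'d::finite dist set" where
  "tempered_distributions = {f.
     (\<forall>\<phi> \<psi>. \<phi> \<in> schwartz_space \<longrightarrow> \<psi> \<in> schwartz_space \<longrightarrow>
        f (\<lambda>t. \<phi> t + \<psi> t) = f \<phi> + f \<psi>) \<and>
     (\<forall>c \<phi>. \<phi> \<in> schwartz_space \<longrightarrow> f (\<lambda>t. c * \<phi> t) = c * f \<phi>) \<and>
     continuous_map schwartz_topology euclidean f \<and>
     (\<forall>\<phi>. \<phi> \<notin> schwartz_space \<longrightarrow> f \<phi> = 0)}"

text \<open>The sesquilinear bracket extending the \<open>L\<^sup>2\<close> inner product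
  \<open>\<integral> f(t) cnj (\<phi>(t)) dt\<close>.\<close>

definition bracket :: "'d::finite dist \<Rightarrow> (real ^ 'd \<Rightarrow> complex) \<Rightarrow> complex" where
  "bracket f \<phi> = f (\<lambda>t. cnj (\<phi> t))"

section \<open>Time-frequency shifts and the short-time Fourier transform\<close>

text \<open>The phase space \<open>\<real>\<^bsup>2d\<^esup>\<close> of points \<open>z = (x, \<omega>)\<close> is the product of two copies of \<open>real ^ 'd\<close>.\<close>

type_synonym 'd phase = "(real ^ 'd) \<times> (real ^ 'd)"

definition tf_shift :: "'d::finite phase \<Rightarrow> (real ^ 'd \<Rightarrow> complex) \<Rightarrow> real ^ 'd \<Rightarrow> complex" where
  "tf_shift z f t = cis (2 * pi * (snd z \<bullet> t)) * f (t - fst z)"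

text \<open>On distributions the shift is the transpose: substituting \<open>t = s + x\<close>,
  \<open>\<integral> (\<pi>(z)f)(t) \<phi>(t) dt = \<integral> f(s) cis (2 pi \<omega> \<bullet> (s + x)) \<phi>(s + x) ds\<close>.\<close>

definition tf_shift_dist :: "'d::finite phase \<Rightarrow> 'd dist \<Rightarrow> 'd dist" where
  "tf_shift_dist z f \<phi> = f (\<lambda>s. cis (2 * pi * (snd z \<bullet> (s + fst z))) * \<phi> (s + fst z))"

definition gauss :: "real ^ 'd::finite \<Rightarrow> complex" where
  "gauss t = complex_of_real (exp (- pi * (t \<bullet> t)))"

definition stft :: "(real ^ 'd::finite \<Rightarrow> complex) \<Rightarrow> (real ^ 'd \<Rightarrow> complex) \<Rightarrow>
    'd phase \<Rightarrow> complex" where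
  "stft g f z = (\<integral>t. f t * cnj (tf_shift z g t) \<partial>lborel)"

definition stft_dist :: "(real ^ 'd::finite \<Rightarrow> complex) \<Rightarrow> 'd dist \<Rightarrow>
    'd phase \<Rightarrow> complex" where
  "stft_dist g f z = bracket f (tf_shift z g)"

section \<open>The modulation spaces and the weak-star topology\<close>

definition M1_norm :: "(real ^ 'd::finite \<Rightarrow> complex) \<Rightarrow> ennreal" where
  "M1_norm f = (\<integral>\<^sup>+z. ennreal (norm (stft gauss f z)) \<partial>lborel)"

text \<open>Functions are not identified almost everywhere; only their transforms \<open>stft gauss f\<close>, which
  do not depend on the representative, are used below.\<close>

definition M1 :: "(real ^ 'd::finite \<Rightarrow> complex) set" where
  "M1 = {f. f \<in> borel_measurable lborel \<and> integrable lborel (\<lambda>t. (norm (f t))\<^sup>2) \<and>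
     M1_norm f < \<infinity>}"

definition Minf_norm :: "'d::finite dist \<Rightarrow> ennreal" where
  "Minf_norm f = esssup lborel (\<lambda>z. ennreal (norm (stft_dist gauss f z)))"

definition Minf :: "'d::finite dist set" where
  "Minf = {f \<in> tempered_distributions. Minf_norm f < \<infinity>}"

text \<open>The standard duality bracket between \<open>Minf\<close> and \<open>M1\<close>. By the orthogonality relations of the
  short-time Fourier transform, the normalisation by \<open>\<parallel>g\<parallel>\<^sup>2\<close> in \<open>L\<^sup>2\<close> makes it
  agree with \<open>bracket\<close> for \<open>h\<close> in the Schwartz space, so it is the continuous extension of \<open>bracket\<close>.\<close>

definition dual_pairing :: "'d::finite dist \<Rightarrow> (real ^ 'd \<Rightarrow> complex) \<Rightarrow> complex" where
  "dual_pairing f h =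
     (\<integral>z. stft_dist gauss f z * cnj (stft gauss h z) \<partial>lborel) /
     complex_of_real (\<integral>t. (norm (gauss t :: complex))\<^sup>2 \<partial>(lborel :: (real ^ 'd) measure))"

definition weak_star_topology :: "'d::finite dist topology" where
  "weak_star_topology = topology_generated_by
     {{f \<in> Minf. dual_pairing f h \<in> U} | h U. h \<in> M1 \<and> open U}"

definition Minf_subspace :: "'d::finite dist set \<Rightarrow> bool" where
  "Minf_subspace W \<longleftrightarrow> W \<subseteq> Minf \<and> (\<lambda>\<phi>. 0) \<in> W \<and>
     (\<forall>f\<in>W. \<forall>h\<in>W. (\<lambda>\<phi>. f \<phi> + h \<phi>) \<in> W) \<and>
     (\<forall>c. \<forall>f\<in>W. (\<lambda>\<phi>. c * f \<phi>) \<in> W)"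

section \<open>Lattices\<close>

text \<open>The index type \<open>'d + 'd\<close> gives \<open>2d\<close> coordinates: \<open>Inl\<close> for position, \<open>Inr\<close> for frequency.\<close>

definition phase_point :: "real ^ ('d + 'd) \<Rightarrow> 'd::finite phase" where
  "phase_point v = ((\<chi> i. v $ Inl i), (\<chi> i. v $ Inr i))"

definition is_lattice :: "'d::finite phase set \<Rightarrow> bool" where
  "is_lattice L \<longleftrightarrow> (\<exists>A :: real ^ ('d + 'd) ^ ('d + 'd). invertible A \<and>
     L = {phase_point (A *v k) | k. \<forall>i. k $ i \<in> \<int>})"

end

theory Submission
  imports Defs "HOL-Probability.Probability" "HOL-Complex_Analysis.Great_Picard"
begin

text \<open>Let \<open>V f\<close> be the short-time Fourier transform with Gaussian window. Shifting along the
  lattice and rescaling, one finds in each \<open>W n\<close> an element \<open>f n\<close> with \<open>V (f n)\<close> bounded by \<open>1\<close>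
  everywhere and of modulus at least \<open>1/2\<close> at a point \<open>z n\<close> of a fixed ball. The inversion formula
  \<open>c f(\<phi>) = \<integral> U \<phi>(z) V f(z) dz\<close>, in which \<open>U \<phi>\<close> decreases rapidly, bounds \<open>f(\<phi>)\<close> by
  the supremum of \<open>V f\<close> times a Schwartz seminorm of \<open>\<phi>\<close> that does not depend on \<open>f\<close>. So the
  functions \<open>V (f n)\<close> are equicontinuous and a diagonal subsequence converges pointwise. By the
  inversion formula and dominated convergence the limit is \<open>V F\<close> for some \<open>F\<close> in \<open>Minf\<close>, and the
  convergence of the subsequence to \<open>F\<close> is weak-star, so \<open>F\<close> lies in every \<open>W n\<close>.
  Equicontinuity gives modulus at least \<open>1/2\<close> for \<open>V F\<close> at a limit point of the \<open>z n\<close>.\<close>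

section \<open>Lebesgue integrals over Euclidean space\<close>

text \<open>Nested nonzero weak-star closed subspaces of a dual space can have trivial intersection:
  a normalised sequence may converge weak-star to zero when the places where its transforms are
  large run off to infinity. Lattice invariance prevents this. A shift by \<mu> only translates the
  modulus of \<open>V f\<close>, and every point of phase space lies within a bounded distance of
  the lattice, so a near-maximum can be moved into a fixed ball without leaving \<open>W n\<close>.
  The constant 1/2 leaves room for a supremum that is not attained. A tempered distribution is here
  just a continuous functional on Schwartz space, so the inversion formula for \<open>f\<close>
  means pulling \<open>f\<close> through a phase space integral of Gaussian atoms. For this the
  integral and its approximating finite sums must be close in every Schwartz seminorm. Hence the two
  kinds of estimates: derivatives of atoms grow at most polynomially in the phase space variable,
  uniformly in time, and \<open>U \<phi>\<close> decays faster than any polynomial. The constant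
  \<open>c\<close> is the squared L2 norm of the Gaussian.\<close>

lemma lborel_integral_shift:
  fixes f :: "'a::euclidean_space \<Rightarrow> 'b::{banach, second_countable_topology}"
  assumes [measurable]: "f \<in> borel_measurable borel"
  shows "(\<integral>x. f (a + x) \<partial>lborel) = (\<integral>x. f x \<partial>lborel)"
proof -
  have "(\<integral>x. f x \<partial>lborel) = (\<integral>x. f x \<partial>(distr lborel borel ((+) a)))"
    by (simp add: lborel_distr_plus)
  also have "\<dots> = (\<integral>x. f (a + x) \<partial>lborel)"
    by (subst integral_distr) auto
  finally show ?thesis by simp
qed

lemma lborel_integrable_shift:
  fixes f :: "'a::euclidean_space \<Rightarrow> 'b::{banach, second_countable_topology}"
  assumes "integrable lborel f"
  shows "integrable lborel (\<lambda>x. f (a + x))"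
proof -
  have [measurable]: "f \<in> borel_measurable borel" using assms by auto
  have "integrable (distr lborel borel ((+) a)) f"
    using assms by (simp add: lborel_distr_plus)
  then show ?thesis
    by (subst (asm) integrable_distr_eq) auto
qed

lemma lborel_integral_scale:
  fixes f :: "'a::euclidean_space \<Rightarrow> 'b::{banach, second_countable_topology}"
  assumes [measurable]: "f \<in> borel_measurable borel" and "0 < c"
  shows "(\<integral>x. f x \<partial>lborel) = c ^ DIM('a) *\<^sub>R (\<integral>x. f (c *\<^sub>R x) \<partial>lborel)"
proof -
  have "(\<integral>x. f x \<partial>lborel) = (\<integral>x. f x \<partial>(density (distr lborel borel (\<lambda>x. 0 + c *\<^sub>R x)) (\<lambda>_. \<bar>c\<bar>^DIM('a))))"
    using lborel_affine[of c "0::'a"] assms(2) by simp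
  also have "\<dots> = c ^ DIM('a) *\<^sub>R (\<integral>x. f (c *\<^sub>R x) \<partial>lborel)"
    using assms(2) by (subst integral_density) (auto simp: integral_distr)
  finally show ?thesis .
qed

lemma lborel_integrable_scale:
  fixes f :: "'a::euclidean_space \<Rightarrow> 'b::{banach, second_countable_topology}"
  assumes "integrable lborel f" and "0 < c"
  shows "integrable lborel (\<lambda>x. f (c *\<^sub>R x))"
proof -
  have [measurable]: "f \<in> borel_measurable borel" using assms by auto
  have "integrable (density (distr lborel borel (\<lambda>x. 0 + c *\<^sub>R x)) (\<lambda>_. \<bar>c\<bar>^DIM('a))) f"
    using lborel_affine[of c "0::'a"] assms by simp
  then have "integrable (distr lborel borel (\<lambda>x. c *\<^sub>R x)) (\<lambda>x. c ^ DIM('a) *\<^sub>R f x)"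
    using assms(2) by (subst (asm) integrable_density) auto
  then have "integrable (distr lborel borel (\<lambda>x. c *\<^sub>R x)) f"
    using integrable_scaleR_right[of "inverse (c ^ DIM('a))" _ "\<lambda>x. c ^ DIM('a) *\<^sub>R f x"] assms(2) by simp
  then show ?thesis
    by (subst (asm) integrable_distr_eq) auto
qed

text \<open>Lebesgue measure is the image of a finite product of one-dimensional Lebesgue measures
  under the basis expansion, so Fubini for finite products applies.\<close>

lemma integral_lborel_prod:
  fixes f :: "'a::euclidean_space \<Rightarrow> real \<Rightarrow> complex"
  assumes "\<And>b. b \<in> Basis \<Longrightarrow> integrable lborel (f b)"
  shows "(\<integral>x. (\<Prod>b\<in>Basis. f b (x \<bullet> b)) \<partial>lborel) = (\<Prod>b\<in>Basis. (\<integral>x. f b x \<partial>lborel))"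
    and "integrable lborel (\<lambda>x. \<Prod>b\<in>Basis. f b (x \<bullet> b))"
proof -
  interpret P: product_sigma_finite "\<lambda>b::'a. lborel :: real measure" ..
  have [measurable]: "f b \<in> borel_measurable borel" if "b \<in> Basis" for b
    using assms[OF that] by auto
  have m: "(\<lambda>x. \<Prod>b\<in>Basis. f b (x \<bullet> b)) \<in> borel_measurable borel"
    by measurable
  have eq: "(\<Prod>b\<in>Basis. f b ((\<Sum>b\<in>Basis. y b *\<^sub>R b) \<bullet> b)) = (\<Prod>b\<in>Basis. f b (y b))" for y :: "'a \<Rightarrow> real"
    by (intro prod.cong refl) simp
  show "(\<integral>x. (\<Prod>b\<in>Basis. f b (x \<bullet> b)) \<partial>lborel) = (\<Prod>b\<in>Basis. (\<integral>x. f b x \<partial>lborel))"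
    by (subst lborel_eq, subst integral_distr)
      (use m assms in \<open>auto simp: eq P.product_integral_prod simp del: inner_sum_left_Basis\<close>)
  show "integrable lborel (\<lambda>x. \<Prod>b\<in>Basis. f b (x \<bullet> b))"
    by (subst lborel_eq, subst integrable_distr_eq)
      (use m assms in \<open>auto simp: eq P.product_integrable_prod simp del: inner_sum_left_Basis\<close>)
qed

text \<open>Each factor \<open>1 + (x \<bullet> b)\<^sup>2\<close> is at most
  \<open>(1 + norm x)\<^sup>2\<close>, so the function is dominated by a product of one-dimensional
  functions \<open>inverse (1 + s\<^sup>2)\<close>. The exponent, twice the dimension, comes from
  this comparison.\<close>

lemma integrable_inverse_power_norm:
  "integrable lborel (\<lambda>x::'a::euclidean_space. inverse ((1 + norm x) ^ (2 * DIM('a))))"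
proof -
  have "integrable lborel (\<lambda>x::real. inverse (1 + x^2))"
    using integrable_inverse_1_plus_square by (simp add: set_integrable_def)
  then have "integrable lborel (\<lambda>x. complex_of_real (inverse (1 + x^2)))"
    by (rule integrable_of_real)
  then have "integrable lborel (\<lambda>x::'a. \<Prod>b\<in>Basis. complex_of_real (inverse (1 + (x \<bullet> b)^2)))"
    by (rule integral_lborel_prod(2))
  then show ?thesis
  proof (rule Bochner_Integration.integrable_bound)
    have "norm (inverse ((1 + norm x) ^ (2 * DIM('a)))) \<le>
         norm (\<Prod>b\<in>Basis. complex_of_real (inverse (1 + (x \<bullet> b)\<^sup>2)))" for x :: 'a
    proof -
      have "(\<Prod>b\<in>(Basis::'a set). 1 + (x \<bullet> b)\<^sup>2) \<le> (\<Prod>b\<in>(Basis::'a set). (1 + norm x)^2)"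
      proof (rule prod_mono, safe)
        fix b :: 'a assume "b \<in> Basis"
        then have "(x \<bullet> b)\<^sup>2 \<le> (norm x)\<^sup>2"
          using Basis_le_norm by (metis abs_ge_zero power2_abs power_mono)
        then show "1 + (x \<bullet> b)\<^sup>2 \<le> (1 + norm x)\<^sup>2"
          using norm_ge_zero[of x] unfolding power2_sum power_one by linarith
      qed (simp add: add_nonneg_nonneg)
      then have "(\<Prod>b\<in>(Basis::'a set). 1 + (x \<bullet> b)\<^sup>2) \<le> (1 + norm x) ^ (2 * DIM('a))"
        by (simp add: power_mult)
      moreover have "0 < (\<Prod>b\<in>(Basis::'a set). 1 + (x \<bullet> b)\<^sup>2)"
        by (intro prod_pos) (simp add: add_pos_nonneg)
      ultimately have "inverse ((1 + norm x) ^ (2 * DIM('a))) \<le> inverse (\<Prod>b\<in>(Basis::'a set). 1 + (x \<bullet> b)\<^sup>2)"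
        by (intro le_imp_inverse_le) auto
      moreover have "norm (1 + (complex_of_real (x \<bullet> b))\<^sup>2) = 1 + (x \<bullet> b)\<^sup>2" for b
      proof -
        have "1 + (complex_of_real (x \<bullet> b))\<^sup>2 = complex_of_real (1 + (x \<bullet> b)\<^sup>2)" by simp
        then show ?thesis by (simp only: norm_of_real) (simp add: add_nonneg_nonneg)
      qed
      ultimately show ?thesis
        by (simp add: prod_norm[symmetric] norm_inverse prod_inversef[symmetric] add_nonneg_nonneg norm_power)
    qed
    then show "AE x in (lborel :: 'a measure). norm (inverse ((1 + norm x) ^ (2 * DIM('a)))) \<le>
         norm (\<Prod>b\<in>Basis. complex_of_real (inverse (1 + (x \<bullet> b)\<^sup>2)))" by (intro AE_I2)
  qed simp
qed

lemma integrable_poly_decay: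
  fixes f :: "'a::euclidean_space \<Rightarrow> 'b::{banach, second_countable_topology}"
  assumes "f \<in> borel_measurable borel"
    and "\<And>x. (1 + norm x) ^ (2 * DIM('a)) * norm (f x) \<le> C"
  shows "integrable lborel f"
    and "(\<integral>x. norm (f x) \<partial>lborel) \<le> C * (\<integral>x. inverse ((1 + norm (x::'a)) ^ (2 * DIM('a))) \<partial>lborel)"
proof -
  have le: "norm (f x) \<le> C * inverse ((1 + norm x) ^ (2 * DIM('a)))" for x
  proof -
    have "(1 + norm x) ^ (2 * DIM('a)) > 0" by (simp add: add_pos_nonneg)
    then show ?thesis using assms(2)[of x] by (simp add: field_simps)
  qed
  have i: "integrable lborel (\<lambda>x::'a. C * inverse ((1 + norm x) ^ (2 * DIM('a))))"
    by (intro integrable_mult_right integrable_inverse_power_norm)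
  show int: "integrable lborel f"
    by (rule Bochner_Integration.integrable_bound[OF i]) (use assms(1) le in \<open>auto intro: order_trans[OF _ abs_ge_self]\<close>)
  have "(\<integral>x. norm (f x) \<partial>lborel) \<le> (\<integral>x. C * inverse ((1 + norm (x::'a)) ^ (2 * DIM('a))) \<partial>lborel)"
    by (intro integral_mono integrable_norm int i le)
  then show "(\<integral>x. norm (f x) \<partial>lborel) \<le> C * (\<integral>x. inverse ((1 + norm (x::'a)) ^ (2 * DIM('a))) \<partial>lborel)"
    by simp
qed

section \<open>The Gaussian as its own Fourier transform\<close>

text \<open>This is the characteristic function of the standard normal distribution at
  \<open>s * u\<close> after the substitution \<open>x = s * v\<close>, where
  \<open>s = sqrt (2 * pi)\<close> is the scale that turns the normal density into
  \<open>exp (- pi * v\<^sup>2)\<close>.\<close>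

lemma gauss_1d:
  fixes u :: real
  shows "integrable lborel (\<lambda>v. cis (2 * pi * (v * u)) * complex_of_real (exp (- pi * v\<^sup>2)))"
    and "(\<integral>v. cis (2 * pi * (v * u)) * complex_of_real (exp (- pi * v\<^sup>2)) \<partial>lborel) = complex_of_real (exp (- pi * u\<^sup>2))"
proof -
  define s where "s = sqrt (2 * pi)"
  have s: "s > 0" "s\<^sup>2 = 2 * pi" by (auto simp: s_def)
  define F where "F x = iexp (s * u * x) * complex_of_real (std_normal_density x)" for x :: real
  have intD: "integrable lborel F"
  proof (rule Bochner_Integration.integrable_bound)
    show "integrable lborel (std_normal_density)" by simp
    show "F \<in> borel_measurable lborel" unfolding F_def by measurable
  qed (auto simp: F_def norm_mult)
  have "char std_normal_distribution (s * u) = (\<integral>x. F x \<partial>lborel)"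
    unfolding char_def F_def
    by (subst integral_density) (auto simp: normal_density_nonneg scaleR_conv_of_real mult_ac)
  then have "(\<integral>x. F x \<partial>lborel) = complex_of_real (exp (- ((s * u)\<^sup>2) / 2))"
    by (simp add: char_std_normal_distribution)
  moreover have "(s * u)\<^sup>2 / 2 = pi * u\<^sup>2" using s by (simp add: power_mult_distrib)
  ultimately have I: "(\<integral>x. F x \<partial>lborel) = complex_of_real (exp (- pi * u\<^sup>2))" by simp
  have eq: "s *\<^sub>R F (s *\<^sub>R v) = cis (2 * pi * (v * u)) * complex_of_real (exp (- pi * v\<^sup>2))" for v
  proof -
    have 1: "s * u * (s * v) = 2 * pi * (v * u)"
      using s(2) by (simp add: power2_eq_square algebra_simps)
    have 2: "s * std_normal_density (s * v) = exp (- pi * v\<^sup>2)"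
      using s by (simp add: std_normal_density_def power_mult_distrib flip: s_def)
    have "s *\<^sub>R F (s *\<^sub>R v) = iexp (s * u * (s * v)) * complex_of_real (s * std_normal_density (s * v))"
      by (simp add: F_def scaleR_conv_of_real mult_ac)
    then show ?thesis unfolding 1 2 by (simp add: cis_conv_exp)
  qed
  have "(\<integral>x. F x \<partial>lborel) = s ^ DIM(real) *\<^sub>R (\<integral>v. F (s *\<^sub>R v) \<partial>lborel)"
    by (rule lborel_integral_scale) (use s intD in auto)
  then show "(\<integral>v. cis (2 * pi * (v * u)) * complex_of_real (exp (- pi * v\<^sup>2)) \<partial>lborel)
      = complex_of_real (exp (- pi * u\<^sup>2))"
    unfolding eq[symmetric] using I by (simp only: integral_scaleR_right) simp
  show "integrable lborel (\<lambda>v. cis (2 * pi * (v * u)) * complex_of_real (exp (- pi * v\<^sup>2)))"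
    unfolding eq[symmetric] by (intro integrable_scaleR_right lborel_integrable_scale intD s)
qed

lemma gauss_fourier:
  fixes u :: "real ^ 'd::finite"
  shows "integrable lborel (\<lambda>v. cis (2 * pi * (v \<bullet> u)) * gauss v)"
    and "(\<integral>v. cis (2 * pi * (v \<bullet> u)) * gauss v \<partial>lborel) = gauss u"
proof -
  let ?f = "\<lambda>b v. cis (2 * pi * (v * (u \<bullet> b))) * complex_of_real (exp (- pi * v\<^sup>2))"
  have eq: "cis (2 * pi * (v \<bullet> u)) * gauss v = (\<Prod>b\<in>Basis. ?f b (v \<bullet> b))" for v
  proof -
    have "(\<Prod>b\<in>Basis. cis (2 * pi * ((v \<bullet> b) * (u \<bullet> b)))) = cis (\<Sum>b\<in>Basis. 2 * pi * ((v \<bullet> b) * (u \<bullet> b)))"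
      by (simp add: cis_conv_exp exp_sum sum_distrib_left)
    moreover have "(\<Sum>b\<in>Basis. 2 * pi * ((v \<bullet> b) * (u \<bullet> b))) = 2 * pi * (v \<bullet> u)"
      by (simp add: euclidean_inner[of v u] sum_distrib_left)
    moreover have "(\<Prod>b\<in>Basis. complex_of_real (exp (- pi * (v \<bullet> b)\<^sup>2))) = gauss v"
      by (simp add: gauss_def euclidean_inner[of v v] sum_distrib_left exp_sum sum_negf[symmetric] power2_eq_square del: sum_negf)
    ultimately show ?thesis by (simp add: prod.distrib)
  qed
  show "integrable lborel (\<lambda>v. cis (2 * pi * (v \<bullet> u)) * gauss v)"
    unfolding eq by (intro integral_lborel_prod(2) gauss_1d)
  have "(\<integral>v. cis (2 * pi * (v \<bullet> u)) * gauss v \<partial>lborel) = (\<Prod>b\<in>Basis. complex_of_real (exp (- pi * (u \<bullet> b)\<^sup>2)))"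
    unfolding eq by (subst integral_lborel_prod(1)) (auto intro: gauss_1d simp: gauss_1d[simplified])
  also have "\<dots> = gauss u"
    by (simp add: gauss_def euclidean_inner[of u u] sum_distrib_left exp_sum sum_negf[symmetric] power2_eq_square del: sum_negf)
  finally show "(\<integral>v. cis (2 * pi * (v \<bullet> u)) * gauss v \<partial>lborel) = gauss u" .
qed

section \<open>Polynomial multiples of shifted Gaussians\<close>

text \<open>Complex polynomials in the real coordinates of a Euclidean space. The generators are
  inner products with arbitrary vectors, so linear forms such as the coordinates of
  \<open>t - x\<close> on the product of time and phase space are covered directly, and facts about
  derivatives and growth go by induction.\<close>

inductive cpoly :: "('a::euclidean_space \<Rightarrow> complex) \<Rightarrow> bool" where
  cpoly_const: "cpoly (\<lambda>x. c)"
| cpoly_inner: "cpoly (\<lambda>x. complex_of_real (x \<bullet> b))"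
| cpoly_add: "cpoly p \<Longrightarrow> cpoly q \<Longrightarrow> cpoly (\<lambda>x. p x + q x)"
| cpoly_mult: "cpoly p \<Longrightarrow> cpoly q \<Longrightarrow> cpoly (\<lambda>x. p x * q x)"

lemma cpoly_sum:
  assumes "\<And>i. i \<in> I \<Longrightarrow> cpoly (p i)"
  shows "cpoly (\<lambda>x. \<Sum>i\<in>I. p i x)"
  using assms by (induction I rule: infinite_finite_induct) (auto intro: cpoly.intros)

text \<open>The derivative is expanded along the basis with polynomial coefficients
  \<open>q' b\<close>, the partial derivatives. The same shape is kept for products with Gaussians,
  so that partial derivatives can be read off and iterated.\<close>

lemma cpoly_deriv:
  assumes "cpoly (q :: 'a::euclidean_space \<Rightarrow> complex)"
  shows "\<exists>q'. (\<forall>b. cpoly (q' b)) \<and>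
    (\<forall>x. (q has_derivative (\<lambda>h. \<Sum>b\<in>Basis. complex_of_real (h \<bullet> b) * q' b x)) (at x))"
  using assms
proof induction
  case (cpoly_const c)
  show ?case by (rule exI[of _ "\<lambda>b x. 0"]) (auto intro: cpoly.intros)
next
  case (cpoly_inner c)
  have "((\<lambda>x. complex_of_real (x \<bullet> c)) has_derivative (\<lambda>h. complex_of_real (h \<bullet> c))) (at x)" for x
    by (intro derivative_intros)
  moreover have "complex_of_real (h \<bullet> c) = (\<Sum>b\<in>Basis. complex_of_real (h \<bullet> b) * complex_of_real (c \<bullet> b))" for h
    by (simp add: euclidean_inner[of h c])
  ultimately show ?case by (intro exI[of _ "\<lambda>b x. complex_of_real (c \<bullet> b)"]) (auto intro: cpoly.intros)
next
  case (cpoly_add p q)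
  from cpoly_add.IH(1) obtain p' where p': "\<And>b. cpoly (p' b)"
    "\<And>x. (p has_derivative (\<lambda>h. \<Sum>b\<in>Basis. complex_of_real (h \<bullet> b) * p' b x)) (at x)" by blast
  from cpoly_add.IH(2) obtain q' where q': "\<And>b. cpoly (q' b)"
    "\<And>x. (q has_derivative (\<lambda>h. \<Sum>b\<in>Basis. complex_of_real (h \<bullet> b) * q' b x)) (at x)" by blast
  have "((\<lambda>x. p x + q x) has_derivative (\<lambda>h. \<Sum>b\<in>Basis. complex_of_real (h \<bullet> b) * (p' b x + q' b x))) (at x)" for x
    by (rule has_derivative_eq_rhs, rule has_derivative_add, rule p', rule q')
      (simp add: fun_eq_iff distrib_left sum.distrib)
  then show ?case by (intro exI[of _ "\<lambda>b x. p' b x + q' b x"]) (simp add: cpoly.intros p' q')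
next
  case (cpoly_mult p q)
  from cpoly_mult.IH(1) obtain p' where p': "\<And>b. cpoly (p' b)"
    "\<And>x. (p has_derivative (\<lambda>h. \<Sum>b\<in>Basis. complex_of_real (h \<bullet> b) * p' b x)) (at x)" by blast
  from cpoly_mult.IH(2) obtain q' where q': "\<And>b. cpoly (q' b)"
    "\<And>x. (q has_derivative (\<lambda>h. \<Sum>b\<in>Basis. complex_of_real (h \<bullet> b) * q' b x)) (at x)" by blast
  have "((\<lambda>x. p x * q x) has_derivative (\<lambda>h. \<Sum>b\<in>Basis. complex_of_real (h \<bullet> b) * (p' b x * q x + p x * q' b x))) (at x)" for x
    by (rule has_derivative_eq_rhs, rule has_derivative_mult, rule p', rule q')
      (simp add: fun_eq_iff distrib_left sum.distrib sum_distrib_left sum_distrib_right mult_ac)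
  then show ?case using cpoly_mult.hyps by (intro exI[of _ "\<lambda>b x. p' b x * q x + p x * q' b x"]) (simp add: cpoly.intros p' q')
qed

text \<open>Constant and degree are hidden behind an existential quantifier, which lets finitely
  many such bounds be merged into one without tracking degrees.\<close>

definition poly_bounded :: "('a \<Rightarrow> real) \<Rightarrow> ('a \<Rightarrow> real) \<Rightarrow> bool" where
  "poly_bounded f g \<longleftrightarrow> (\<exists>C M. 0 \<le> C \<and> (\<forall>x. f x \<le> C * (1 + g x) ^ M))"

lemma poly_boundedE:
  assumes "poly_bounded f g"
  obtains C M where "0 \<le> C" "\<And>x. f x \<le> C * (1 + g x) ^ M"
  using assms that unfolding poly_bounded_def by metis

lemma poly_boundedI:
  assumes "0 \<le> C" "\<And>x. f x \<le> C * (1 + g x) ^ M"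
  shows "poly_bounded f g"
  using assms unfolding poly_bounded_def by blast

lemma poly_bounded_add:
  assumes "poly_bounded f g" "poly_bounded h g" and g: "\<And>x. 0 \<le> g x"
  shows "poly_bounded (\<lambda>x. f x + h x) g"
proof -
  from assms(1) obtain C M where 1: "0 \<le> C" "\<And>x. f x \<le> C * (1 + g x) ^ M" by (rule poly_boundedE) blast
  from assms(2) obtain D N where 2: "0 \<le> D" "\<And>x. h x \<le> D * (1 + g x) ^ N" by (rule poly_boundedE) blast
  have "f x + h x \<le> (C + D) * (1 + g x) ^ (M + N)" for x
  proof -
    have "C * (1 + g x) ^ M \<le> C * (1 + g x) ^ (M + N)"
      using g[of x] 1(1) by (intro mult_left_mono power_increasing) auto
    moreover have "D * (1 + g x) ^ N \<le> D * (1 + g x) ^ (M + N)"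
      using g[of x] 2(1) by (intro mult_left_mono power_increasing) auto
    ultimately show ?thesis using 1(2)[of x] 2(2)[of x] by (simp add: distrib_right)
  qed
  then show ?thesis using 1(1) 2(1) by (intro poly_boundedI[of "C + D"]) auto
qed

lemma poly_bounded_sum:
  assumes "finite B" "\<And>b. b \<in> B \<Longrightarrow> poly_bounded (f b) g" and "\<And>x. 0 \<le> g x"
  shows "poly_bounded (\<lambda>x. \<Sum>b\<in>B. f b x) g"
  using assms
proof (induction B rule: finite_induct)
  case empty
  show ?case by (rule poly_boundedI[of 0]) auto
next
  case (insert b B)
  then show ?case by (simp add: poly_bounded_add)
qed

lemma cpoly_bound:
  assumes "cpoly q"
  shows "poly_bounded (\<lambda>x. norm (q x)) norm"
  using assms
proof induction
  case (cpoly_const c)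
  show ?case by (rule poly_boundedI[of "norm c" _ _ 0]) auto
next
  case (cpoly_inner b)
  have "norm (complex_of_real (x \<bullet> b)) \<le> norm b * (1 + norm x) ^ 1" for x
    using order_trans[OF Cauchy_Schwarz_ineq2[of x b], of "norm b + norm b * norm x"]
    by (simp add: algebra_simps)
  then show ?case by (rule poly_boundedI[rotated]) auto
next
  case (cpoly_add p q)
  then have "poly_bounded (\<lambda>x. norm (p x) + norm (q x)) norm" by (intro poly_bounded_add) auto
  then obtain C M where 1: "0 \<le> C" "\<And>x. norm (p x) + norm (q x) \<le> C * (1 + norm x) ^ M"
    by (rule poly_boundedE) blast
  show ?case by (rule poly_boundedI[OF 1(1)]) (rule order_trans[OF norm_triangle_ineq 1(2)])
next
  case (cpoly_mult p q)
  from cpoly_mult(3) obtain C M where 1: "0 \<le> C" "\<And>x. norm (p x) \<le> C * (1 + norm x) ^ M" by (rule poly_boundedE) blast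
  from cpoly_mult(4) obtain D N where 2: "0 \<le> D" "\<And>x. norm (q x) \<le> D * (1 + norm x) ^ N" by (rule poly_boundedE) blast
  have "norm (p x * q x) \<le> (C * D) * (1 + norm x) ^ (M + N)" for x
  proof -
    have "norm (p x) * norm (q x) \<le> (C * (1 + norm x) ^ M) * (D * (1 + norm x) ^ N)"
      using 1 2 by (intro mult_mono) auto
    then show ?thesis by (simp add: norm_mult power_add mult_ac)
  qed
  then show ?case using 1(1) 2(1) by (intro poly_boundedI[of "C * D"]) auto
qed

text \<open>With \<open>r = norm u\<close>, \<open>(1 + r) ^ m\<close> is at most
  \<open>exp (m * r)\<close>, and completing the square bounds \<open>m * r - r\<^sup>2\<close> by
  \<open>m\<^sup>2 / 4\<close>.\<close>

lemma gauss_decay: "(1 + norm u) ^ m * norm (gauss u) \<le> exp ((real m)\<^sup>2)"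
proof -
  let ?r = "norm u"
  have "(1 + ?r) ^ m \<le> exp ?r ^ m"
    by (intro power_mono) auto
  then have "(1 + ?r) ^ m * exp (- pi * ?r\<^sup>2) \<le> exp (real m * ?r) * exp (- pi * ?r\<^sup>2)"
    by (intro mult_right_mono) (auto simp: exp_of_nat_mult)
  also have "\<dots> = exp (real m * ?r - pi * ?r\<^sup>2)" by (simp add: exp_add[symmetric])
  also have "\<dots> \<le> exp ((real m)\<^sup>2)"
  proof -
    have "1 * ?r\<^sup>2 \<le> pi * ?r\<^sup>2" using pi_gt3 by (intro mult_right_mono) auto
    moreover have "0 \<le> (?r - real m / 2)\<^sup>2" by simp
    then have "real m * ?r - ?r\<^sup>2 \<le> (real m)\<^sup>2 / 4" by (simp add: power2_diff power_divide mult_ac)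
    moreover have "(real m)\<^sup>2 / 4 \<le> (real m)\<^sup>2" by simp
    ultimately have "real m * ?r - pi * ?r\<^sup>2 \<le> (real m)\<^sup>2" by linarith
    then show ?thesis by simp
  qed
  finally show ?thesis by (simp add: gauss_def power2_norm_eq_inner)
qed

lemma gauss_exp: "gauss u = exp (\<Sum>b\<in>Basis. complex_of_real (- pi) * (complex_of_real (u \<bullet> b) * complex_of_real (u \<bullet> b)))"
  by (simp add: gauss_def euclidean_inner[of u u] sum_distrib_left exp_of_real[symmetric])

text \<open>The polynomial may depend on the phase space variables as well, which makes the class closed
  under all partial derivatives; estimates for its members then hold uniformly in the time variable
  and with polynomial growth in the phase space variables.\<close>

definition tf_class :: "((real ^ 'd::finite) \<times> 'd phase \<Rightarrow> complex) set" where
  "tf_class = {\<lambda>p. q p * cnj (tf_shift (snd p) gauss (fst p)) | q. cpoly q}"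

text \<open>In the joint variables \<open>(t, x, w)\<close> the atom is the exponential of a
  quadratic polynomial. Differentiating it therefore only produces polynomial factors.\<close>

lemma tf_shift_exp:
  obtains Q :: "(real ^ 'd::finite) \<times> 'd phase \<Rightarrow> complex" where "cpoly Q"
    "\<And>p. cnj (tf_shift (snd p) gauss (fst p)) = exp (Q p)"
proof
  \<comment> \<open>The vector \<open>(b, (- b, 0))\<close> picks out the coordinate of
    \<open>t - x\<close> along \<open>b\<close> from the triple \<open>(t, x, w)\<close>.\<close>
  let ?L = "\<lambda>p::(real ^ 'd) \<times> 'd phase. \<lambda>b. complex_of_real (p \<bullet> (b, (- b, 0)))"
  let ?Q = "\<lambda>p::(real ^ 'd) \<times> 'd phase. (\<Sum>b\<in>Basis. (- 2 * pi * \<i>) * (complex_of_real (p \<bullet> (0, (0, b))) * complex_of_real (p \<bullet> (b, (0, 0)))))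
     + (\<Sum>b\<in>Basis. complex_of_real (- pi) * (?L p b * ?L p b))"
  show "cpoly ?Q" by (intro cpoly_add cpoly_sum cpoly_mult cpoly_const cpoly_inner)
  fix p :: "(real ^ 'd) \<times> 'd phase"
  obtain t x w where p: "p = (t, x, w)" by (cases p)
  have "gauss (t - x) = exp (\<Sum>b\<in>Basis. complex_of_real (- pi) * (?L p b * ?L p b))"
    unfolding gauss_exp p by (simp add: inner_diff_left)
  moreover have "cnj (cis (2 * pi * (w \<bullet> t)))
      = exp (\<Sum>b\<in>Basis. (- 2 * pi * \<i>) * (complex_of_real (p \<bullet> (0, (0, b))) * complex_of_real (p \<bullet> (b, (0, 0)))))"
    unfolding p cis_cnj cis_conv_exp exp_cnj
    by (subst euclidean_inner) (simp add: sum_distrib_left sum_negf[symmetric] mult_ac del: sum_negf)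
  moreover have "cnj (gauss (t - x)) = gauss (t - x)" by (simp add: gauss_def)
  ultimately show "cnj (tf_shift (snd p) gauss (fst p)) = exp (?Q p)"
    by (simp add: tf_shift_def exp_add p)
qed

text \<open>The derivative of \<open>q * exp Q\<close> is \<open>(q' + q * Q') * exp Q\<close>,
  whose factor is again a polynomial.\<close>

lemma tf_class_deriv:
  assumes "G \<in> tf_class"
  obtains G' where "\<And>b. G' b \<in> tf_class"
    "\<And>p. (G has_derivative (\<lambda>h. \<Sum>b\<in>Basis. complex_of_real (h \<bullet> b) * G' b p)) (at p)"
proof -
  from assms obtain q where q: "cpoly q" "G = (\<lambda>p. q p * cnj (tf_shift (snd p) gauss (fst p)))"
    unfolding tf_class_def by blast
  obtain Q :: "(real ^ 'a) \<times> 'a phase \<Rightarrow> complex" where Q: "cpoly Q"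
    "\<And>p. cnj (tf_shift (snd p) gauss (fst p)) = exp (Q p)" by (rule tf_shift_exp) blast
  from cpoly_deriv[OF q(1)] obtain q' where q': "\<And>b. cpoly (q' b)"
    "\<And>x. (q has_derivative (\<lambda>h. \<Sum>b\<in>Basis. complex_of_real (h \<bullet> b) * q' b x)) (at x)" by blast
  from cpoly_deriv[OF Q(1)] obtain Q' where Q': "\<And>b. cpoly (Q' b)"
    "\<And>x. (Q has_derivative (\<lambda>h. \<Sum>b\<in>Basis. complex_of_real (h \<bullet> b) * Q' b x)) (at x)" by blast
  let ?G' = "\<lambda>b p. (q' b p + q p * Q' b p) * cnj (tf_shift (snd p) gauss (fst p))"
  have 1: "?G' b \<in> tf_class" for b
    unfolding tf_class_def by (intro CollectI exI[of _ "\<lambda>p. q' b p + q p * Q' b p"] conjI refl cpoly_add cpoly_mult q q' Q')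
  have e: "((\<lambda>p. exp (Q p)) has_derivative (\<lambda>h. (\<Sum>b\<in>Basis. complex_of_real (h \<bullet> b) * Q' b p) * exp (Q p))) (at p)" for p
    by (rule has_derivative_compose[OF Q'(2), of exp "\<lambda>h. h * exp (Q p)", simplified])
      (use DERIV_exp[of "Q p"] in \<open>simp add: has_field_derivative_def mult_commute_abs\<close>)
  have "((\<lambda>p. q p * exp (Q p)) has_derivative (\<lambda>h. \<Sum>b\<in>Basis. complex_of_real (h \<bullet> b) * ?G' b p)) (at p)" for p
    by (rule has_derivative_eq_rhs, rule has_derivative_mult, rule q'(2), rule e)
      (auto simp: fun_eq_iff Q(2) algebra_simps sum.distrib sum_distrib_left)
  then have "(G has_derivative (\<lambda>h. \<Sum>b\<in>Basis. complex_of_real (h \<bullet> b) * ?G' b p)) (at p)" for p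
    unfolding q(2) Q(2) .
  with 1 show ?thesis by (intro that[of ?G'])
qed

lemma tf_class_continuous: "G \<in> tf_class \<Longrightarrow> continuous_on UNIV G"
  by (erule tf_class_deriv) (rule continuous_at_imp_continuous_on, rule ballI, rule has_derivative_continuous)

lemma norm_Pair_le: "norm (a, b) \<le> norm a + norm b"
  by (simp add: norm_Pair sqrt_sum_squares_le_sum)

lemma one_plus_norm_mult: "1 + norm (a + b) \<le> (1 + norm a) * (1 + norm b)"
proof -
  have "norm (a + b) \<le> norm a + norm b" by (rule norm_triangle_ineq)
  moreover have "0 \<le> norm a * norm b" by simp
  moreover have "(1 + norm a) * (1 + norm b) = 1 + norm a + norm b + norm a * norm b" by (simp add: algebra_simps)
  ultimately show ?thesis by linarith
qed

text \<open>The Gaussian decays in \<open>t - x\<close>, not in \<open>t\<close>. Each factor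
  \<open>1 + norm t\<close> is at most \<open>(1 + norm (t - x)) * (1 + norm z)\<close>: the first
  part is absorbed by the Gaussian, the second causes the growth in \<open>z\<close>.\<close>

lemma tf_class_bound:
  assumes "G \<in> tf_class"
  shows "poly_bounded (\<lambda>p. (1 + norm (fst p)) ^ k * norm (G p)) (\<lambda>p. norm (snd p))"
proof -
  from assms obtain q where q: "cpoly q" "G = (\<lambda>p. q p * cnj (tf_shift (snd p) gauss (fst p)))"
    unfolding tf_class_def by blast
  from cpoly_bound[OF q(1)] obtain C n where C: "0 \<le> C" "\<And>p. norm (q p) \<le> C * (1 + norm p) ^ n"
    by (rule poly_boundedE) blast
  have "(1 + norm t) ^ k * norm (G (t, z)) \<le> C * (exp ((real (k + n))\<^sup>2)) * (1 + norm z) ^ (k + n + n)" for t z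
  proof -
    obtain x w where z: "z = (x, w)" by (cases z)
    have "norm x \<le> norm z" unfolding z by (rule norm_fst_le)
    have "1 + norm (t, z) \<le> (1 + norm t) * (1 + norm z)"
      using norm_Pair_le[of t z] mult_nonneg_nonneg[of "norm t" "norm z"]
          by (simp add: algebra_simps del: mult_nonneg_nonneg)
    then have qb: "norm (q (t, z)) \<le> C * ((1 + norm t) * (1 + norm z)) ^ n"
      by (intro order_trans[OF C(2)] mult_left_mono power_mono C(1)) auto
    have t: "1 + norm t \<le> (1 + norm (t - x)) * (1 + norm z)"
    proof -
      have "1 + norm t \<le> (1 + norm (t - x)) * (1 + norm x)" using one_plus_norm_mult[of "t - x" x] by simp
      also have "\<dots> \<le> (1 + norm (t - x)) * (1 + norm z)" using \<open>norm x \<le> norm z\<close> by (intro mult_left_mono) auto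
      finally show ?thesis .
    qed
    have "(1 + norm t) ^ k * norm (G (t, z)) = (1 + norm t) ^ k * norm (q (t, z)) * norm (gauss (t - x))"
      by (simp add: q(2) norm_mult tf_shift_def z)
    also have "\<dots> \<le> (1 + norm t) ^ k * (C * ((1 + norm t) * (1 + norm z)) ^ n) * norm (gauss (t - x))"
      using qb by (intro mult_right_mono mult_left_mono) auto
    also have "\<dots> = C * (1 + norm z) ^ n * norm (gauss (t - x)) * (1 + norm t) ^ (k + n)"
      by (simp add: power_mult_distrib power_add mult_ac)
    also have "\<dots> \<le> C * (1 + norm z) ^ n * norm (gauss (t - x)) * ((1 + norm (t - x)) * (1 + norm z)) ^ (k + n)"
      using t C(1) by (intro mult_left_mono power_mono mult_nonneg_nonneg) auto
    also have "\<dots> = C * (1 + norm z) ^ (k + n + n) * ((1 + norm (t - x)) ^ (k + n) * norm (gauss (t - x)))"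
      by (simp add: power_mult_distrib power_add mult_ac)
    also have "\<dots> \<le> C * (1 + norm z) ^ (k + n + n) * (exp ((real (k + n))\<^sup>2))"
      by (intro mult_left_mono mult_nonneg_nonneg gauss_decay C(1)) auto
    finally show ?thesis by (simp add: mult_ac)
  qed
  then show ?thesis using C(1) by (intro poly_boundedI[of "C * (exp ((real (k + n))\<^sup>2))"]) auto
qed

lemma onorm_sum_Basis_le:
  fixes c :: "'a::euclidean_space \<Rightarrow> complex"
  shows "onorm (\<lambda>h. \<Sum>b\<in>Basis. complex_of_real (h \<bullet> b) * c b) \<le> (\<Sum>b\<in>Basis. norm (c b))"
proof (rule onorm_le)
  fix h :: 'a
  have "norm (\<Sum>b\<in>Basis. complex_of_real (h \<bullet> b) * c b) \<le> (\<Sum>b\<in>Basis. norm (c b) * norm h)"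
    by (intro sum_norm_le) (auto simp: norm_mult mult.commute[of "norm (c _)"] intro!: mult_right_mono Basis_le_norm)
  then show "norm (\<Sum>b\<in>Basis. complex_of_real (h \<bullet> b) * c b) \<le> (\<Sum>b\<in>Basis. norm (c b)) * norm h"
    by (simp add: sum_distrib_right)
qed

text \<open>The mean value inequality with the bounds for the partial derivatives, which are in the
  same class. The case \<open>s = t\<close> compares two atoms in a weighted norm; the case
  \<open>z = y\<close> yields the Taylor estimate.\<close>

lemma tf_class_lipschitz:
  fixes G :: "(real ^ 'd::finite) \<times> 'd phase \<Rightarrow> complex"
  assumes "G \<in> tf_class"
  obtains C M where "0 \<le> C" "\<And>t s z y. norm (s - t) \<le> 1 \<Longrightarrow>
    (1 + norm t) ^ k * norm (G (s, z) - G (t, y)) \<le> C * (1 + norm z + norm y) ^ M * (norm (s - t) + norm (z - y))"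
proof -
  obtain G' where G': "\<And>b. G' b \<in> tf_class"
    "\<And>p. (G has_derivative (\<lambda>h. \<Sum>b\<in>Basis. complex_of_real (h \<bullet> b) * G' b p)) (at p)"
    by (rule tf_class_deriv[OF assms]) blast
  have "poly_bounded (\<lambda>p. \<Sum>b\<in>Basis. (1 + norm (fst p)) ^ k * norm (G' b p)) (\<lambda>p. norm (snd p))"
    by (intro poly_bounded_sum tf_class_bound G'(1)) auto
  then obtain C M where C: "0 \<le> C"
    "\<And>p. (\<Sum>b\<in>Basis. (1 + norm (fst p)) ^ k * norm (G' b p)) \<le> C * (1 + norm (snd p)) ^ M"
    by (rule poly_boundedE) blast
  have "(1 + norm t) ^ k * norm (G (s, z) - G (t, y))
      \<le> (2 ^ k * C) * (1 + norm z + norm y) ^ M * (norm (s - t) + norm (z - y))"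
    if st: "norm (s - t) \<le> 1" for t s z y
  proof -
    define B where "B = 2 ^ k * C * (1 + norm z + norm y) ^ M / (1 + norm t) ^ k"
    have B0: "0 \<le> B" using C(1) by (auto simp: B_def)
    \<comment> \<open>A convex set that contains both points. For time components within distance 1
      of \<open>t\<close> the quantity \<open>1 + norm t\<close> at most doubles, which is the
      source of \<open>2 ^ k\<close>.\<close>
    let ?S = "cball t 1 \<times> cball 0 (norm z + norm y)"
    have on: "onorm (\<lambda>h. \<Sum>b\<in>Basis. complex_of_real (h \<bullet> b) * G' b p) \<le> B" if "p \<in> ?S" for p
    proof -
      from that have p: "norm (t - fst p) \<le> 1" "norm (snd p) \<le> norm z + norm y"
        by (simp_all add: mem_Times_iff dist_norm)
      have "norm t \<le> norm (fst p) + 1" using p(1) norm_triangle_ineq2[of t "fst p"] by linarith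
      then have "1 + norm t \<le> 2 * (1 + norm (fst p))" by (smt (verit) norm_ge_zero)
      then have "(1 + norm t) ^ k \<le> (2 * (1 + norm (fst p))) ^ k" by (intro power_mono) auto
      then have "(1 + norm t) ^ k * (\<Sum>b\<in>Basis. norm (G' b p))
          \<le> (2 * (1 + norm (fst p))) ^ k * (\<Sum>b\<in>Basis. norm (G' b p))"
        by (intro mult_right_mono sum_nonneg) auto
      also have "\<dots> = 2 ^ k * (\<Sum>b\<in>Basis. (1 + norm (fst p)) ^ k * norm (G' b p))"
        by (simp only: power_mult_distrib sum_distrib_left mult.assoc)
      also have "\<dots> \<le> 2 ^ k * (C * (1 + norm (snd p)) ^ M)" by (intro mult_left_mono C(2)) auto
      also have "\<dots> \<le> 2 ^ k * (C * (1 + norm z + norm y) ^ M)"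
        using p(2) C(1) by (intro mult_left_mono power_mono) auto
      finally have "(\<Sum>b\<in>Basis. norm (G' b p)) \<le> B"
        unfolding B_def by (simp add: field_simps pos_le_divide_eq add_pos_nonneg)
      then show ?thesis by (rule order_trans[OF onorm_sum_Basis_le])
    qed
    have "norm (G (s, z) - G (t, y)) \<le> B * norm ((s, z) - (t, y))"
      by (rule differentiable_bound[of ?S, OF _ has_derivative_at_withinI[OF G'(2)] on])
        (use st in \<open>simp_all add: convex_Times mem_Times_iff dist_norm norm_minus_commute[of t]\<close>)
    also have "\<dots> \<le> B * (norm (s - t) + norm (z - y))"
      using B0 norm_Pair_le[of "s - t" "z - y"] by (intro mult_left_mono) auto
    finally have "(1 + norm t) ^ k * norm (G (s, z) - G (t, y))
        \<le> (1 + norm t) ^ k * (B * (norm (s - t) + norm (z - y)))"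
      by (intro mult_left_mono) auto
    moreover have "(1 + norm t) ^ k * B = 2 ^ k * C * (1 + norm z + norm y) ^ M"
      using norm_ge_zero[of t] unfolding B_def by (simp del: norm_ge_zero)
    ultimately show ?thesis by (simp add: mult.assoc[symmetric])
  qed
  then show ?thesis using C(1) by (intro that[of "2 ^ k * C"]) auto
qed

text \<open>Only time moves, so the first derivatives vary by at most a multiple of the time step,
  with a factor polynomial in \<open>z\<close>. The quadratic remainder has the same kind of factor,
  which is what differentiation under a phase space integral needs.\<close>

lemma tf_class_taylor:
  fixes G :: "(real ^ 'd::finite) \<times> 'd phase \<Rightarrow> complex"
  assumes "\<And>b. G' b \<in> tf_class"
    "\<And>p. (G has_derivative (\<lambda>h. \<Sum>b\<in>Basis. complex_of_real (h \<bullet> b) * G' b p)) (at p)"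
  obtains C M where "0 \<le> C" "\<And>t s z. norm (s - t) \<le> 1 \<Longrightarrow>
    norm (G (s, z) - G (t, z) - (\<Sum>b\<in>Basis. complex_of_real ((s - t, 0) \<bullet> b) * G' b (t, z)))
        \<le> C * (1 + norm z) ^ M * (norm (s - t))\<^sup>2"
proof -
  have "\<exists>C M. 0 \<le> C \<and> (\<forall>t s z. norm (s - t) \<le> 1 \<longrightarrow>
      norm (G' b (s, z) - G' b (t, z)) \<le> C * (1 + 2 * norm z) ^ M * norm (s - t))" for b
  proof -
    obtain C M where "0 \<le> C" "\<And>t s z y. norm (s - t) \<le> 1 \<Longrightarrow>
      (1 + norm t) ^ 0 * norm (G' b (s, z) - G' b (t, y))
          \<le> C * (1 + norm z + norm y) ^ M * (norm (s - t) + norm (z - y))"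
      by (rule tf_class_lipschitz[OF assms(1)]) blast
    from this(1) this(2)[where z=z and y=z for z] show ?thesis
      by (intro exI[of _ C] exI[of _ M]) (auto simp: algebra_simps)
  qed
  then obtain C M where C: "\<And>b. 0 \<le> C b" "\<And>b t s z. norm (s - t) \<le> 1 \<Longrightarrow>
      norm (G' b (s, z) - G' b (t, z)) \<le> C b * (1 + 2 * norm z) ^ M b * norm (s - t)" by metis
  \<comment> \<open>One exponent for all basis directions: the sum dominates every
    \<open>M b\<close>. The power of 2 in \<open>D\<close> comes from
    \<open>1 + 2 * norm z \<le> 2 * (1 + norm z)\<close>.\<close>
  define N where "N = (\<Sum>b\<in>Basis. M b)"
  define D where "D = (\<Sum>b\<in>Basis. C b) * 2 ^ N"
  have D0: "0 \<le> D" unfolding D_def using C(1) by (intro mult_nonneg_nonneg sum_nonneg) auto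
  have "norm (G (s, z) - G (t, z) - (\<Sum>b\<in>Basis. complex_of_real ((s - t, 0) \<bullet> b) * G' b (t, z)))
      \<le> D * (1 + norm z) ^ N * (norm (s - t))\<^sup>2"
    if st: "norm (s - t) \<le> 1" for t s z
  proof -
    let ?f = "\<lambda>p h. \<Sum>b\<in>Basis. complex_of_real (h \<bullet> b) * G' b p"
    define B where "B = D * (1 + norm z) ^ N * norm (s - t)"
    have on: "onorm (?f p - ?f (t, z)) \<le> B" if p: "p \<in> cball t (norm (s - t)) \<times> {z}" for p
    proof -
      from p obtain r where p: "p = (r, z)" "norm (r - t) \<le> norm (s - t)"
        by (cases p) (auto simp: dist_norm norm_minus_commute)
      have "?f p - ?f (t, z) = (\<lambda>h. \<Sum>b\<in>Basis. complex_of_real (h \<bullet> b) * (G' b p - G' b (t, z)))"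
        by (auto simp: fun_eq_iff sum_subtractf algebra_simps)
      then have "onorm (?f p - ?f (t, z)) \<le> (\<Sum>b\<in>Basis. norm (G' b p - G' b (t, z)))"
        using onorm_sum_Basis_le[of "\<lambda>b. G' b p - G' b (t, z)"] by simp
      also have "\<dots> \<le> (\<Sum>b\<in>Basis. C b * (2 ^ N * (1 + norm z) ^ N * norm (s - t)))"
      proof (rule sum_mono)
        fix b :: "(real ^ 'd) \<times> 'd phase" assume b: "b \<in> Basis"
        have "norm (G' b p - G' b (t, z)) \<le> C b * (1 + 2 * norm z) ^ M b * norm (r - t)"
          using C(2) p st by auto
        also have "\<dots> \<le> C b * (2 * (1 + norm z)) ^ N * norm (s - t)"
        proof (intro mult_mono mult_left_mono C(1) p(2) mult_nonneg_nonneg)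
          have "(1 + 2 * norm z) ^ M b \<le> (2 * (1 + norm z)) ^ M b" by (intro power_mono) auto
          also have "\<dots> \<le> (2 * (1 + norm z)) ^ N"
            using b member_le_sum[of b Basis M] norm_ge_zero[of z] unfolding N_def
                by (intro power_increasing) (auto simp del: norm_ge_zero)
          finally show "(1 + 2 * norm z) ^ M b \<le> (2 * (1 + norm z)) ^ N" .
        qed auto
        finally show "norm (G' b p - G' b (t, z)) \<le> C b * (2 ^ N * (1 + norm z) ^ N * norm (s - t))"
          by (simp only: power_mult_distrib mult.assoc)
      qed
      also have "\<dots> = B" unfolding B_def D_def by (simp add: sum_distrib_right mult.assoc)
      finally show ?thesis .
    qed
    have "norm (G (s, z) - G (t, z) - ?f (t, z) ((s, z) - (t, z))) \<le> norm ((s, z) - (t, z)) * B"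
    proof (rule differentiable_bound_linearization[of _ _ "cball t (norm (s - t)) \<times> {z}" G ?f])
      show "onorm (?f p - ?f (t, z)) \<le> B" if "p \<in> cball t (norm (s - t)) \<times> {z}" for p
        using on that .
      show "(G has_derivative ?f p) (at p within cball t (norm (s - t)) \<times> {z})" for p
        by (rule has_derivative_at_withinI[OF assms(2)])
    qed (auto simp: dist_norm intro: mult_left_le_one_le)
    moreover have "norm ((s, z) - (t, z)) = norm (s - t)" by (simp add: norm_Pair)
    ultimately show ?thesis unfolding B_def by (simp add: power2_eq_square mult_ac)
  qed
  with D0 show ?thesis by (rule that)
qed

section \<open>Schwartz space and tempered distributions\<close>

lemma iter_partial_Nil [simp]: "iter_partial [] f = f"
  by (simp add: iter_partial_def)

lemma iter_partial_Cons: "iter_partial (i # is) f = partial_deriv i (iter_partial is f)"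
  by (simp add: iter_partial_def)

lemma smoothD: "smooth f \<Longrightarrow> iter_partial is f differentiable (at x)"
  by (simp add: smooth_def)

lemma smooth_has_derivative:
  "smooth f \<Longrightarrow> (iter_partial is f has_derivative frechet_derivative (iter_partial is f) (at x)) (at x)"
  using frechet_derivative_works smoothD by blast

lemma iter_partial_add:
  assumes "smooth f" "smooth g"
  shows "iter_partial is (\<lambda>x. f x + g x) = (\<lambda>x. iter_partial is f x + iter_partial is g x)"
proof (induction "is")
  case (Cons i "is")
  have "partial_deriv i (\<lambda>x. iter_partial is f x + iter_partial is g x) x =
      partial_deriv i (iter_partial is f) x + partial_deriv i (iter_partial is g) x" for x
    unfolding partial_deriv_def
    by (simp add: frechet_derivative_at[OF has_derivative_add[OF smooth_has_derivative[OF assms(1)] smooth_has_derivative[OF assms(2)]], symmetric])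
  then show ?case by (simp add: iter_partial_Cons Cons fun_eq_iff)
qed simp

lemma iter_partial_cmult:
  assumes "smooth f"
  shows "iter_partial is (\<lambda>x. c * f x) = (\<lambda>x. c * iter_partial is f x)"
proof (induction "is")
  case (Cons i "is")
  have "partial_deriv i (\<lambda>x. c * iter_partial is f x) x = c * partial_deriv i (iter_partial is f) x" for x
    unfolding partial_deriv_def
    by (simp add: frechet_derivative_at[OF has_derivative_mult_right[OF smooth_has_derivative[OF assms(1)]], symmetric])
  then show ?case by (simp add: iter_partial_Cons Cons fun_eq_iff)
qed simp

lemma smooth_add: "smooth f \<Longrightarrow> smooth g \<Longrightarrow> smooth (\<lambda>x. f x + g x)"
  unfolding smooth_def[of "\<lambda>x. f x + g x"] by (auto simp: iter_partial_add intro: differentiable_add smoothD)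

lemma smooth_cmult: "smooth f \<Longrightarrow> smooth (\<lambda>x. c * f x)"
  unfolding smooth_def[of "\<lambda>x. c * f x"] by (auto simp: iter_partial_cmult intro: differentiable_mult smoothD)

lemma schwartz_smooth: "\<phi> \<in> schwartz_space \<Longrightarrow> smooth \<phi>"
  by (simp add: schwartz_space_def)

lemma schwartz_bound:
  assumes "\<phi> \<in> schwartz_space"
  shows "(1 + norm x) ^ k * norm (iter_partial is \<phi> x) \<le> schwartz_seminorm k is \<phi>"
  using assms unfolding schwartz_seminorm_def schwartz_space_def by (intro cSUP_upper) auto

lemma schwartz_seminorm_least:
  assumes "\<And>x. (1 + norm x) ^ k * norm (iter_partial is \<phi> x) \<le> B"
  shows "schwartz_seminorm k is \<phi> \<le> B"
  unfolding schwartz_seminorm_def using assms by (intro cSUP_least) auto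

lemma schwartz_seminorm_nonneg:
  assumes "\<phi> \<in> schwartz_space"
  shows "0 \<le> schwartz_seminorm k is \<phi>"
  by (rule order_trans[OF _ schwartz_bound[OF assms, of 0]]) auto

lemma schwartz_spaceI:
  assumes "smooth \<phi>" "\<And>k is. \<exists>B. \<forall>x. (1 + norm x) ^ k * norm (iter_partial is \<phi> x) \<le> B"
  shows "\<phi> \<in> schwartz_space"
  unfolding schwartz_space_def bdd_above_def using assms by auto

lemma schwartz_add_bound:
  assumes "\<phi> \<in> schwartz_space" "\<psi> \<in> schwartz_space"
  shows "(1 + norm x) ^ k * norm (iter_partial is (\<lambda>x. \<phi> x + \<psi> x) x)
      \<le> schwartz_seminorm k is \<phi> + schwartz_seminorm k is \<psi>"
proof -
  have "(1 + norm x) ^ k * norm (iter_partial is (\<lambda>x. \<phi> x + \<psi> x) x)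
     \<le> (1 + norm x) ^ k * (norm (iter_partial is \<phi> x) + norm (iter_partial is \<psi> x))"
    using assms by (simp add: iter_partial_add schwartz_smooth norm_triangle_ineq mult_left_mono)
  also have "\<dots> \<le> schwartz_seminorm k is \<phi> + schwartz_seminorm k is \<psi>"
    unfolding distrib_left by (intro add_mono schwartz_bound assms)
  finally show ?thesis .
qed

lemma schwartz_add [intro]:
  assumes "\<phi> \<in> schwartz_space" "\<psi> \<in> schwartz_space"
  shows "(\<lambda>x. \<phi> x + \<psi> x) \<in> schwartz_space"
  by (rule schwartz_spaceI) (auto intro: smooth_add schwartz_smooth assms schwartz_add_bound[OF assms])

lemma schwartz_seminorm_add:
  assumes "\<phi> \<in> schwartz_space" "\<psi> \<in> schwartz_space"
  shows "schwartz_seminorm k is (\<lambda>x. \<phi> x + \<psi> x) \<le> schwartz_seminorm k is \<phi> + schwartz_seminorm k is \<psi>"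
  by (intro schwartz_seminorm_least schwartz_add_bound assms)

lemma schwartz_cmult_bound:
  assumes "\<phi> \<in> schwartz_space"
  shows "(1 + norm x) ^ k * norm (iter_partial is (\<lambda>x. c * \<phi> x) x) \<le> norm c * schwartz_seminorm k is \<phi>"
  using mult_left_mono[OF schwartz_bound[OF assms, of x k "is"], of "norm c"] assms
  by (simp add: iter_partial_cmult schwartz_smooth norm_mult mult_ac)

lemma schwartz_cmult [intro]:
  assumes "\<phi> \<in> schwartz_space"
  shows "(\<lambda>x. c * \<phi> x) \<in> schwartz_space"
  by (rule schwartz_spaceI) (auto intro: smooth_cmult schwartz_smooth assms schwartz_cmult_bound[OF assms])

lemma schwartz_seminorm_cmult:
  assumes "\<phi> \<in> schwartz_space"
  shows "schwartz_seminorm k is (\<lambda>x. c * \<phi> x) \<le> norm c * schwartz_seminorm k is \<phi>"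
  by (intro schwartz_seminorm_least schwartz_cmult_bound assms)

lemma schwartz_diff [intro]:
  assumes "\<phi> \<in> schwartz_space" "\<psi> \<in> schwartz_space"
  shows "(\<lambda>x. \<phi> x - \<psi> x) \<in> schwartz_space"
  using schwartz_add[OF assms(1) schwartz_cmult[OF assms(2), of "-1"]] by simp

lemma iter_partial_diff:
  assumes "smooth f" "smooth g"
  shows "iter_partial is (\<lambda>x. f x - g x) = (\<lambda>x. iter_partial is f x - iter_partial is g x)"
  using iter_partial_add[OF assms(1) smooth_cmult[OF assms(2), of "-1"]] iter_partial_cmult[OF assms(2), of _ "-1"] by simp

lemma schwartz_zero [intro, simp]: "(\<lambda>x. 0) \<in> schwartz_space"
proof -
  have 0: "iter_partial is (\<lambda>x::real^'a. 0 :: complex) = (\<lambda>x. 0)" for "is"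
    by (induction "is") (auto simp: iter_partial_Cons partial_deriv_def frechet_derivative_const)
  show ?thesis by (intro schwartz_spaceI) (auto simp: smooth_def 0)
qed

lemma schwartz_sum [intro]:
  assumes "\<And>i. i \<in> I \<Longrightarrow> \<phi> i \<in> schwartz_space"
  shows "(\<lambda>x. \<Sum>i\<in>I. \<phi> i x) \<in> schwartz_space"
  using assms by (induction I rule: infinite_finite_induct) auto

lemma iter_partial_sum:
  assumes "\<And>i. i \<in> I \<Longrightarrow> \<phi> i \<in> schwartz_space"
  shows "iter_partial is (\<lambda>x. \<Sum>i\<in>I. \<phi> i x) = (\<lambda>x. \<Sum>i\<in>I. iter_partial is (\<phi> i) x)"
  using assms
proof (induction I rule: infinite_finite_induct)
  case (insert i I)
  then show ?case by (simp add: iter_partial_add schwartz_smooth schwartz_sum)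
next
  case empty
  show ?case using iter_partial_cmult[OF schwartz_smooth[OF schwartz_zero], of "is" 0] by simp
next
  case (infinite A)
  then show ?case using iter_partial_cmult[OF schwartz_smooth[OF schwartz_zero], of "is" 0] by simp
qed

text \<open>An increasing sequence of seminorms that dominates the whole family indexed by weights
  and multi-indices; a single one of them then describes a neighbourhood or the continuity of a
  functional.\<close>

definition total_seminorm :: "nat \<Rightarrow> (real ^ 'd::finite \<Rightarrow> complex) \<Rightarrow> real" where
  "total_seminorm n \<phi> = (\<Sum>is\<in>{is. length is \<le> n}. schwartz_seminorm n is \<phi>)"

lemma finite_multiindices: "finite {is :: 'd::finite list. length is \<le> n}"
  using finite_lists_length_le[of "UNIV :: 'd set" n] by simp

lemma total_seminorm_nonneg: "\<phi> \<in> schwartz_space \<Longrightarrow> 0 \<le> total_seminorm n \<phi>"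
  unfolding total_seminorm_def by (intro sum_nonneg schwartz_seminorm_nonneg)

lemma total_seminorm_cmult:
  "\<phi> \<in> schwartz_space \<Longrightarrow> total_seminorm n (\<lambda>x. c * \<phi> x) \<le> norm c * total_seminorm n \<phi>"
  unfolding total_seminorm_def sum_distrib_left by (intro sum_mono schwartz_seminorm_cmult)

lemma schwartz_seminorm_le_total:
  assumes "\<phi> \<in> schwartz_space" "k \<le> n" "length is \<le> n"
  shows "schwartz_seminorm k is \<phi> \<le> total_seminorm n \<phi>"
proof -
  have "schwartz_seminorm k is \<phi> \<le> schwartz_seminorm n is \<phi>"
  proof (rule schwartz_seminorm_least)
    fix x
    have "(1 + norm x) ^ k * norm (iter_partial is \<phi> x) \<le> (1 + norm x) ^ n * norm (iter_partial is \<phi> x)"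
      using assms(2) by (intro mult_right_mono power_increasing) auto
    also have "\<dots> \<le> schwartz_seminorm n is \<phi>" by (rule schwartz_bound[OF assms(1)])
    finally show "(1 + norm x) ^ k * norm (iter_partial is \<phi> x) \<le> schwartz_seminorm n is \<phi>" .
  qed
  also have "\<dots> \<le> total_seminorm n \<phi>"
    unfolding total_seminorm_def using assms
    by (intro member_le_sum[where f="\<lambda>is. schwartz_seminorm n is \<phi>"] finite_multiindices schwartz_seminorm_nonneg) auto
  finally show ?thesis .
qed

lemma total_seminorm_mono:
  assumes "\<phi> \<in> schwartz_space" "m \<le> n"
  shows "total_seminorm m \<phi> \<le> total_seminorm n \<phi>"
proof -
  have "total_seminorm m \<phi> \<le> (\<Sum>is\<in>{is. length is \<le> m}. schwartz_seminorm n is \<phi>)"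
    unfolding total_seminorm_def
  proof (intro sum_mono schwartz_seminorm_least)
    fix x and "is" :: "'a list"
    have "(1 + norm x) ^ m * norm (iter_partial is \<phi> x) \<le> (1 + norm x) ^ n * norm (iter_partial is \<phi> x)"
      using assms(2) by (intro mult_right_mono power_increasing) auto
    also have "\<dots> \<le> schwartz_seminorm n is \<phi>" by (rule schwartz_bound[OF assms(1)])
    finally show "(1 + norm x) ^ m * norm (iter_partial is \<phi> x) \<le> schwartz_seminorm n is \<phi>" .
  qed
  also have "\<dots> \<le> total_seminorm n \<phi>"
    unfolding total_seminorm_def using assms
    by (intro sum_mono2 finite_multiindices schwartz_seminorm_nonneg) auto
  finally show ?thesis .
qed

section \<open>Neighbourhoods in Schwartz space and the boundedness of tempered
  distributions\<close>

abbreviation schwartz_subbasis :: "(real ^ 'd::finite \<Rightarrow> complex) set set" where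
  "schwartz_subbasis \<equiv> {{\<psi> \<in> schwartz_space. schwartz_seminorm k is (\<lambda>t. \<psi> t - \<phi> t) < e} | \<phi> k is e. \<phi> \<in> schwartz_space}"

lemma schwartz_seminorm_zero: "schwartz_seminorm k is (\<lambda>t. 0) \<le> 0"
  using schwartz_seminorm_cmult[OF schwartz_zero, of k "is" 0] by simp

lemma topspace_schwartz: "topspace schwartz_topology = schwartz_space"
proof
  show "topspace schwartz_topology \<subseteq> schwartz_space"
    unfolding schwartz_topology_def by auto
  show "schwartz_space \<subseteq> topspace (schwartz_topology :: (real ^ 'd \<Rightarrow> complex) topology)"
  proof
    fix \<phi> :: "real ^ 'd \<Rightarrow> complex" assume "\<phi> \<in> schwartz_space"
    then have "\<phi> \<in> {\<psi> \<in> schwartz_space. schwartz_seminorm 0 [] (\<lambda>t. \<psi> t - \<phi> t) < 1}"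
      using schwartz_seminorm_zero[of 0 "[]"] by (auto intro: order_le_less_trans)
    with \<open>\<phi> \<in> schwartz_space\<close> show "\<phi> \<in> topspace schwartz_topology"
      unfolding schwartz_topology_def topology_generated_by_topspace by blast
  qed
qed

text \<open>The generating sets are seminorm balls about arbitrary centres. The triangle inequality
  puts a ball centred at \<phi> inside each of them, and the property survives finite intersections
  and unions.\<close>

lemma openin_schwartz_ball:
  assumes "openin schwartz_topology U" "\<phi> \<in> U"
  obtains n e where "0 < e" "\<And>\<psi>. \<psi> \<in> schwartz_space \<Longrightarrow> total_seminorm n (\<lambda>t. \<psi> t - \<phi> t) < e \<Longrightarrow> \<psi> \<in> U"
proof -
  have sub: "U \<subseteq> schwartz_space" if "generate_topology_on schwartz_subbasis U" for U :: "(real ^ 'a \<Rightarrow> complex) set"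
    using that by induction auto
  have "generate_topology_on schwartz_subbasis U"
    using assms(1) by (simp add: schwartz_topology_def openin_topology_generated_by_iff)
  then have "\<forall>\<phi>\<in>U. \<exists>n e. 0 < e \<and> (\<forall>\<psi>\<in>schwartz_space. total_seminorm n (\<lambda>t. \<psi> t - \<phi> t) < e \<longrightarrow> \<psi> \<in> U)"
  proof induction
    case Empty
    then show ?case by simp
  next
    case (Int A B)
    show ?case
    proof
      fix \<phi> assume p: "\<phi> \<in> A \<inter> B"
      then have S: "\<phi> \<in> schwartz_space" using sub[OF Int.hyps(1)] by auto
      obtain n e where 1: "0 < e" "\<And>\<psi>. \<psi> \<in> schwartz_space \<Longrightarrow> total_seminorm n (\<lambda>t. \<psi> t - \<phi> t) < e \<Longrightarrow> \<psi> \<in> A"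
        using Int.IH(1) p by blast
      obtain m d where 2: "0 < d" "\<And>\<psi>. \<psi> \<in> schwartz_space \<Longrightarrow> total_seminorm m (\<lambda>t. \<psi> t - \<phi> t) < d \<Longrightarrow> \<psi> \<in> B"
        using Int.IH(2) p by blast
      have "\<psi> \<in> A \<inter> B" if "\<psi> \<in> schwartz_space" "total_seminorm (max n m) (\<lambda>t. \<psi> t - \<phi> t) < min e d" for \<psi>
        using that 1(2) 2(2) total_seminorm_mono[OF schwartz_diff[OF that(1) S], of n "max n m"]
          total_seminorm_mono[OF schwartz_diff[OF that(1) S], of m "max n m"] by auto
      then show "\<exists>n e. 0 < e \<and> (\<forall>\<psi>\<in>schwartz_space. total_seminorm n (\<lambda>t. \<psi> t - \<phi> t) < e \<longrightarrow> \<psi> \<in> A \<inter> B)"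
        using 1(1) 2(1) by (intro exI[of _ "max n m"] exI[of _ "min e d"]) auto
    qed
  next
    case (UN K)
    show ?case
    proof
      fix \<phi> assume "\<phi> \<in> \<Union>K"
      then obtain k where k: "k \<in> K" "\<phi> \<in> k" by blast
      from UN.IH[OF k(1)] k(2) obtain n e where 1: "0 < e" "\<And>\<psi>. \<psi> \<in> schwartz_space \<Longrightarrow>
          total_seminorm n (\<lambda>t. \<psi> t - \<phi> t) < e \<Longrightarrow> \<psi> \<in> k"
        by blast
      then show "\<exists>n e. 0 < e \<and> (\<forall>\<psi>\<in>schwartz_space. total_seminorm n (\<lambda>t. \<psi> t - \<phi> t) < e \<longrightarrow> \<psi> \<in> \<Union>K)"
        using k(1) by blast
    qed
  next
    case (Basis s)
    then obtain \<phi>0 k "is" e where s: "s = {\<psi> \<in> schwartz_space. schwartz_seminorm k is (\<lambda>t. \<psi> t - \<phi>0 t) < e}" "\<phi>0 \<in> schwartz_space"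
      by blast
    show ?case
    proof
      fix \<phi> assume "\<phi> \<in> s"
      then have p: "\<phi> \<in> schwartz_space" "schwartz_seminorm k is (\<lambda>t. \<phi> t - \<phi>0 t) < e" using s by auto
      let ?d = "e - schwartz_seminorm k is (\<lambda>t. \<phi> t - \<phi>0 t)"
      let ?n = "max k (length is)"
      have "\<psi> \<in> s" if q: "\<psi> \<in> schwartz_space" "total_seminorm ?n (\<lambda>t. \<psi> t - \<phi> t) < ?d" for \<psi>
      proof -
        have "schwartz_seminorm k is (\<lambda>t. (\<psi> t - \<phi> t) + (\<phi> t - \<phi>0 t))
            \<le> schwartz_seminorm k is (\<lambda>t. \<psi> t - \<phi> t) + schwartz_seminorm k is (\<lambda>t. \<phi> t - \<phi>0 t)"
          by (intro schwartz_seminorm_add schwartz_diff p q s)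
        moreover have "schwartz_seminorm k is (\<lambda>t. \<psi> t - \<phi> t) \<le> total_seminorm ?n (\<lambda>t. \<psi> t - \<phi> t)"
          by (intro schwartz_seminorm_le_total schwartz_diff p q) auto
        ultimately show ?thesis using q s(1) by simp
      qed
      then show "\<exists>n e. 0 < e \<and> (\<forall>\<psi>\<in>schwartz_space. total_seminorm n (\<lambda>t. \<psi> t - \<phi> t) < e \<longrightarrow> \<psi> \<in> s)"
        using p(2) by (intro exI[of _ ?n] exI[of _ ?d]) auto
    qed
  qed
  then show ?thesis using assms(2) that by metis
qed

lemma schwartz_ball_openin:
  fixes U :: "(real ^ 'd::finite \<Rightarrow> complex) set"
  assumes "U \<subseteq> schwartz_space"
    and "\<And>\<phi>. \<phi> \<in> U \<Longrightarrow> \<exists>n e. 0 < e \<and> (\<forall>\<psi>\<in>schwartz_space. total_seminorm n (\<lambda>t. \<psi> t - \<phi> t) < e \<longrightarrow> \<psi> \<in> U)"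
  shows "openin schwartz_topology U"
proof (subst openin_subopen, intro ballI)
  fix \<phi> assume "\<phi> \<in> U"
  then have S: "\<phi> \<in> schwartz_space" using assms by blast
  from assms(2)[OF \<open>\<phi> \<in> U\<close>] obtain n e where e: "0 < e"
    "\<And>\<psi>. \<psi> \<in> schwartz_space \<Longrightarrow> total_seminorm n (\<lambda>t. \<psi> t - \<phi> t) < e \<Longrightarrow> \<psi> \<in> U" by blast
  let ?I = "{is :: 'd list. length is \<le> n}"
  \<comment> \<open>The radius \<open>e\<close> is shared equally among the finitely many
    multi-indices in the sum, so membership in all these balls makes the total less than
    \<open>e\<close>.\<close>
  let ?B = "\<lambda>is. {\<psi> \<in> schwartz_space. schwartz_seminorm n is (\<lambda>t. \<psi> t - \<phi> t) < e / (card ?I)}"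
  have I: "finite ?I" "?I \<noteq> {}" using finite_multiindices by (auto intro!: exI[of _ "[]"])
  then have c: "real (card ?I) > 0" by (simp add: card_gt_0_iff)
  have "openin schwartz_topology (\<Inter>is\<in>?I. ?B is)"
    using S by (intro openin_INT2 I) (auto simp: schwartz_topology_def intro!: topology_generated_by_Basis)
  moreover have "\<phi> \<in> (\<Inter>is\<in>?I. ?B is)"
    using S e(1) c schwartz_seminorm_zero by (auto intro!: order_le_less_trans[OF schwartz_seminorm_zero])
  moreover have "(\<Inter>is\<in>?I. ?B is) \<subseteq> U"
  proof
    fix \<psi> assume p: "\<psi> \<in> (\<Inter>is\<in>?I. ?B is)"
    then have "\<psi> \<in> schwartz_space" using I(2) by blast
    moreover have "total_seminorm n (\<lambda>t. \<psi> t - \<phi> t) < (\<Sum>is\<in>?I. e / card ?I)"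
      unfolding total_seminorm_def using p I by (intro sum_strict_mono) auto
    moreover have "(\<Sum>is\<in>?I. e / card ?I) = e" using c by simp
    ultimately show "\<psi> \<in> U" using e(2) by simp
  qed
  ultimately show "\<exists>T. openin schwartz_topology T \<and> \<phi> \<in> T \<and> T \<subseteq> U" by blast
qed

lemma tempered_add:
  "f \<in> tempered_distributions \<Longrightarrow> \<phi> \<in> schwartz_space \<Longrightarrow> \<psi> \<in> schwartz_space \<Longrightarrow> f (\<lambda>t. \<phi> t + \<psi> t) = f \<phi> + f \<psi>"
  by (simp add: tempered_distributions_def)

lemma tempered_cmult:
  "f \<in> tempered_distributions \<Longrightarrow> \<phi> \<in> schwartz_space \<Longrightarrow> f (\<lambda>t. c * \<phi> t) = c * f \<phi>"
  by (simp add: tempered_distributions_def)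

lemma tempered_outside:
  "f \<in> tempered_distributions \<Longrightarrow> \<phi> \<notin> schwartz_space \<Longrightarrow> f \<phi> = 0"
  by (simp add: tempered_distributions_def)

lemma tempered_diff:
  "f \<in> tempered_distributions \<Longrightarrow> \<phi> \<in> schwartz_space \<Longrightarrow> \<psi> \<in> schwartz_space \<Longrightarrow> f (\<lambda>t. \<phi> t - \<psi> t) = f \<phi> - f \<psi>"
  using tempered_add[of f \<phi> "\<lambda>t. (-1) * \<psi> t"] tempered_cmult[of f \<psi> "-1"] schwartz_cmult[of \<psi> "-1"] by simp

lemma tempered_sum:
  assumes "f \<in> tempered_distributions" "\<And>i. i \<in> I \<Longrightarrow> \<phi> i \<in> schwartz_space"
  shows "f (\<lambda>t. \<Sum>i\<in>I. \<phi> i t) = (\<Sum>i\<in>I. f (\<phi> i))"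
  using assms(2)
proof (induction I rule: infinite_finite_induct)
  case (insert i I)
  then show ?case by (simp add: tempered_add[OF assms(1)] schwartz_sum)
qed (use tempered_cmult[OF assms(1) schwartz_zero, of 0] in auto)

text \<open>The preimage of the unit ball contains a total seminorm ball about zero, and scaling
  makes this a global bound.\<close>

lemma tempered_bounded:
  assumes f: "f \<in> tempered_distributions"
  obtains C n where "0 \<le> C" "\<And>\<phi>. \<phi> \<in> schwartz_space \<Longrightarrow> norm (f \<phi>) \<le> C * total_seminorm n \<phi>"
proof -
  have cont: "continuous_map schwartz_topology euclidean f"
    using f by (simp add: tempered_distributions_def)
  have f0: "f (\<lambda>t. 0) = 0" using tempered_cmult[OF f schwartz_zero, of 0] by simp
  have "openin schwartz_topology {\<phi> \<in> schwartz_space. f \<phi> \<in> ball 0 1}"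
    using openin_continuous_map_preimage[OF cont, of "ball 0 1"] by (simp add: topspace_schwartz)
  moreover have "(\<lambda>t. 0) \<in> {\<phi> \<in> schwartz_space. f \<phi> \<in> ball 0 1}" using f0 by simp
  ultimately obtain n e where e: "0 < e"
    "\<And>\<psi>. \<psi> \<in> schwartz_space \<Longrightarrow> total_seminorm n (\<lambda>t. \<psi> t - 0) < e \<Longrightarrow> \<psi> \<in> {\<phi> \<in> schwartz_space. f \<phi> \<in> ball 0 1}"
    by (rule openin_schwartz_ball) blast
  have "norm (f \<phi>) \<le> (2 / e) * total_seminorm n \<phi>" if S: "\<phi> \<in> schwartz_space" for \<phi>
  proof (rule field_le_epsilon)
    fix r :: real assume "0 < r"
    \<comment> \<open>The slack \<open>r\<close> keeps \<open>c\<close> positive when the seminorm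
      of \<phi> vanishes; the factor 2 is more than enough to bring \<open>\<phi> / c\<close>
      strictly inside the ball of radius \<open>e\<close>.\<close>
    define c where "c = 2 / e * total_seminorm n \<phi> + r"
    have P: "0 \<le> total_seminorm n \<phi>" by (rule total_seminorm_nonneg[OF S])
    have c: "0 < c" using P e(1) \<open>0 < r\<close> by (auto simp: c_def intro!: add_nonneg_pos)
    have "total_seminorm n (\<lambda>t. complex_of_real (1 / c) * \<phi> t) \<le> (1 / c) * total_seminorm n \<phi>"
      using total_seminorm_cmult[OF S, of n "complex_of_real (1 / c)"] c by (simp add: norm_divide)
    also have "\<dots> < e"
    proof -
      have "total_seminorm n \<phi> < e * c" using P e(1) \<open>0 < r\<close>
        by (simp add: c_def distrib_left add_nonneg_pos)
      then show ?thesis using c by (simp add: field_simps)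
    qed
    finally have "f (\<lambda>t. complex_of_real (1 / c) * \<phi> t) \<in> ball 0 1"
      using e(2)[OF schwartz_cmult[OF S, of "complex_of_real (1 / c)"]] by simp
    then have "norm (f \<phi>) < c"
      using c unfolding tempered_cmult[OF f S] by (simp add: norm_mult norm_divide field_simps)
    then show "norm (f \<phi>) \<le> 2 / e * total_seminorm n \<phi> + r" by (simp add: c_def)
  qed
  then show ?thesis using e(1) by (intro that[of "2 / e" n]) auto
qed

lemma tempered_distributionsI:
  assumes add: "\<And>\<phi> \<psi>. \<phi> \<in> schwartz_space \<Longrightarrow> \<psi> \<in> schwartz_space \<Longrightarrow> f (\<lambda>t. \<phi> t + \<psi> t) = f \<phi> + f \<psi>"
    and cmult: "\<And>c \<phi>. \<phi> \<in> schwartz_space \<Longrightarrow> f (\<lambda>t. c * \<phi> t) = c * f \<phi>"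
    and outside: "\<And>\<phi>. \<phi> \<notin> schwartz_space \<Longrightarrow> f \<phi> = 0"
    and bound: "\<And>\<phi>. \<phi> \<in> schwartz_space \<Longrightarrow> norm (f \<phi>) \<le> C * total_seminorm n \<phi>"
  shows "f \<in> tempered_distributions"
proof -
  have diff: "f (\<lambda>t. \<phi> t - \<psi> t) = f \<phi> - f \<psi>" if "\<phi> \<in> schwartz_space" "\<psi> \<in> schwartz_space" for \<phi> \<psi>
    using add[OF that(1) schwartz_cmult[OF that(2), of "-1"]] cmult[OF that(2), of "-1"] by simp
  have "continuous_map schwartz_topology euclidean f"
    unfolding continuous_map_def topspace_schwartz
  proof (intro conjI allI impI)
    fix V :: "complex set" assume "openin euclidean V"
    then have V: "open V" by simp
    show "openin schwartz_topology {\<phi> \<in> schwartz_space. f \<phi> \<in> V}"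
    proof (rule schwartz_ball_openin)
      fix \<phi> assume p: "\<phi> \<in> {\<phi> \<in> schwartz_space. f \<phi> \<in> V}"
      then obtain e where e: "0 < e" "\<And>y. dist y (f \<phi>) < e \<Longrightarrow> y \<in> V"
        using V unfolding open_dist by blast
      \<comment> \<open>The sign of \<open>C\<close> is unrestricted, so the radius uses the
        positive constant \<open>\<bar>C\<bar> + 1\<close> instead.\<close>
      have "f \<psi> \<in> V" if "\<psi> \<in> schwartz_space" "total_seminorm n (\<lambda>t. \<psi> t - \<phi> t) < e / (\<bar>C\<bar> + 1)" for \<psi>
      proof (rule e(2))
        have S: "(\<lambda>t. \<psi> t - \<phi> t) \<in> schwartz_space" using that p by auto
        have "norm (f \<psi> - f \<phi>) \<le> C * total_seminorm n (\<lambda>t. \<psi> t - \<phi> t)"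
          using bound[OF S] diff that p by auto
        also have "\<dots> \<le> (\<bar>C\<bar> + 1) * total_seminorm n (\<lambda>t. \<psi> t - \<phi> t)"
          by (intro mult_right_mono total_seminorm_nonneg S) auto
        also have "\<dots> < e" using that(2) by (simp add: field_simps)
        finally show "dist (f \<psi>) (f \<phi>) < e" by (simp add: dist_norm)
      qed
      then show "\<exists>n e. 0 < e \<and> (\<forall>\<psi>\<in>schwartz_space. total_seminorm n (\<lambda>t. \<psi> t - \<phi> t) < e
          \<longrightarrow> \<psi> \<in> {\<phi> \<in> schwartz_space. f \<phi> \<in> V})"
        using e(1) by (intro exI[of _ n] exI[of _ "e / (\<bar>C\<bar> + 1)"]) auto
    qed auto
  qed auto
  then show ?thesis using add cmult outside by (simp add: tempered_distributions_def)
qed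

section \<open>Superpositions of time-frequency atoms\<close>

text \<open>The conjugate is taken because \<open>bracket\<close> conjugates its second argument:
  \<open>f (tf_atom z)\<close> is then exactly the transform \<open>V f\<close> at
  \<open>z\<close>.\<close>

abbreviation tf_atom :: "'d::finite phase \<Rightarrow> real ^ 'd \<Rightarrow> complex" where
  "tf_atom z \<equiv> \<lambda>t. cnj (tf_shift z gauss t)"

lemma tf_atom_class: "(\<lambda>p. tf_atom (snd p) (fst p)) \<in> tf_class"
  unfolding tf_class_def by (intro CollectI exI[of _ "\<lambda>p. 1"] conjI cpoly_const) simp

lemma sum_Basis_inner:
  fixes c :: "'a::euclidean_space \<Rightarrow> complex"
  assumes "e \<in> Basis"
  shows "(\<Sum>b\<in>Basis. complex_of_real (e \<bullet> b) * c b) = c e"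
proof -
  have "(\<Sum>b\<in>Basis. complex_of_real (e \<bullet> b) * c b) = (\<Sum>b\<in>Basis. if b = e then c b else 0)"
    using assms by (intro sum.cong refl) (simp add: inner_Basis)
  also have "\<dots> = c e" using assms by simp
  finally show ?thesis .
qed

lemma tf_class_slice_derivative:
  assumes "\<And>p. (G has_derivative (\<lambda>h. \<Sum>b\<in>Basis. complex_of_real (h \<bullet> b) * G' b p)) (at p)"
  shows "((\<lambda>t. G (t, z)) has_derivative (\<lambda>h. \<Sum>b\<in>Basis. complex_of_real ((h, 0) \<bullet> b) * G' b (t, z))) (at t)"
proof -
  have "((\<lambda>t. (t, z)) has_derivative (\<lambda>h. (h, 0))) (at t)"
    by (intro derivative_intros)
  from has_derivative_compose[OF this assms] show ?thesis .
qed

text \<open>The direction \<open>axis i 1\<close>, paired with zero, is itself a basis vector of the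
  product, so the sum collapses to one coefficient; \<open>z0 - z0\<close> is just the zero of the
  second factor.\<close>

lemma partial_deriv_sum_Basis:
  fixes z0 :: "'b::euclidean_space"
  assumes "(f has_derivative (\<lambda>h. \<Sum>b\<in>Basis. complex_of_real ((h, z0 - z0) \<bullet> b) * c b)) (at t)"
  shows "partial_deriv i f t = c (axis i 1, 0)"
proof -
  have "(axis i 1, 0) \<in> (Basis :: ((real ^ 'a) \<times> 'b) set)"
    by (auto simp: Basis_prod_def axis_in_Basis_iff)
  then show ?thesis
    unfolding partial_deriv_def frechet_derivative_at[OF assms, symmetric]
    by (simp add: sum_Basis_inner)
qed

text \<open>Integrability against every polynomial is the condition that matches
  \<open>tf_class\<close>, whose members and derivatives grow polynomially in \<open>z\<close> with
  degrees depending on the order of the derivative.\<close>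

definition rapid_weight :: "('a::euclidean_space \<Rightarrow> complex) \<Rightarrow> bool" where
  "rapid_weight w \<longleftrightarrow> w \<in> borel_measurable borel \<and> (\<forall>M. integrable lborel (\<lambda>z. (1 + norm z) ^ M * norm (w z)))"

lemma rapid_weight_measurable [measurable_dest]: "rapid_weight w \<Longrightarrow> w \<in> borel_measurable borel"
  by (simp add: rapid_weight_def)

lemma rapid_weight_integrable: "rapid_weight w \<Longrightarrow> integrable lborel (\<lambda>z. (1 + norm z) ^ M * norm (w z))"
  by (simp add: rapid_weight_def)

lemma rapid_weight_integrable_mult:
  fixes g :: "'a::euclidean_space \<Rightarrow> complex"
  assumes w: "rapid_weight w" and [measurable]: "g \<in> borel_measurable borel"
    and b: "\<And>z. norm (g z) \<le> C * (1 + norm z) ^ M"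
  shows "integrable lborel (\<lambda>z. w z * g z)"
    and "norm (\<integral>z. w z * g z \<partial>lborel) \<le> C * (\<integral>z. (1 + norm z) ^ M * norm (w z) \<partial>lborel)"
proof -
  note [measurable] = rapid_weight_measurable[OF w]
  have i: "integrable lborel (\<lambda>z. C * ((1 + norm z) ^ M * norm (w z)))"
    by (intro integrable_mult_right rapid_weight_integrable w)
  have le: "norm (w z * g z) \<le> C * ((1 + norm z) ^ M * norm (w z))" for z
    using mult_left_mono[OF b[of z] norm_ge_zero[of "w z"]] by (simp add: norm_mult mult_ac)
  show int: "integrable lborel (\<lambda>z. w z * g z)"
    by (rule Bochner_Integration.integrable_bound[OF i]) (auto intro!: order_trans[OF le])
  have "norm (\<integral>z. w z * g z \<partial>lborel) \<le> (\<integral>z. norm (w z * g z) \<partial>lborel)"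
    by (rule integral_norm_bound)
  also have "\<dots> \<le> (\<integral>z. C * ((1 + norm z) ^ M * norm (w z)) \<partial>lborel)"
    by (intro integral_mono integrable_norm int i le)
  finally show "norm (\<integral>z. w z * g z \<partial>lborel) \<le> C * (\<integral>z. (1 + norm z) ^ M * norm (w z) \<partial>lborel)"
    by simp
qed

lemma tf_class_measurable:
  assumes "G \<in> tf_class"
  shows "(\<lambda>z. G (t, z)) \<in> borel_measurable borel"
proof -
  have "continuous_on UNIV (\<lambda>z. G (t, z))"
    by (rule continuous_on_compose2[OF tf_class_continuous[OF assms]]) (auto intro!: continuous_intros)
  then show ?thesis by (rule borel_measurable_continuous_onI)
qed

lemma tf_class_weight_integrable:
  assumes "rapid_weight w" "G \<in> tf_class"
  shows "integrable lborel (\<lambda>z. w z * G (t, z))"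
proof -
  obtain C M where "0 \<le> C" "\<And>p. (1 + norm (fst p)) ^ 0 * norm (G p) \<le> C * (1 + norm (snd p)) ^ M"
    using tf_class_bound[OF assms(2), of 0] by (rule poly_boundedE) blast
  from this(2)[of "(t, z)" for z] show ?thesis
    by (intro rapid_weight_integrable_mult(1)[OF assms(1) tf_class_measurable[OF assms(2)]]) simp
qed

text \<open>Differentiation under the integral sign: the Taylor remainder is at most
  \<open>C * (1 + norm z) ^ M\<close> times the squared time step, and integrating it against the
  weight leaves a quadratic error.\<close>

lemma tf_class_weighted_derivative:
  fixes G :: "(real ^ 'd::finite) \<times> 'd phase \<Rightarrow> complex"
  assumes w: "rapid_weight w" and G: "G \<in> tf_class"
    and G': "\<And>b. G' b \<in> tf_class" "\<And>p. (G has_derivative (\<lambda>h. \<Sum>b\<in>Basis. complex_of_real (h \<bullet> b) * G' b p)) (at p)"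
  shows "((\<lambda>t. \<integral>z. w z * G (t, z) \<partial>lborel) has_derivative
    (\<lambda>h. \<Sum>b\<in>Basis. complex_of_real ((h, 0) \<bullet> b) * (\<integral>z. w z * G' b (t, z) \<partial>lborel))) (at t)"
proof -
  let ?I = "\<lambda>t. \<integral>z. w z * G (t, z) \<partial>lborel"
  let ?D = "\<lambda>h. \<Sum>b\<in>Basis. complex_of_real ((h, 0) \<bullet> b) * (\<integral>z. w z * G' b (t, z) \<partial>lborel)"
  obtain C M where C: "0 \<le> C" "\<And>t s z. norm (s - t) \<le> 1 \<Longrightarrow>
    norm (G (s, z) - G (t, z) - (\<Sum>b\<in>Basis. complex_of_real ((s - t, 0) \<bullet> b) * G' b (t, z)))
        \<le> C * (1 + norm z) ^ M * (norm (s - t))\<^sup>2"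
    by (rule tf_class_taylor[OF G']) blast
  define K where "K = C * (\<integral>z. (1 + norm z) ^ M * norm (w z) \<partial>lborel)"
  have i: "integrable lborel (\<lambda>z. w z * H (t, z))" if "H \<in> tf_class" for H t
    by (rule tf_class_weight_integrable[OF w that])
  have est: "norm (?I s - ?I t - ?D (s - t)) \<le> K * (norm (s - t))\<^sup>2" if st: "norm (s - t) \<le> 1" for s
  proof -
    have "?I s - ?I t - ?D (s - t) = (\<integral>z. w z * (G (s, z) - G (t, z) - (\<Sum>b\<in>Basis. complex_of_real ((s - t, 0) \<bullet> b) * G' b (t, z))) \<partial>lborel)"
    proof -
      let ?T = "\<lambda>z. \<Sum>b\<in>Basis. complex_of_real ((s - t, 0) \<bullet> b) * (w z * G' b (t, z))"
      have T: "integrable lborel ?T" "(\<integral>z. ?T z \<partial>lborel) = ?D (s - t)"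
        using i[OF G'(1)] by (auto simp: Bochner_Integration.integral_sum)
      have "(\<integral>z. w z * G (s, z) - w z * G (t, z) - ?T z \<partial>lborel) = ?I s - ?I t - ?D (s - t)"
        using i[OF G] T by simp
      moreover have "w z * (G (s, z) - G (t, z) - (\<Sum>b\<in>Basis. complex_of_real ((s - t, 0) \<bullet> b) * G' b (t, z)))
          = w z * G (s, z) - w z * G (t, z) - ?T z" for z
        by (simp add: right_diff_distrib sum_distrib_left mult.left_commute)
      ultimately show ?thesis by simp
    qed
    also have "norm \<dots> \<le> (C * (norm (s - t))\<^sup>2) * (\<integral>z. (1 + norm z) ^ M * norm (w z) \<partial>lborel)"
    proof (rule rapid_weight_integrable_mult(2)[OF w])
      show "(\<lambda>z. G (s, z) - G (t, z) - (\<Sum>b\<in>Basis. complex_of_real ((s - t, 0) \<bullet> b) * G' b (t, z))) \<in> borel_measurable borel"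
        by (intro borel_measurable_diff borel_measurable_sum borel_measurable_times borel_measurable_const tf_class_measurable G G')
      show "norm (G (s, z) - G (t, z) - (\<Sum>b\<in>Basis. complex_of_real ((s - t, 0) \<bullet> b) * G' b (t, z)))
          \<le> C * (norm (s - t))\<^sup>2 * (1 + norm z) ^ M" for z
        using C(2)[OF st, of z] by (simp add: mult_ac)
    qed
    finally show ?thesis by (simp add: K_def mult_ac)
  qed
  have lin: "bounded_linear ?D"
    by (intro bounded_linear_sum bounded_linear_mult_const bounded_linear_compose[OF bounded_linear_of_real]
        bounded_linear_compose[OF bounded_linear_inner_left] bounded_linear_Pair bounded_linear_ident bounded_linear_zero)
  show ?thesis
    unfolding has_derivative_at_within
  proof (intro conjI lin)
    have ev: "\<forall>\<^sub>F s in at t. norm ((?I s - ?I t - ?D (s - t)) /\<^sub>R norm (s - t)) \<le> K * norm (s - t)"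
      unfolding eventually_at
    proof (intro exI[of _ 1] conjI ballI impI)
      fix s assume "s \<noteq> t \<and> dist s t < 1"
      then have "norm (s - t) > 0" "norm (s - t) \<le> 1" by (auto simp: dist_norm)
      then show "norm ((?I s - ?I t - ?D (s - t)) /\<^sub>R norm (s - t)) \<le> K * norm (s - t)"
        unfolding norm_scaleR using est[of s] by (simp add: field_simps power2_eq_square)
    qed auto
    have "((\<lambda>s. K * norm (s - t)) \<longlongrightarrow> K * norm (t - t)) (at t)"
      by (intro tendsto_intros)
    then have "((\<lambda>s. K * norm (s - t)) \<longlongrightarrow> 0) (at t)" by simp
    from Lim_null_comparison[OF ev this]
    show "((\<lambda>s. (?I s - ?I t - ?D (s - t)) /\<^sub>R norm (s - t)) \<longlongrightarrow> 0) (at t)" .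
  qed
qed

text \<open>One and the same \<open>H\<close> represents the iterated derivative of every slice and
  of every weighted superposition. Estimates for \<open>H\<close> thus compare an integral of atoms
  with finite sums of atoms at the level of all derivatives.\<close>

lemma tf_class_iter_partial:
  fixes G :: "(real ^ 'd::finite) \<times> 'd phase \<Rightarrow> complex"
  assumes "G \<in> tf_class"
  obtains H where "H \<in> tf_class" "\<And>z. iter_partial is (\<lambda>t. G (t, z)) = (\<lambda>t. H (t, z))"
    "\<And>w. rapid_weight w \<Longrightarrow> iter_partial is (\<lambda>t. \<integral>z. w z * G (t, z) \<partial>lborel) = (\<lambda>t. \<integral>z. w z * H (t, z) \<partial>lborel)"
proof -
  have "\<exists>H\<in>tf_class. (\<forall>z. iter_partial is (\<lambda>t. G (t, z)) = (\<lambda>t. H (t, z))) \<and>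
    (\<forall>w. rapid_weight w \<longrightarrow> iter_partial is (\<lambda>t. \<integral>z. w z * G (t, z) \<partial>lborel) = (\<lambda>t. \<integral>z. w z * H (t, z) \<partial>lborel))"
  proof (induction "is")
    case Nil
    then show ?case using assms by (intro bexI[of _ G]) auto
  next
    case (Cons i "is")
    then obtain H where H: "H \<in> tf_class" "\<And>z. iter_partial is (\<lambda>t. G (t, z)) = (\<lambda>t. H (t, z))"
      "\<And>w. rapid_weight w \<Longrightarrow> iter_partial is (\<lambda>t. \<integral>z. w z * G (t, z) \<partial>lborel) = (\<lambda>t. \<integral>z. w z * H (t, z) \<partial>lborel)"
      by blast
    obtain H' where H': "\<And>b. H' b \<in> tf_class"
      "\<And>p. (H has_derivative (\<lambda>h. \<Sum>b\<in>Basis. complex_of_real (h \<bullet> b) * H' b p)) (at p)"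
      by (rule tf_class_deriv[OF H(1)]) blast
    have "partial_deriv i (\<lambda>t. H (t, z)) t = H' (axis i 1, 0) (t, z)" for t z
      by (rule partial_deriv_sum_Basis[of _ "0"]) (use tf_class_slice_derivative[OF H'(2)] in simp)
    moreover have "partial_deriv i (\<lambda>t. \<integral>z. w z * H (t, z) \<partial>lborel) t = (\<integral>z. w z * H' (axis i 1, 0) (t, z) \<partial>lborel)"
      if "rapid_weight w" for t w
      by (rule partial_deriv_sum_Basis[of _ "0"]) (use tf_class_weighted_derivative[OF that H(1) H'] in simp)
    ultimately show ?case
      by (intro bexI[of _ "H' (axis i 1, 0)"] conjI allI impI ext H'(1)) (simp_all only: iter_partial_Cons H(2,3))
  qed
  then show ?thesis using that by blast
qed

lemma tf_class_slice_schwartz: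
  fixes G :: "(real ^ 'd::finite) \<times> 'd phase \<Rightarrow> complex"
  assumes "G \<in> tf_class"
  shows "(\<lambda>t. G (t, z)) \<in> schwartz_space"
proof (rule schwartz_spaceI)
  show "smooth (\<lambda>t. G (t, z))"
    unfolding smooth_def
  proof (intro allI)
    fix "is" x
    obtain H where H: "H \<in> tf_class" "\<And>z. iter_partial is (\<lambda>t. G (t, z)) = (\<lambda>t. H (t, z))"
      by (rule tf_class_iter_partial[OF assms, of "is"]) blast
    obtain H' where H': "\<And>p. (H has_derivative (\<lambda>h. \<Sum>b\<in>Basis. complex_of_real (h \<bullet> b) * H' b p)) (at p)"
      by (rule tf_class_deriv[OF H(1)]) blast
    show "iter_partial is (\<lambda>t. G (t, z)) differentiable at x"
      unfolding H(2) by (rule differentiableI[OF tf_class_slice_derivative[OF H']])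
  qed
  fix k "is"
  obtain H where H: "H \<in> tf_class" "\<And>z. iter_partial is (\<lambda>t. G (t, z)) = (\<lambda>t. H (t, z))"
    by (rule tf_class_iter_partial[OF assms, of "is"]) blast
  obtain C M where "\<And>p. (1 + norm (fst p)) ^ k * norm (H p) \<le> C * (1 + norm (snd p)) ^ M"
    using tf_class_bound[OF H(1), of k] by (rule poly_boundedE) blast
  from this[of "(t, z)" for t] show "\<exists>B. \<forall>x. (1 + norm x) ^ k * norm (iter_partial is (\<lambda>t. G (t, z)) x) \<le> B"
    unfolding H(2) by auto
qed

lemma tf_class_weighted_schwartz:
  fixes G :: "(real ^ 'd::finite) \<times> 'd phase \<Rightarrow> complex"
  assumes "G \<in> tf_class" and w: "rapid_weight w"
  shows "(\<lambda>t. \<integral>z. w z * G (t, z) \<partial>lborel) \<in> schwartz_space"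
proof (rule schwartz_spaceI)
  show "smooth (\<lambda>t. \<integral>z. w z * G (t, z) \<partial>lborel)"
    unfolding smooth_def
  proof (intro allI)
    fix "is" x
    obtain H where H: "H \<in> tf_class"
      "\<And>w. rapid_weight w \<Longrightarrow> iter_partial is (\<lambda>t. \<integral>z. w z * G (t, z) \<partial>lborel) = (\<lambda>t. \<integral>z. w z * H (t, z) \<partial>lborel)"
      by (rule tf_class_iter_partial[OF assms(1), of "is"]) blast
    obtain H' where H': "\<And>b. H' b \<in> tf_class" "\<And>p. (H has_derivative (\<lambda>h. \<Sum>b\<in>Basis. complex_of_real (h \<bullet> b) * H' b p)) (at p)"
      by (rule tf_class_deriv[OF H(1)]) blast
    show "iter_partial is (\<lambda>t. \<integral>z. w z * G (t, z) \<partial>lborel) differentiable at x"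
      unfolding H(2)[OF w] by (rule differentiableI[OF tf_class_weighted_derivative[OF w H(1) H']])
  qed
  fix k "is"
  obtain H where H: "H \<in> tf_class"
    "\<And>w. rapid_weight w \<Longrightarrow> iter_partial is (\<lambda>t. \<integral>z. w z * G (t, z) \<partial>lborel) = (\<lambda>t. \<integral>z. w z * H (t, z) \<partial>lborel)"
    by (rule tf_class_iter_partial[OF assms(1), of "is"]) blast
  obtain C M where C: "\<And>p. (1 + norm (fst p)) ^ k * norm (H p) \<le> C * (1 + norm (snd p)) ^ M"
    using tf_class_bound[OF H(1), of k] by (rule poly_boundedE) blast
  have "(1 + norm t) ^ k * norm (\<integral>z. w z * H (t, z) \<partial>lborel) \<le> C * (\<integral>z. (1 + norm z) ^ M * norm (w z) \<partial>lborel)" for t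
  proof -
    have p: "0 < (1 + norm t) ^ k" by (simp add: add_pos_nonneg)
    have "norm (\<integral>z. w z * H (t, z) \<partial>lborel) \<le> (C / (1 + norm t) ^ k) * (\<integral>z. (1 + norm z) ^ M * norm (w z) \<partial>lborel)"
    proof (rule rapid_weight_integrable_mult(2)[OF w tf_class_measurable[OF H(1)]])
      show "norm (H (t, z)) \<le> C / (1 + norm t) ^ k * (1 + norm z) ^ M" for z
        using C[of "(t, z)"] p by (simp add: field_simps)
    qed
    then show ?thesis using p by (simp add: field_simps)
  qed
  then show "\<exists>B. \<forall>x. (1 + norm x) ^ k * norm (iter_partial is (\<lambda>t. \<integral>z. w z * G (t, z) \<partial>lborel) x) \<le> B"
    unfolding H(2)[OF w] by blast
qed

lemma tf_atom_schwartz: "tf_atom z \<in> schwartz_space"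
  using tf_class_slice_schwartz[OF tf_atom_class, of z] by simp

text \<open>The map from \<open>z\<close> to the atom is locally Lipschitz into Schwartz space.
  Composed with a functional bounded by a Schwartz seminorm, it gives a modulus of continuity for
  the transform that depends on that bound only.\<close>

lemma tf_atom_lipschitz:
  obtains C M where "0 \<le> C" "\<And>z y :: 'd::finite phase. total_seminorm n (\<lambda>t. tf_atom z t - tf_atom y t)
      \<le> C * (1 + norm z + norm y) ^ M * norm (z - y)"
proof -
  let ?E = "\<lambda>p::(real ^ 'd) \<times> 'd phase. tf_atom (snd p) (fst p)"
  have "\<exists>C M. 0 \<le> C \<and> (\<forall>z y :: 'd phase. schwartz_seminorm n is (\<lambda>t. tf_atom z t - tf_atom y t)
      \<le> C * (1 + (norm z + norm y)) ^ M * norm (z - y))" for "is"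
  proof -
    obtain H where H: "H \<in> tf_class" "\<And>z. iter_partial is (\<lambda>t. ?E (t, z)) = (\<lambda>t. H (t, z))"
      by (rule tf_class_iter_partial[OF tf_atom_class, of "is"]) blast
    obtain C M where C: "0 \<le> C" "\<And>t s z y. norm (s - t) \<le> 1 \<Longrightarrow>
      (1 + norm t) ^ n * norm (H (s, z) - H (t, y)) \<le> C * (1 + norm z + norm y) ^ M * (norm (s - t) + norm (z - y))"
      by (rule tf_class_lipschitz[OF H(1), of n]) blast
    have "schwartz_seminorm n is (\<lambda>t. tf_atom z t - tf_atom y t)
        \<le> C * (1 + (norm z + norm y)) ^ M * norm (z - y)" for z y :: "'d phase"
    proof (rule schwartz_seminorm_least)
      fix t :: "real ^ 'd"
      show "(1 + norm t) ^ n * norm (iter_partial is (\<lambda>t. tf_atom z t - tf_atom y t) t)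
          \<le> C * (1 + (norm z + norm y)) ^ M * norm (z - y)"
        using C(2)[of t t z y] H(2)[of z] H(2)[of y]
        by (simp add: iter_partial_diff schwartz_smooth tf_atom_schwartz add.assoc)
    qed
    with C(1) show ?thesis by blast
  qed
  then have "\<forall>is. \<exists>C M. 0 \<le> C \<and> (\<forall>z y :: 'd phase. schwartz_seminorm n is (\<lambda>t. tf_atom z t - tf_atom y t)
      \<le> C * (1 + (norm z + norm y)) ^ M * norm (z - y))"
    by blast
  from choice[OF this] obtain C where "\<forall>is. \<exists>M. 0 \<le> C is
      \<and> (\<forall>z y :: 'd phase. schwartz_seminorm n is (\<lambda>t. tf_atom z t - tf_atom y t)
          \<le> C is * (1 + (norm z + norm y)) ^ M * norm (z - y))"
    by blast
  from choice[OF this] obtain M where C: "\<And>is. 0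
      \<le> C is" "\<And>is (z :: 'd phase) y. schwartz_seminorm n is (\<lambda>t. tf_atom z t - tf_atom y t)
          \<le> C is * (1 + (norm z + norm y)) ^ M is * norm (z - y)"
    by blast
  \<comment> \<open>The pairs \<open>(z, y)\<close> with weight \<open>norm z + norm y\<close> serve
    to merge the bounds for the finitely many multi-indices into one constant and one
    exponent.\<close>
  have "poly_bounded (\<lambda>(z :: 'd phase, y :: 'd phase). C is * (1 + (norm z + norm y)) ^ M is) (\<lambda>(z, y). norm z + norm y)" for "is"
    by (rule poly_boundedI[OF C(1)[of "is"]]) auto
  then have "poly_bounded (\<lambda>p. \<Sum>is\<in>{is. length is
      \<le> n}. (case p of (z :: 'd phase, y :: 'd phase) \<Rightarrow> C is * (1 + (norm z + norm y)) ^ M is)) (\<lambda>(z, y). norm z + norm y)"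
    by (intro poly_bounded_sum finite_multiindices) auto
  then obtain D N where D: "0 \<le> D" "\<And>p. (\<Sum>is\<in>{is. length is
      \<le> n}. (case p of (z :: 'd phase, y :: 'd phase) \<Rightarrow> C is * (1 + (norm z + norm y)) ^ M is))
          \<le> D * (1 + (case p of (z, y) \<Rightarrow> norm z + norm y)) ^ N"
    by (rule poly_boundedE) blast
  have "total_seminorm n (\<lambda>t. tf_atom z t - tf_atom y t) \<le> D * (1 + norm z + norm y) ^ N * norm (z - y)"
      for z y :: "'d phase"
  proof -
    have "total_seminorm n (\<lambda>t. tf_atom z t - tf_atom y t) \<le> (\<Sum>is\<in>{is. length is
        \<le> n}. C is * (1 + (norm z + norm y)) ^ M is) * norm (z - y)"
      unfolding total_seminorm_def sum_distrib_right by (intro sum_mono C(2))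
    also have "\<dots> \<le> D * (1 + norm z + norm y) ^ N * norm (z - y)"
      using D(2)[of "(z, y)"] by (intro mult_right_mono) (simp_all add: add.assoc)
    finally show ?thesis .
  qed
  with D(1) show thesis by (rule that)
qed

lemma tempered_atom_lipschitz:
  assumes "f \<in> tempered_distributions"
  obtains C M where "0 \<le> C" "\<And>z y :: 'd::finite phase. norm (f (tf_atom z) - f (tf_atom y))
      \<le> C * (1 + norm z + norm y) ^ M * norm (z - y)"
proof -
  obtain C n where C: "0 \<le> C" "\<And>\<phi>. \<phi> \<in> schwartz_space \<Longrightarrow> norm (f \<phi>) \<le> C * total_seminorm n \<phi>"
    using tempered_bounded[OF assms] by blast
  obtain D M where D: "0 \<le> D" "\<And>z y :: 'd phase. total_seminorm n (\<lambda>t. tf_atom z t - tf_atom y t)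
      \<le> D * (1 + norm z + norm y) ^ M * norm (z - y)"
    by (rule tf_atom_lipschitz) blast
  have "norm (f (tf_atom z) - f (tf_atom y)) \<le> (C * D) * (1 + norm z + norm y) ^ M * norm (z - y)" for z y
    using C(2)[OF schwartz_diff[OF tf_atom_schwartz tf_atom_schwartz], of z y] mult_left_mono[OF D(2)[of z y] C(1)]
    by (simp add: tempered_diff[OF assms] tf_atom_schwartz mult.assoc)
  then show thesis using C(1) D(1) by (intro that[of "C * D"]) auto
qed

lemma continuous_on_lipschitz_poly:
  fixes F :: "'a::real_normed_vector \<Rightarrow> complex"
  assumes "\<And>z y. norm (F z - F y) \<le> C * (1 + norm z + norm y) ^ M * norm (z - y)"
  shows "continuous_on UNIV F"
proof (rule continuous_at_imp_continuous_on, rule ballI)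
  fix y :: 'a
  have "((\<lambda>z. C * (1 + norm z + norm y) ^ M * norm (z - y)) \<longlongrightarrow> C * (1 + norm y + norm y) ^ M * norm (y - y)) (at y)"
    by (intro tendsto_intros)
  then have "((\<lambda>z. C * (1 + norm z + norm y) ^ M * norm (z - y)) \<longlongrightarrow> 0) (at y)" by simp
  then have "((\<lambda>z. F z - F y) \<longlongrightarrow> 0) (at y)"
    by (rule Lim_null_comparison[rotated]) (simp add: assms)
  then show "isCont F y" unfolding isCont_def using LIM_zero_cancel by blast
qed

section \<open>Weighted integrals as limits of finite combinations\<close>

lemma integral_simple_compose:
  fixes w g :: "'a \<Rightarrow> complex"
  assumes s: "simple_function M s" and w: "integrable M w"
  shows "integrable M (\<lambda>z. w z * g (s z))"
    and "(\<integral>z. w z * g (s z) \<partial>M) = (\<Sum>y\<in>s ` space M. (\<integral>z. indicator (s -` {y} \<inter> space M) z *\<^sub>R w z \<partial>M) * g y)"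
proof -
  have fin: "finite (s ` space M)" and [measurable]: "\<And>y. s -` {y} \<inter> space M \<in> sets M"
    using s simple_functionD[OF s] by auto
  have i: "integrable M (\<lambda>z. indicator (s -` {y} \<inter> space M) z *\<^sub>R w z)" for y
    by (intro integrable_mult_indicator w) simp
  have eq: "w z * g (s z) = (\<Sum>y\<in>s ` space M. (indicator (s -` {y} \<inter> space M) z *\<^sub>R w z) * g y)" if "z \<in> space M" for z
  proof -
    have "(\<Sum>y\<in>s ` space M. (indicator (s -` {y} \<inter> space M) z *\<^sub>R w z) * g y) = (\<Sum>y\<in>s ` space M. if y
        = s z then w z * g y else 0)"
      using that by (intro sum.cong refl) (auto simp: indicator_def)
    then show ?thesis using that fin by simp
  qed
  have i2: "integrable M (\<lambda>z. \<Sum>y\<in>s ` space M. (indicator (s -` {y} \<inter> space M) z *\<^sub>R w z) * g y)"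
    by (intro Bochner_Integration.integrable_sum integrable_mult_left i)
  then show "integrable M (\<lambda>z. w z * g (s z))"
    by (rule Bochner_Integration.integrable_cong[THEN iffD1, OF refl, rotated]) (simp only: eq)
  have "(\<integral>z. w z * g (s z) \<partial>M) = (\<integral>z. (\<Sum>y\<in>s ` space M. (indicator (s -` {y} \<inter> space M) z *\<^sub>R w z) * g y) \<partial>M)"
    by (rule Bochner_Integration.integral_cong[OF refl]) (simp only: eq)
  also have "\<dots> = (\<Sum>y\<in>s ` space M. (\<integral>z. indicator (s -` {y} \<inter> space M) z *\<^sub>R w z \<partial>M) * g y)"
    by (simp only: Bochner_Integration.integral_sum[OF integrable_mult_left[OF i]] integral_mult_left_zero)
  finally show "(\<integral>z. w z * g (s z) \<partial>M) = (\<Sum>y\<in>s ` space M. (\<integral>z. indicator (s -` {y} \<inter> space M) z *\<^sub>R w z \<partial>M) * g y)" .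
qed

text \<open>The sequence \<open>s\<close> depends on the dimension and the weight alone, not on
  \<open>F\<close>. The same finite sums can therefore be tested against \<open>V f\<close> and
  against every derivative of the atoms. The factor 3 reflects
  \<open>norm (s i z) \<le> 2 * norm z\<close>, which gives
  \<open>1 + norm z + norm (s i z) \<le> 3 * (1 + norm z)\<close>.\<close>

lemma rapid_weight_discretize:
  fixes w :: "'a::euclidean_space \<Rightarrow> complex"
  assumes w: "rapid_weight w"
  obtains s where "\<And>i. simple_function lborel (s i)"
    "\<And>F C M i. F \<in> borel_measurable borel \<Longrightarrow> 0 \<le> C \<Longrightarrow>
      (\<And>z y. norm (F z - F y) \<le> C * (1 + norm z + norm y) ^ M * norm (z - y)) \<Longrightarrow>
      integrable lborel (\<lambda>z. w z * F z) \<Longrightarrow>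
      norm ((\<integral>z. w z * F z \<partial>lborel) - (\<integral>z. w z * F (s i z) \<partial>lborel))
        \<le> C * (\<integral>z. norm (w z) * (3 * (1 + norm z)) ^ M * norm (z - s i z) \<partial>lborel)"
    "\<And>M. (\<lambda>i. \<integral>z. norm (w z) * (3 * (1 + norm z)) ^ M * norm (z - s i z) \<partial>lborel) \<longlonglongrightarrow> 0"
proof -
  note [measurable] = rapid_weight_measurable[OF w]
  have "(\<lambda>z::'a. z) \<in> borel_measurable lborel" by simp
  \<comment> \<open>The function approximated here is the identity of phase space:
    \<open>s i z\<close> is a point near \<open>z\<close> taken from a finite set.\<close>
  from borel_measurable_implies_sequence_metric[OF this, of 0] obtain s where
    s: "\<And>i. simple_function lborel (s i)" "\<And>z. (\<lambda>i. s i z) \<longlonglongrightarrow> z" "\<And>i z :: 'a. norm (s i z) \<le> 2 * norm z"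
    by auto
  have [measurable]: "s i \<in> borel_measurable borel" for i
    using borel_measurable_simple_function[OF s(1)[of i]] by simp
  have wi: "integrable lborel w"
    using rapid_weight_integrable[OF w, of 0] by (simp add: integrable_norm_iff)
  have dom: "norm (w z) * (3 * (1 + norm z)) ^ M * norm (z - s i z)
      \<le> 3 ^ Suc M * ((1 + norm z) ^ Suc M * norm (w z))" for M i z
  proof -
    have "norm (z - s i z) \<le> 3 * (1 + norm z)" using norm_triangle_ineq4[of z "s i z"] s(3)[of i z]
        by (smt (verit) norm_ge_zero)
    then have "norm (w z) * (3 * (1 + norm z)) ^ M * norm (z - s i z)
        \<le> norm (w z) * (3 * (1 + norm z)) ^ M * (3 * (1 + norm z))"
      by (intro mult_left_mono) auto
    also have "\<dots> = 3 ^ Suc M * ((1 + norm z) ^ Suc M * norm (w z))" by (simp only: power_mult_distrib power_Suc mult_ac)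
    finally show ?thesis .
  qed
  have bi: "integrable lborel (\<lambda>z. 3 ^ Suc M * ((1 + norm z) ^ Suc M * norm (w z)))" for M
    by (intro integrable_mult_right rapid_weight_integrable w)
  have di: "integrable lborel (\<lambda>z. norm (w z) * (3 * (1 + norm z)) ^ M * norm (z - s i z))" for M i
    by (rule Bochner_Integration.integrable_bound[OF bi[of M]]) (measurable, use dom in \<open>auto intro!: AE_I2 simp: abs_mult\<close>)
  show thesis
  proof (rule that[of s])
    show "simple_function lborel (s i)" for i by (rule s(1))
    show "(\<lambda>i. \<integral>z. norm (w z) * (3 * (1 + norm z)) ^ M * norm (z - s i z) \<partial>lborel) \<longlonglongrightarrow> 0" for M
    proof -
      have "(\<lambda>i. \<integral>z. norm (w z) * (3 * (1 + norm z)) ^ M * norm (z - s i z) \<partial>lborel) \<longlonglongrightarrow> (\<integral>z. 0 \<partial>(lborel :: 'a measure))"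
      proof (rule integral_dominated_convergence[OF _ _ bi[of M]])
        show "AE z in lborel. (\<lambda>i. norm (w z) * (3 * (1 + norm z)) ^ M * norm (z - s i z)) \<longlonglongrightarrow> 0"
        proof (rule AE_I2)
          fix z
          have "(\<lambda>i. norm (w z) * (3 * (1 + norm z)) ^ M * norm (z - s i z))
              \<longlonglongrightarrow> norm (w z) * (3 * (1 + norm z)) ^ M * norm (z - z)"
            by (intro tendsto_intros s(2))
          then show "(\<lambda>i. norm (w z) * (3 * (1 + norm z)) ^ M * norm (z - s i z)) \<longlonglongrightarrow> 0" by simp
        qed
        show "AE z in lborel. norm (norm (w z) * (3 * (1 + norm z)) ^ M * norm (z - s i z))
            \<le> 3 ^ Suc M * ((1 + norm z) ^ Suc M * norm (w z))" for i
          by (rule AE_I2) (use dom in \<open>auto simp: abs_mult\<close>)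
      qed auto
      then show ?thesis by simp
    qed
    show "norm ((\<integral>z. w z * F z \<partial>lborel) - (\<integral>z. w z * F (s i z) \<partial>lborel))
        \<le> C * (\<integral>z. norm (w z) * (3 * (1 + norm z)) ^ M * norm (z - s i z) \<partial>lborel)"
      if [measurable]: "F \<in> borel_measurable borel" and C: "0 \<le> C"
        and F: "\<And>z y. norm (F z - F y) \<le> C * (1 + norm z + norm y) ^ M * norm (z - y)"
        and int: "integrable lborel (\<lambda>z. w z * F z)" for F C M i
    proof -
      have int2: "integrable lborel (\<lambda>z. w z * F (s i z))" by (rule integral_simple_compose[OF s(1) wi])
      have le: "norm (w z * F z - w z * F (s i z)) \<le> C * (norm (w z) * (3 * (1 + norm z)) ^ M * norm (z - s i z))" for z
      proof -
        have "norm (F z - F (s i z)) \<le> C * (1 + norm z + norm (s i z)) ^ M * norm (z - s i z)" by (rule F)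
        also have "\<dots> \<le> C * (3 * (1 + norm z)) ^ M * norm (z - s i z)"
        proof (intro mult_right_mono mult_left_mono power_mono C)
          show "1 + norm z + norm (s i z) \<le> 3 * (1 + norm z)" using s(3)[of i z] by (smt (verit) norm_ge_zero)
        qed auto
        finally have "norm (w z) * norm (F z - F (s i z))
            \<le> norm (w z) * (C * (3 * (1 + norm z)) ^ M * norm (z - s i z))"
          by (rule mult_left_mono) auto
        then show ?thesis unfolding right_diff_distrib[symmetric] norm_mult by (simp add: mult_ac)
      qed
      have "(\<integral>z. w z * F z \<partial>lborel) - (\<integral>z. w z * F (s i z) \<partial>lborel) = (\<integral>z. w z * F z - w z * F (s i z) \<partial>lborel)"
        using int int2 by simp
      also have "norm \<dots> \<le> (\<integral>z. norm (w z * F z - w z * F (s i z)) \<partial>lborel)" by (rule integral_norm_bound)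
      also have "\<dots> \<le> (\<integral>z. C * (norm (w z) * (3 * (1 + norm z)) ^ M * norm (z - s i z)) \<partial>lborel)"
        by (intro integral_mono integrable_norm Bochner_Integration.integrable_diff int int2 integrable_mult_right di le)
      finally show ?thesis by simp
    qed
  qed
qed

text \<open>Approximating the weight by finite combinations of point masses moves \<open>f\<close> inside the integral.\<close>

lemma tempered_weighted_integral:
  fixes f :: "'d::finite dist"
  assumes f: "f \<in> tempered_distributions" and w: "rapid_weight w"
  shows "f (\<lambda>t. \<integral>z. w z * tf_atom z t \<partial>lborel) = (\<integral>z. w z * f (tf_atom z) \<partial>lborel)"
    and "integrable lborel (\<lambda>z. w z * f (tf_atom z))"
proof -
  let ?E = "\<lambda>p::(real ^ 'd) \<times> 'd phase. tf_atom (snd p) (fst p)"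
  let ?\<psi> = "\<lambda>t. \<integral>z. w z * tf_atom z t \<partial>lborel"
  let ?F = "\<lambda>z. f (tf_atom z)"
  note [measurable] = rapid_weight_measurable[OF w]
  have wi: "integrable lborel w"
    using rapid_weight_integrable[OF w, of 0] by (simp add: integrable_norm_iff)
  obtain s where s: "\<And>i. simple_function lborel (s i)"
    "\<And>F C M i. F \<in> borel_measurable borel \<Longrightarrow> 0 \<le> C \<Longrightarrow>
      (\<And>z y. norm (F z - F y) \<le> C * (1 + norm z + norm y) ^ M * norm (z - y)) \<Longrightarrow>
      integrable lborel (\<lambda>z. w z * F z) \<Longrightarrow>
      norm ((\<integral>z. w z * F z \<partial>lborel) - (\<integral>z. w z * F (s i z) \<partial>lborel))
        \<le> C * (\<integral>z. norm (w z) * (3 * (1 + norm z)) ^ M * norm (z - s i z) \<partial>lborel)"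
    "\<And>M. (\<lambda>i. \<integral>z. norm (w z) * (3 * (1 + norm z)) ^ M * norm (z - s i z) \<partial>lborel) \<longlonglongrightarrow> 0"
    by (rule rapid_weight_discretize[OF w]) blast
  define \<delta> where "\<delta> M i = (\<integral>z. norm (w z) * (3 * (1 + norm z)) ^ M * norm (z - s i z) \<partial>lborel)" for M i
  have \<delta>: "\<delta> M \<longlonglongrightarrow> 0" for M unfolding \<delta>_def by (rule s(3))
  obtain C M where C: "0 \<le> C" "\<And>z y. norm (?F z - ?F y) \<le> C * (1 + norm z + norm y) ^ M * norm (z - y)"
    by (rule tempered_atom_lipschitz[OF f]) blast
  have Fm: "?F \<in> borel_measurable borel"
    by (intro borel_measurable_continuous_onI continuous_on_lipschitz_poly[OF C(2)])
  show Fi: "integrable lborel (\<lambda>z. w z * f (tf_atom z))"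
  proof (rule rapid_weight_integrable_mult(1)[OF w Fm])
    fix z :: "'d phase"
    have "norm (?F z) \<le> norm (?F 0) + norm (?F z - ?F 0)" using norm_triangle_sub[of "?F z" "?F 0"] .
    also have "\<dots> \<le> norm (?F 0) * (1 + norm z) ^ Suc M + C * (1 + norm z) ^ Suc M"
    proof (intro add_mono)
      show "norm (?F 0) \<le> norm (?F 0) * (1 + norm z) ^ Suc M"
        using mult_left_mono[OF one_le_power[of "1 + norm z" "Suc M"], of "norm (?F 0)"] by (simp del: power_Suc)
      have "norm (?F z - ?F 0) \<le> C * (1 + norm z) ^ M * norm z" using C(2)[of z 0] by simp
      also have "\<dots> \<le> C * (1 + norm z) ^ M * (1 + norm z)" using C(1) by (intro mult_left_mono) auto
      finally show "norm (?F z - ?F 0) \<le> C * (1 + norm z) ^ Suc M" by (simp add: mult_ac)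
    qed
    finally show "norm (?F z) \<le> (norm (?F 0) + C) * (1 + norm z) ^ Suc M" by (simp add: distrib_right)
  qed
  \<comment> \<open>The mass that the weight puts on the cell of points rounded to
    \<open>y\<close>.\<close>
  define c where "c i y = (\<integral>z. indicator (s i -` {y} \<inter> space lborel) z *\<^sub>R w z \<partial>lborel)" for i y
  have simp_int: "(\<integral>z. w z * g (s i z) \<partial>lborel) = (\<Sum>y\<in>s i ` space lborel. c i y * g y)"
      for g :: "'d phase \<Rightarrow> complex" and i
    unfolding c_def by (rule integral_simple_compose(2)[OF s(1) wi])
  let ?S = "\<lambda>i t. \<Sum>y\<in>s i ` space lborel. c i y * tf_atom y t"
  have S: "?S i \<in> schwartz_space" for i
    by (intro schwartz_sum schwartz_cmult tf_atom_schwartz)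
  have fS: "f (?S i) = (\<integral>z. w z * ?F (s i z) \<partial>lborel)" for i
    using simp_int[of ?F i]
    by (simp add: tempered_sum[OF f] schwartz_cmult tf_atom_schwartz tempered_cmult[OF f])
  have \<psi>: "?\<psi> \<in> schwartz_space"
    using tf_class_weighted_schwartz[OF tf_atom_class w] by simp
  \<comment> \<open>By linearity \<open>f\<close> of the finite sum is the discretised integral of
    \<open>V f\<close>, so the sums converge to the right-hand side of the claim.\<close>
  have z1: "(\<lambda>i. (\<integral>z. w z * ?F z \<partial>lborel) - f (?S i)) \<longlonglongrightarrow> 0"
  proof (rule Lim_null_comparison)
    show "\<forall>\<^sub>F i in sequentially. norm ((\<integral>z. w z * ?F z \<partial>lborel) - f (?S i)) \<le> C * \<delta> M i"
      unfolding fS \<delta>_def by (intro always_eventually allI s(2) Fm C Fi)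
    show "(\<lambda>i. C * \<delta> M i) \<longlonglongrightarrow> 0" by (rule tendsto_mult_right_zero[OF \<delta>])
  qed
  have 1: "(\<lambda>i. f (?S i)) \<longlonglongrightarrow> (\<integral>z. w z * ?F z \<partial>lborel)"
    using tendsto_diff[OF tendsto_const[of "\<integral>z. w z * ?F z \<partial>lborel"] z1] by simp
  obtain B n where B: "0 \<le> B" "\<And>\<phi>. \<phi> \<in> schwartz_space \<Longrightarrow> norm (f \<phi>) \<le> B * total_seminorm n \<phi>"
    using tempered_bounded[OF f] by blast
  \<comment> \<open>The same sums converge to the superposition in Schwartz space. At each
    \<open>t\<close> the function \<open>H (t, z)\<close> has Lipschitz constant
    \<open>D / (1 + norm t) ^ n\<close>, so the weight of the seminorm cancels and the bound is
    uniform in \<open>t\<close>.\<close>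
  have sem: "(\<lambda>i. schwartz_seminorm n is (\<lambda>t. ?\<psi> t - ?S i t)) \<longlonglongrightarrow> 0" for "is"
  proof -
    obtain H where H: "H \<in> tf_class" "\<And>z. iter_partial is (\<lambda>t. ?E (t, z)) = (\<lambda>t. H (t, z))"
      "\<And>w. rapid_weight w \<Longrightarrow> iter_partial is (\<lambda>t. \<integral>z. w z * ?E (t, z) \<partial>lborel) = (\<lambda>t. \<integral>z. w z * H (t, z) \<partial>lborel)"
      by (rule tf_class_iter_partial[OF tf_atom_class, of "is"]) blast
    obtain D N where D: "0 \<le> D" "\<And>t s z y. norm (s - t) \<le> 1 \<Longrightarrow>
      (1 + norm t) ^ n * norm (H (s, z) - H (t, y)) \<le> D * (1 + norm z + norm y) ^ N * (norm (s - t) + norm (z - y))"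
      by (rule tf_class_lipschitz[OF H(1), of n]) blast
    have "schwartz_seminorm n is (\<lambda>t. ?\<psi> t - ?S i t) \<le> D * \<delta> N i" for i
    proof (rule schwartz_seminorm_least)
      fix t :: "real ^ 'd"
      have p: "0 < (1 + norm t) ^ n" by (simp add: add_pos_nonneg)
      have "iter_partial is (?S i) = (\<lambda>t. \<Sum>y\<in>s i ` space lborel. c i y * iter_partial is (tf_atom y) t)"
        by (subst iter_partial_sum) (auto simp: schwartz_cmult tf_atom_schwartz iter_partial_cmult schwartz_smooth)
      also have "\<dots> = (\<lambda>t. \<Sum>y\<in>s i ` space lborel. c i y * H (t, y))"
        using H(2) by simp
      also have "\<dots> = (\<lambda>t. \<integral>z. w z * H (t, s i z) \<partial>lborel)"
        by (rule ext) (rule simp_int[symmetric])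
      finally have "iter_partial is (\<lambda>t. ?\<psi> t - ?S i t) t
          = (\<integral>z. w z * H (t, z) \<partial>lborel) - (\<integral>z. w z * H (t, s i z) \<partial>lborel)"
        using H(3)[OF w] iter_partial_diff[OF schwartz_smooth[OF \<psi>] schwartz_smooth[OF S[of i]], of "is"] by simp
      also have "norm \<dots> \<le> (D / (1 + norm t) ^ n) * \<delta> N i"
        unfolding \<delta>_def
      proof (rule s(2))
        show "(\<lambda>z. H (t, z)) \<in> borel_measurable borel" by (rule tf_class_measurable[OF H(1)])
        show "0 \<le> D / (1 + norm t) ^ n" using D(1) p by simp
        show "norm (H (t, z) - H (t, y)) \<le> D / (1 + norm t) ^ n * (1 + norm z + norm y) ^ N * norm (z - y)" for z y
          using D(2)[of t t z y] p by (simp add: field_simps)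
        show "integrable lborel (\<lambda>z. w z * H (t, z))" by (rule tf_class_weight_integrable[OF w H(1)])
      qed
      finally show "(1 + norm t) ^ n * norm (iter_partial is (\<lambda>t. ?\<psi> t - ?S i t) t) \<le> D * \<delta> N i"
        using p by (simp add: field_simps)
    qed
    then have "\<forall>\<^sub>F i in sequentially. norm (schwartz_seminorm n is (\<lambda>t. ?\<psi> t - ?S i t)) \<le> D * \<delta> N i"
      using schwartz_seminorm_nonneg[OF schwartz_diff[OF \<psi> S]] by (intro always_eventually allI) simp
    then show ?thesis by (rule Lim_null_comparison) (rule tendsto_mult_right_zero[OF \<delta>])
  qed
  have tot: "(\<lambda>i. B * total_seminorm n (\<lambda>t. ?\<psi> t - ?S i t)) \<longlonglongrightarrow> 0"
    unfolding total_seminorm_def by (intro tendsto_mult_right_zero tendsto_null_sum sem)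
  have z2: "(\<lambda>i. f ?\<psi> - f (?S i)) \<longlonglongrightarrow> 0"
  proof (rule Lim_null_comparison[OF _ tot])
    show "\<forall>\<^sub>F i in sequentially. norm (f ?\<psi> - f (?S i)) \<le> B * total_seminorm n (\<lambda>t. ?\<psi> t - ?S i t)"
      using B(2)[OF schwartz_diff[OF \<psi> S]] unfolding tempered_diff[OF f \<psi> S] by (intro always_eventually allI)
  qed
  have 2: "(\<lambda>i. f (?S i)) \<longlonglongrightarrow> f ?\<psi>"
    using tendsto_diff[OF tendsto_const[of "f ?\<psi>"] z2] by simp
  show "f ?\<psi> = (\<integral>z. w z * ?F z \<partial>lborel)"
    by (rule LIMSEQ_unique[OF 2 1])
qed

section \<open>Decay of the short-time Fourier transform\<close>

text \<open>Translation invariance makes the integral of every difference quotient vanish, and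
  dominated convergence passes to the derivative. No slicing into lines is involved.\<close>

lemma integral_directional_derivative_zero:
  fixes u :: "'a::euclidean_space \<Rightarrow> complex"
  assumes d: "\<And>t. (u has_derivative u' t) (at t)" and e: "norm e = 1"
    and b: "\<And>t. (1 + norm t) ^ (2 * DIM('a)) * norm (u t) \<le> B"
    and b': "\<And>t. (1 + norm t) ^ (2 * DIM('a)) * norm (u' t e) \<le> B"
  shows "(\<integral>t. u' t e \<partial>lborel) = 0"
proof -
  let ?N = "2 * DIM('a)"
  have cont: "continuous_on UNIV u"
    by (intro continuous_at_imp_continuous_on ballI has_derivative_continuous[OF d])
  then have [measurable]: "u \<in> borel_measurable borel" by (rule borel_measurable_continuous_onI)
  have ui: "integrable lborel u" by (rule integrable_poly_decay(1)[OF _ b]) simp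
  have B0: "0 \<le> B" using b[of 0] by (rule order_trans[rotated]) simp
  define h where "h n = inverse (real (Suc n))" for n
  have h: "0 < h n" "h n \<le> 1" for n by (auto simp: h_def field_simps)
  define q where "q n t = (1 / h n) *\<^sub>R (u (h n *\<^sub>R e + t) - u t)" for n t
  have line: "((\<lambda>s. u (t + s *\<^sub>R e)) has_derivative (\<lambda>r. r *\<^sub>R u' (t + s *\<^sub>R e) e)) (at s)" for t s
  proof -
    have "((\<lambda>s. t + s *\<^sub>R e) has_derivative (\<lambda>r. r *\<^sub>R e)) (at s)"
      by (auto intro!: derivative_eq_intros)
    from has_derivative_compose[OF this d]
    show ?thesis by (simp add: linear_cmul[OF has_derivative_linear[OF d]])
  qed
  have lim: "(\<lambda>n. q n t) \<longlonglongrightarrow> u' t e" for t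
  proof -
    have "((\<lambda>s. norm (u (t + s *\<^sub>R e) - u t - s *\<^sub>R u' t e) / norm s) \<longlongrightarrow> 0) (at 0)"
      using line[of t 0] by (simp add: has_derivative_iff_norm)
    moreover have "filterlim h (at 0) sequentially"
      unfolding filterlim_at using LIMSEQ_inverse_real_of_nat h(1) by (auto simp: h_def[abs_def])
    ultimately have "(\<lambda>n. norm (u (t + h n *\<^sub>R e) - u t - h n *\<^sub>R u' t e) / norm (h n)) \<longlonglongrightarrow> 0"
      by (rule filterlim_compose)
    moreover have "norm (u (t + h n *\<^sub>R e) - u t - h n *\<^sub>R u' t e) / norm (h n) = norm (q n t - u' t e)" for n
    proof -
      have "q n t - u' t e = (1 / h n) *\<^sub>R (u (t + h n *\<^sub>R e) - u t - h n *\<^sub>R u' t e)"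
        using h(1)[of n] by (simp add: q_def scaleR_diff_right add.commute)
      then show ?thesis using h(1)[of n] by simp
    qed
    ultimately have "(\<lambda>n. norm (q n t - u' t e)) \<longlonglongrightarrow> 0" by simp
    then show ?thesis by (simp add: tendsto_norm_zero_iff LIM_zero_iff)
  qed
  \<comment> \<open>The mean value inequality on a segment of length at most 1, along which
    \<open>1 + norm t\<close> changes at most by a factor 2.\<close>
  have bound: "norm (q n t) \<le> (2 ^ ?N * B) * inverse ((1 + norm t) ^ ?N)" for n t
  proof -
    have p: "0 < (1 + norm t) ^ ?N" by (simp add: add_pos_nonneg)
    have on: "onorm (\<lambda>r. r *\<^sub>R u' (t + s *\<^sub>R e) e) \<le> 2 ^ ?N * B / (1 + norm t) ^ ?N" if s: "s \<in> {0..1}" for s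
    proof (rule onorm_le)
      fix r :: real
      have "norm t \<le> norm (t + s *\<^sub>R e) + norm (s *\<^sub>R e)" using norm_triangle_ineq4[of "t + s *\<^sub>R e" "s *\<^sub>R e"] by simp
      also have "norm (s *\<^sub>R e) \<le> 1" using s e by simp
      finally have "1 + norm t \<le> 2 * (1 + norm (t + s *\<^sub>R e))" by (smt (verit) norm_ge_zero)
      then have "(1 + norm t) ^ ?N * norm (u' (t + s *\<^sub>R e) e)
          \<le> (2 * (1 + norm (t + s *\<^sub>R e))) ^ ?N * norm (u' (t + s *\<^sub>R e) e)"
        by (intro mult_right_mono power_mono) auto
      also have "\<dots> \<le> 2 ^ ?N * B"
        unfolding power_mult_distrib mult.assoc by (intro mult_left_mono b') auto
      finally have "norm (u' (t + s *\<^sub>R e) e) \<le> 2 ^ ?N * B / (1 + norm t) ^ ?N"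
        using p by (simp add: field_simps)
      then have "\<bar>r\<bar> * norm (u' (t + s *\<^sub>R e) e) \<le> \<bar>r\<bar> * (2 ^ ?N * B / (1 + norm t) ^ ?N)"
        by (rule mult_left_mono) auto
      then show "norm (r *\<^sub>R u' (t + s *\<^sub>R e) e) \<le> 2 ^ ?N * B / (1 + norm t) ^ ?N * norm r"
        by (simp add: mult.commute)
    qed
    have "norm (u (t + h n *\<^sub>R e) - u (t + 0 *\<^sub>R e)) \<le> 2 ^ ?N * B / (1 + norm t) ^ ?N * norm (h n - 0)"
      by (rule differentiable_bound[of "{0..1}", OF _ has_derivative_at_withinI[OF line] on])
        (use h[of n] in \<open>auto simp: less_imp_le\<close>)
    then have "norm (u (t + h n *\<^sub>R e) - u t) / h n \<le> 2 ^ ?N * B / (1 + norm t) ^ ?N"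
      using h(1)[of n] by (simp add: field_simps)
    then show ?thesis
      using h(1)[of n] by (simp add: q_def add.commute divide_inverse mult.commute)
  qed
  have "(\<lambda>n. \<integral>t. q n t \<partial>lborel) \<longlonglongrightarrow> (\<integral>t. u' t e \<partial>lborel)"
  proof (rule integral_dominated_convergence)
    show "integrable lborel (\<lambda>t::'a. (2 ^ ?N * B) * inverse ((1 + norm t) ^ ?N))"
      by (intro integrable_mult_right integrable_inverse_power_norm)
    show qm: "q n \<in> borel_measurable lborel" for n unfolding q_def by measurable
    \<comment> \<open>The derivative is measurable as a pointwise limit of continuous difference
      quotients.\<close>
    show "(\<lambda>t. u' t e) \<in> borel_measurable lborel"
      by (rule borel_measurable_LIMSEQ_metric[OF qm lim])
  qed (auto intro!: AE_I2 lim bound)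
  moreover have "(\<integral>t. q n t \<partial>lborel) = 0" for n
  proof -
    have "integrable lborel (\<lambda>t. u (h n *\<^sub>R e + t))" by (rule lborel_integrable_shift[OF ui])
    then show ?thesis unfolding q_def using ui lborel_integral_shift[of u "h n *\<^sub>R e"] by simp
  qed
  ultimately show ?thesis by (simp add: LIMSEQ_const_iff)
qed

lemma tf_shift_gauss_derivative:
  "(tf_shift z gauss has_derivative
    (\<lambda>h. (\<i> * complex_of_real (2 * pi * (snd z \<bullet> h)) - complex_of_real (2 * pi * ((t - fst z) \<bullet> h))) * tf_shift z gauss t)) (at t)"
proof -
  let ?Q = "\<lambda>t. \<i> * complex_of_real (2 * pi * (snd z \<bullet> t)) - complex_of_real (pi * ((t - fst z) \<bullet> (t - fst z)))"
  have eq: "tf_shift z gauss = (\<lambda>t. exp (?Q t))"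
    by (simp add: fun_eq_iff tf_shift_def gauss_def cis_conv_exp exp_diff exp_minus exp_of_real[symmetric] divide_inverse)
  have Q: "(?Q has_derivative (\<lambda>h. \<i> * complex_of_real (2 * pi * (snd z \<bullet> h)) - complex_of_real (2 * pi * ((t - fst z) \<bullet> h)))) (at t)"
    by (auto intro!: derivative_eq_intros simp: fun_eq_iff inner_commute algebra_simps)
  have "(exp has_derivative (\<lambda>h. h * exp (?Q t))) (at (?Q t))"
    using DERIV_exp[of "?Q t"] by (simp add: has_field_derivative_def mult_commute_abs)
  from has_derivative_compose[OF Q this] show ?thesis unfolding eq .
qed

lemma norm_tf_shift [simp]: "norm (tf_shift z g t) = norm (g (t - fst z))"
  by (simp add: tf_shift_def norm_mult)

lemma continuous_on_gauss: "continuous_on UNIV gauss"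
  unfolding gauss_def by (intro continuous_intros)

text \<open>The factor \<open>q\<close> depends on \<open>t - x\<close> only, so that integration by parts gains a power of the
  frequency without losing decay in the position \<open>x\<close>.\<close>

definition atom_moment :: "(real ^ 'd::finite \<Rightarrow> complex) \<Rightarrow> (real ^ 'd \<Rightarrow> complex) \<Rightarrow> 'd phase \<Rightarrow> complex" where
  "atom_moment u q z = (\<integral>t. u t * (q (t - fst z) * tf_shift z gauss t) \<partial>lborel)"

lemma schwartz_continuous:
  assumes "\<phi> \<in> schwartz_space"
  shows "continuous_on UNIV (iter_partial is \<phi>)"
  by (intro continuous_at_imp_continuous_on ballI differentiable_imp_continuous_within smoothD schwartz_smooth assms)

lemma cpoly_continuous: "cpoly q \<Longrightarrow> continuous_on UNIV q"
  by (induction rule: cpoly.induct) (auto intro!: continuous_intros)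

lemma cpoly_gauss_decay:
  fixes q :: "real ^ 'd::finite \<Rightarrow> complex"
  assumes "cpoly q"
  obtains K where "0 \<le> K" "\<And>u. (1 + norm u) ^ m * norm (q u * gauss u) \<le> K"
proof -
  obtain C n where C: "0 \<le> C" "\<And>x. norm (q x) \<le> C * (1 + norm x) ^ n"
    using cpoly_bound[OF assms] by (rule poly_boundedE) blast
  have "(1 + norm u) ^ m * norm (q u * gauss u) \<le> C * exp ((real (m + n))\<^sup>2)" for u
  proof -
    have "(1 + norm u) ^ m * (norm (q u) * norm (gauss u))
        \<le> (1 + norm u) ^ m * ((C * (1 + norm u) ^ n) * norm (gauss u))"
      by (intro mult_left_mono mult_right_mono C) auto
    also have "\<dots> = C * ((1 + norm u) ^ (m + n) * norm (gauss u))" by (simp add: power_add mult_ac)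
    also have "\<dots> \<le> C * exp ((real (m + n))\<^sup>2)" by (intro mult_left_mono gauss_decay C(1))
    finally show ?thesis by (simp only: norm_mult)
  qed
  then show ?thesis using C(1) by (intro that[of "C * exp ((real (m + n))\<^sup>2)"]) auto
qed

text \<open>The inequality \<open>1 + norm x \<le> (1 + norm t) * (1 + norm (t - x))\<close>, with
  \<open>x = fst z\<close>, splits the position weight between the decay of \<phi> in
  \<open>t\<close> and that of \<open>q * gauss\<close> in \<open>t - x\<close>. The constant
  \<open>K\<close> does not involve \<phi>.\<close>

lemma atom_moment_integrand_bound:
  fixes q :: "real ^ 'd::finite \<Rightarrow> complex"
  assumes "cpoly q"
  obtains K where "0 \<le> K" "\<And>\<phi> is N z t. \<phi> \<in> schwartz_space \<Longrightarrow>
    (1 + norm t) ^ N * ((1 + norm (fst z)) ^ m * norm (iter_partial is \<phi> t * (q (t - fst z)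
        * tf_shift z gauss t))) \<le> K * schwartz_seminorm (N + m) is \<phi>"
proof -
  obtain K where K: "0 \<le> K" "\<And>u. (1 + norm u) ^ m * norm (q u * gauss u) \<le> K"
    by (rule cpoly_gauss_decay[OF assms]) blast
  have "(1 + norm t) ^ N * ((1 + norm (fst z)) ^ m * norm (iter_partial is \<phi> t * (q (t - fst z)
      * tf_shift z gauss t))) \<le> K * schwartz_seminorm (N + m) is \<phi>"
    if S: "\<phi> \<in> schwartz_space" for \<phi> "is" N z t
  proof -
    let ?a = "norm (iter_partial is \<phi> t)" and ?b = "norm (q (t - fst z) * gauss (t - fst z))"
    have "1 + norm (fst z) \<le> (1 + norm t) * (1 + norm (t - fst z))"
      using one_plus_norm_mult[of t "- (t - fst z)"] by (simp add: norm_minus_commute)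
    then have "(1 + norm (fst z)) ^ m * (?a * ?b) \<le> ((1 + norm t) * (1 + norm (t - fst z))) ^ m * (?a * ?b)"
      by (intro mult_right_mono power_mono) auto
    then have "(1 + norm t) ^ N * ((1 + norm (fst z)) ^ m * (?a * ?b))
        \<le> (1 + norm t) ^ N * (((1 + norm t) * (1 + norm (t - fst z))) ^ m * (?a * ?b))"
      by (intro mult_left_mono) auto
    also have "\<dots> = ((1 + norm t) ^ (N + m) * ?a) * ((1 + norm (t - fst z)) ^ m * ?b)"
      by (simp only: power_mult_distrib power_add mult_ac)
    also have "\<dots> \<le> schwartz_seminorm (N + m) is \<phi> * K"
      using S by (intro mult_mono schwartz_bound K schwartz_seminorm_nonneg) auto
    finally show ?thesis by (simp add: norm_mult mult_ac)
  qed
  with K(1) show thesis by (rule that)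
qed

lemma atom_moment_measurable:
  assumes "\<phi> \<in> schwartz_space" "cpoly q"
  shows "(\<lambda>t. iter_partial is \<phi> t * (q (t - fst z) * tf_shift z gauss t)) \<in> borel_measurable borel"
proof -
  have "continuous_on UNIV (tf_shift z gauss)"
    unfolding tf_shift_def cis_conv_exp by (intro continuous_intros continuous_on_compose2[OF continuous_on_gauss]) auto
  then show ?thesis
    by (intro borel_measurable_continuous_onI continuous_intros schwartz_continuous assms
        continuous_on_compose2[OF cpoly_continuous[OF assms(2)]]) auto
qed

lemma atom_moment_integrable:
  fixes \<phi> :: "real ^ 'd::finite \<Rightarrow> complex"
  assumes "\<phi> \<in> schwartz_space" "cpoly q"
  shows "integrable lborel (\<lambda>t. iter_partial is \<phi> t * (q (t - fst z) * tf_shift z gauss t))"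
proof -
  obtain K where K: "0 \<le> K" "\<And>\<phi> is N z t. \<phi> \<in> schwartz_space \<Longrightarrow>
    (1 + norm t) ^ N * ((1 + norm (fst z)) ^ 0 * norm (iter_partial is \<phi> t * (q (t - fst z)
        * tf_shift z gauss t))) \<le> K * schwartz_seminorm (N + 0) is \<phi>"
    by (rule atom_moment_integrand_bound[OF assms(2)]) blast
  show ?thesis
    by (rule integrable_poly_decay(1)[OF atom_moment_measurable[OF assms], where C
        = "K * schwartz_seminorm (2 * DIM(real ^ 'd)) is \<phi>"])
      (use K(2)[OF assms(1), of _ "2 * DIM(real ^ 'd)" z "is"] in auto)
qed

text \<open>The derivative in direction \<open>i\<close> of the integrand has integral zero. Its
  three contributions come from \<phi>, from the exponential, which yields the frequency factor, and
  from \<open>q\<close> times the Gaussian.\<close>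

lemma atom_moment_by_parts:
  fixes q :: "real ^ 'd::finite \<Rightarrow> complex" and i :: 'd
  assumes q: "cpoly q"
  obtains q1 where "cpoly q1" "\<And>\<phi> is z. \<phi> \<in> schwartz_space \<Longrightarrow> 
    2 * pi * \<i> * complex_of_real (snd z $ i) * atom_moment (iter_partial is \<phi>) q z =
      - atom_moment (iter_partial (i # is) \<phi>) q z - atom_moment (iter_partial is \<phi>) q1 z"
proof -
  obtain q' where q': "\<And>b. cpoly (q' b)"
    "\<And>x. (q has_derivative (\<lambda>h. \<Sum>b\<in>Basis. complex_of_real (h \<bullet> b) * q' b x)) (at x)"
    using cpoly_deriv[OF q] by blast
  let ?e = "axis i 1 :: real ^ 'd"
  \<comment> \<open>The partial derivative of \<open>q\<close> plus the factor
    \<open>- 2 * pi * u\<close> in direction \<open>i\<close> from the Gaussian: still a polynomial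
    in \<open>t - x\<close>.\<close>
  let ?q1 = "\<lambda>u. q' ?e u + (complex_of_real (- (2 * pi)) * complex_of_real (u \<bullet> ?e)) * q u"
  have q1: "cpoly ?q1" by (intro cpoly_add cpoly_mult cpoly_const cpoly_inner q q')
  have eB: "?e \<in> Basis" by (simp add: axis_in_Basis_iff)
  have "2 * pi * \<i> * complex_of_real (snd z $ i) * atom_moment (iter_partial is \<phi>) q z =
      - atom_moment (iter_partial (i # is) \<phi>) q z - atom_moment (iter_partial is \<phi>) ?q1 z"
    if S: "\<phi> \<in> schwartz_space" for \<phi> "is" and z :: "'d phase"
  proof -
    let ?N = "2 * DIM(real ^ 'd)"
    let ?T = "\<lambda>is q t. iter_partial is \<phi> t * (q (t - fst z) * tf_shift z gauss t)"
    let ?u' = "\<lambda>t h. iter_partial is \<phi> t * (q (t - fst z) * ((\<i> * complex_of_real (2 * pi * (snd z \<bullet> h))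
        - complex_of_real (2 * pi * ((t - fst z) \<bullet> h))) * tf_shift z gauss t)
       + (\<Sum>b\<in>Basis. complex_of_real (h \<bullet> b) * q' b (t - fst z)) * tf_shift z gauss t)
       + frechet_derivative (iter_partial is \<phi>) (at t) h * (q (t - fst z) * tf_shift z gauss t)"
    let ?c = "2 * pi * \<i> * complex_of_real (snd z $ i)"
    have d: "(?T is q has_derivative ?u' t) (at t)" for t
    proof -
      have "((\<lambda>t. t - fst z) has_derivative (\<lambda>h. h)) (at t)" by (auto intro!: derivative_eq_intros)
      from has_derivative_compose[OF this q'(2)]
      have "((\<lambda>t. q (t - fst z)) has_derivative (\<lambda>h. \<Sum>b\<in>Basis. complex_of_real (h \<bullet> b) * q' b (t - fst z))) (at t)" .
      from has_derivative_mult[OF smooth_has_derivative[OF schwartz_smooth[OF S], of "is"] has_derivative_mult[OF this tf_shift_gauss_derivative]]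
      show ?thesis .
    qed
    have ue: "?u' t ?e = ?T (i # is) q t + ?T is ?q1 t + ?c * ?T is q t" for t
      unfolding sum_Basis_inner[OF eB] by (simp add: iter_partial_Cons partial_deriv_def inner_axis algebra_simps)
    have bd: "\<exists>K. \<forall>t. (1 + norm t) ^ ?N * norm (?T js p t) \<le> K" if p: "cpoly p" for js p
    proof -
      obtain K where K: "0 \<le> K" "\<And>\<phi> is N z t. \<phi> \<in> schwartz_space \<Longrightarrow>
        (1 + norm t) ^ N * ((1 + norm (fst z)) ^ 0 * norm (iter_partial is \<phi> t * (p (t - fst z)
            * tf_shift z gauss t))) \<le> K * schwartz_seminorm (N + 0) is \<phi>"
        by (rule atom_moment_integrand_bound[OF p]) blast
      show ?thesis using K(2)[OF S, of _ ?N z js] by auto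
    qed
    obtain B1 where B1: "\<And>t. (1 + norm t) ^ ?N * norm (?T (i # is) q t) \<le> B1" using bd[OF q] by blast
    obtain B2 where B2: "\<And>t. (1 + norm t) ^ ?N * norm (?T is ?q1 t) \<le> B2" using bd[OF q1] by blast
    obtain B3 where B3: "\<And>t. (1 + norm t) ^ ?N * norm (?T is q t) \<le> B3" using bd[OF q] by blast
    define B where "B = max B3 (B1 + B2 + norm ?c * B3)"
    have "(\<integral>t. ?u' t ?e \<partial>lborel) = 0"
    proof (rule integral_directional_derivative_zero[OF d])
      show "norm ?e = 1" by simp
      show "(1 + norm t) ^ ?N * norm (?T is q t) \<le> B" for t using B3[of t] by (simp add: B_def)
      show "(1 + norm t) ^ ?N * norm (?u' t ?e) \<le> B" for t
      proof -
        have "norm (?u' t ?e) \<le> norm (?T (i # is) q t) + norm (?T is ?q1 t) + norm ?c * norm (?T is q t)"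
          unfolding ue norm_mult[of ?c, symmetric] by (intro norm_triangle_le add_right_mono norm_triangle_ineq)
        then have "(1 + norm t) ^ ?N * norm (?u' t ?e)
            \<le> (1 + norm t) ^ ?N * (norm (?T (i # is) q t) + norm (?T is ?q1 t) + norm ?c * norm (?T is q t))"
          by (intro mult_left_mono) auto
        also have "\<dots> = (1 + norm t) ^ ?N * norm (?T (i # is) q t) + (1 + norm t) ^ ?N * norm (?T is ?q1 t)
            + norm ?c * ((1 + norm t) ^ ?N * norm (?T is q t))"
          by (simp only: distrib_left mult_ac)
        also have "\<dots> \<le> B1 + B2 + norm ?c * B3" by (intro add_mono B1 B2 mult_left_mono B3 norm_ge_zero)
        finally show ?thesis by (simp add: B_def)
      qed
    qed
    then have "(\<integral>t. ?T (i # is) q t \<partial>lborel) + (\<integral>t. ?T is ?q1 t \<partial>lborel) + ?c * (\<integral>t. ?T is q t \<partial>lborel) = 0"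
      unfolding ue using atom_moment_integrable[OF S q] atom_moment_integrable[OF S q1] by simp
    then show ?thesis unfolding atom_moment_def by (simp add: add_eq_0_iff algebra_simps)
  qed
  with q1 show thesis by (rule that)
qed

text \<open>Induction on the power of the frequency, with the multi-index and the polynomial left
  arbitrary because integration by parts changes both. The constants are chosen before \<phi>, so
  decay is bounded by a seminorm.\<close>

lemma atom_moment_decay:
  fixes q :: "real ^ 'd::finite \<Rightarrow> complex"
  assumes "cpoly q"
  shows "\<exists>C n. 0 \<le> C \<and> (\<forall>\<phi>\<in>schwartz_space. \<forall>z.
    (1 + norm (fst z)) ^ m * (1 + norm (snd z)) ^ k * norm (atom_moment (iter_partial is \<phi>) q z)
        \<le> C * total_seminorm n \<phi>)"
  using assms
proof (induction k arbitrary: "is" q)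
  case 0
  let ?N = "2 * DIM(real ^ 'd)"
  let ?J = "\<integral>t. inverse ((1 + norm (t :: real ^ 'd)) ^ ?N) \<partial>lborel"
  have J: "0 \<le> ?J" by (rule Bochner_Integration.integral_nonneg) simp
  obtain K where K: "0 \<le> K" "\<And>\<phi> is N z t. \<phi> \<in> schwartz_space \<Longrightarrow>
    (1 + norm t) ^ N * ((1 + norm (fst z)) ^ m * norm (iter_partial is \<phi> t * (q (t - fst z)
        * tf_shift z gauss t))) \<le> K * schwartz_seminorm (N + m) is \<phi>"
    by (rule atom_moment_integrand_bound[OF 0]) blast
  define n where "n = max (?N + m) (length is)"
  have "(1 + norm (fst z)) ^ m * (1 + norm (snd z)) ^ 0 * norm (atom_moment (iter_partial is \<phi>) q z)
      \<le> (K * ?J) * total_seminorm n \<phi>"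
    if S: "\<phi> \<in> schwartz_space" for \<phi> and z :: "'d phase"
  proof -
    let ?f = "\<lambda>t. (1 + norm (fst z)) ^ m *\<^sub>R (iter_partial is \<phi> t * (q (t - fst z) * tf_shift z gauss t))"
    have "(1 + norm (fst z)) ^ m * norm (atom_moment (iter_partial is \<phi>) q z) = norm (\<integral>t. ?f t \<partial>lborel)"
      unfolding atom_moment_def integral_scaleR_right by (simp add: abs_of_nonneg add_nonneg_nonneg)
    also have "\<dots> \<le> (\<integral>t. norm (?f t) \<partial>lborel)" by (rule integral_norm_bound)
    also have "\<dots> \<le> (K * schwartz_seminorm (?N + m) is \<phi>) * ?J"
    proof (rule integrable_poly_decay(2))
      show "?f \<in> borel_measurable borel"
        by (intro borel_measurable_scaleR borel_measurable_const atom_moment_measurable S 0)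
      show "(1 + norm t) ^ ?N * norm (?f t) \<le> K * schwartz_seminorm (?N + m) is \<phi>" for t
        using K(2)[OF S, of t ?N z "is"] by (simp add: abs_of_nonneg add_nonneg_nonneg)
    qed
    also have "\<dots> \<le> (K * total_seminorm n \<phi>) * ?J"
      by (intro mult_right_mono mult_left_mono schwartz_seminorm_le_total S K(1) J) (auto simp: n_def)
    finally show ?thesis by (simp add: mult_ac)
  qed
  then show ?case using K(1) J by (intro exI[of _ "K * ?J"] exI[of _ n]) auto
next
  case (Suc k)
  let ?b = "\<lambda>js p C n. 0 \<le> C \<and> (\<forall>\<phi>\<in>schwartz_space. \<forall>z :: 'd phase.
    (1 + norm (fst z)) ^ m * (1 + norm (snd z)) ^ k * norm (atom_moment (iter_partial js \<phi>) p z)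
        \<le> C * total_seminorm n \<phi>)"
  obtain C0 n0 where C0: "?b is q C0 n0" using Suc by blast
  have "\<exists>C n. 0 \<le> C \<and> (\<forall>\<phi>\<in>schwartz_space. \<forall>z :: 'd phase.
    (1 + norm (fst z)) ^ m * (1 + norm (snd z)) ^ k * (\<bar>snd z $ i\<bar> * norm (atom_moment (iter_partial is \<phi>) q z))
        \<le> C * total_seminorm n \<phi>)" for i
  proof -
    obtain q1 where q1: "cpoly q1" "\<And>\<phi> is z. \<phi> \<in> schwartz_space \<Longrightarrow>
      2 * pi * \<i> * complex_of_real (snd z $ i) * atom_moment (iter_partial is \<phi>) q z =
      - atom_moment (iter_partial (i # is) \<phi>) q z - atom_moment (iter_partial is \<phi>) q1 z"
      by (rule atom_moment_by_parts[OF Suc.prems, of i]) blast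
    obtain C1 n1 where C1: "?b (i # is) q C1 n1" using Suc by blast
    obtain C2 n2 where C2: "?b is q1 C2 n2" using Suc.IH[OF q1(1)] by blast
    have "(1 + norm (fst z)) ^ m * (1 + norm (snd z)) ^ k * (\<bar>snd z $ i\<bar>
        * norm (atom_moment (iter_partial is \<phi>) q z)) \<le> (C1 + C2) * total_seminorm (max n1 n2) \<phi>"
      if S: "\<phi> \<in> schwartz_space" for \<phi> and z :: "'d phase"
    proof -
      let ?W = "(1 + norm (fst z)) ^ m * (1 + norm (snd z)) ^ k"
      let ?A = "atom_moment (iter_partial (i # is) \<phi>) q z" and ?B = "atom_moment (iter_partial is \<phi>) q1 z"
      have W: "0 \<le> ?W" by simp
      have "2 * pi * (\<bar>snd z $ i\<bar> * norm (atom_moment (iter_partial is \<phi>) q z))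
          = norm (2 * pi * \<i> * complex_of_real (snd z $ i) * atom_moment (iter_partial is \<phi>) q z)"
        by (simp add: norm_mult)
      also have "\<dots> \<le> norm ?A + norm ?B"
        unfolding q1(2)[OF S] using norm_triangle_ineq4[of "- ?A" ?B] by simp
      finally have "2 * pi * (\<bar>snd z $ i\<bar> * norm (atom_moment (iter_partial is \<phi>) q z)) \<le> norm ?A + norm ?B" .
      moreover have "1 * (\<bar>snd z $ i\<bar> * norm (atom_moment (iter_partial is \<phi>) q z))
          \<le> 2 * pi * (\<bar>snd z $ i\<bar> * norm (atom_moment (iter_partial is \<phi>) q z))"
        using pi_gt3 by (intro mult_right_mono) auto
      ultimately have "\<bar>snd z $ i\<bar> * norm (atom_moment (iter_partial is \<phi>) q z) \<le> norm ?A + norm ?B" by simp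
      then have "?W * (\<bar>snd z $ i\<bar> * norm (atom_moment (iter_partial is \<phi>) q z)) \<le> ?W * norm ?A + ?W * norm ?B"
        using mult_left_mono[OF _ W] by (simp only: distrib_left[symmetric])
      also have "\<dots> \<le> C1 * total_seminorm n1 \<phi> + C2 * total_seminorm n2 \<phi>"
        using C1 C2 S by (intro add_mono) blast+
      also have "\<dots> \<le> C1 * total_seminorm (max n1 n2) \<phi> + C2 * total_seminorm (max n1 n2) \<phi>"
        using C1 C2 S by (intro add_mono mult_left_mono total_seminorm_mono) auto
      finally show ?thesis by (simp add: distrib_right)
    qed
    with C1 C2 show ?thesis by (intro exI[of _ "C1 + C2"] exI[of _ "max n1 n2"]) auto
  qed
  then have "\<forall>i. \<exists>Cn. 0 \<le> fst Cn \<and> (\<forall>\<phi>\<in>schwartz_space. \<forall>z :: 'd phase.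
    (1 + norm (fst z)) ^ m * (1 + norm (snd z)) ^ k * (\<bar>snd z $ i\<bar> * norm (atom_moment (iter_partial is \<phi>) q z))
        \<le> fst Cn * total_seminorm (snd Cn) \<phi>)"
    by simp
  from choice[OF this] obtain c where c: "\<And>i. 0 \<le> fst (c i)" "\<And>i \<phi> z. \<phi> \<in> schwartz_space \<Longrightarrow>
    (1 + norm (fst z)) ^ m * (1 + norm (snd z)) ^ k * (\<bar>snd z $ i\<bar> * norm (atom_moment (iter_partial is \<phi>) q z))
        \<le> fst (c i) * total_seminorm (snd (c i)) \<phi>"
    by blast
  \<comment> \<open>Sums dominate each of their terms, so a single order and a single constant cover
    all coordinates and the case without an additional frequency factor.\<close>
  define n where "n = n0 + (\<Sum>i\<in>UNIV. snd (c i))"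
  define C where "C = C0 + (\<Sum>i\<in>UNIV. fst (c i))"
  have "(1 + norm (fst z)) ^ m * (1 + norm (snd z)) ^ Suc k * norm (atom_moment (iter_partial is \<phi>) q z)
      \<le> C * total_seminorm n \<phi>"
    if S: "\<phi> \<in> schwartz_space" for \<phi> and z :: "'d phase"
  proof -
    let ?W = "(1 + norm (fst z)) ^ m * (1 + norm (snd z)) ^ k"
    let ?A = "norm (atom_moment (iter_partial is \<phi>) q z)"
    \<comment> \<open>The norm of the frequency is at most the sum of the moduli of its coordinates,
      to each of which integration by parts has been applied.\<close>
    have "?W * (1 + norm (snd z)) * ?A \<le> ?W * (1 + (\<Sum>i\<in>UNIV. \<bar>snd z $ i\<bar>)) * ?A"
      using norm_le_l1_cart[of "snd z"] by (intro mult_right_mono mult_left_mono) auto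
    also have "\<dots> = ?W * ?A + (\<Sum>i\<in>UNIV. ?W * (\<bar>snd z $ i\<bar> * ?A))"
      by (simp add: distrib_left distrib_right sum_distrib_left sum_distrib_right mult.assoc)
    also have "\<dots> \<le> C0 * total_seminorm n \<phi> + (\<Sum>i\<in>UNIV. fst (c i) * total_seminorm n \<phi>)"
    proof (intro add_mono sum_mono)
      have "?W * ?A \<le> C0 * total_seminorm n0 \<phi>" using C0 S by blast
      also have "\<dots> \<le> C0 * total_seminorm n \<phi>"
        using C0 S by (intro mult_left_mono total_seminorm_mono) (auto simp: n_def)
      finally show "?W * ?A \<le> C0 * total_seminorm n \<phi>" .
      fix i
      have "?W * (\<bar>snd z $ i\<bar> * ?A) \<le> fst (c i) * total_seminorm (snd (c i)) \<phi>" by (rule c(2)[OF S])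
      also have "snd (c i) \<le> n" using member_le_sum[of i UNIV "\<lambda>i. snd (c i)"] by (simp add: n_def)
      then have "fst (c i) * total_seminorm (snd (c i)) \<phi> \<le> fst (c i) * total_seminorm n \<phi>"
        using c(1) S by (intro mult_left_mono total_seminorm_mono)
      finally show "?W * (\<bar>snd z $ i\<bar> * ?A) \<le> fst (c i) * total_seminorm n \<phi>" .
    qed
    also have "\<dots> = C * total_seminorm n \<phi>" by (simp add: C_def distrib_right sum_distrib_right)
    finally show ?thesis by (simp add: mult_ac)
  qed
  moreover have "0 \<le> C" using C0 c(1) by (auto simp: C_def intro!: add_nonneg_nonneg sum_nonneg)
  ultimately show ?case by blast
qed

text \<open>The \<open>U \<phi>\<close> of the inversion formula. It pairs \<phi> bilinearly with
  the unconjugated shift, which makes it the conjugate of the short-time Fourier transform of the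
  conjugate of \<phi>; this matches distributions acting without conjugation.\<close>

definition atom_transform :: "(real ^ 'd::finite \<Rightarrow> complex) \<Rightarrow> 'd phase \<Rightarrow> complex" where
  "atom_transform \<phi> z = (\<integral>t. \<phi> t * tf_shift z gauss t \<partial>lborel)"

lemma atom_transform_moment: "atom_transform \<phi> = atom_moment (iter_partial [] \<phi>) (\<lambda>u. 1)"
  by (simp add: atom_transform_def atom_moment_def fun_eq_iff)

lemma atom_transform_decay:
  obtains C n where "0 \<le> C" "\<And>\<phi> z. \<phi> \<in> schwartz_space \<Longrightarrow>
    (1 + norm (z :: 'd::finite phase)) ^ m * norm (atom_transform \<phi> z) \<le> C * total_seminorm n \<phi>"
proof -
  obtain C n where C: "0 \<le> C" "\<And>\<phi> z. \<phi> \<in> schwartz_space \<Longrightarrow>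
    (1 + norm (fst z)) ^ m * (1 + norm (snd z)) ^ m * norm (atom_transform \<phi> (z :: 'd phase)) \<le> C * total_seminorm n \<phi>"
    unfolding atom_transform_moment using atom_moment_decay[OF cpoly_const] by metis
  have "(1 + norm z) ^ m * norm (atom_transform \<phi> z) \<le> C * total_seminorm n \<phi>" if S: "\<phi> \<in> schwartz_space"
      for \<phi> and z :: "'d phase"
  proof -
    have "norm z \<le> norm (fst z) + norm (snd z)" using norm_Pair_le[of "fst z" "snd z"] by simp
    then have "1 + norm z \<le> (1 + norm (fst z)) * (1 + norm (snd z))"
      using mult_nonneg_nonneg[of "norm (fst z)" "norm (snd z)"]
          by (simp add: distrib_left distrib_right del: mult_nonneg_nonneg)
    then have "(1 + norm z) ^ m * norm (atom_transform \<phi> z)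
        \<le> ((1 + norm (fst z)) * (1 + norm (snd z))) ^ m * norm (atom_transform \<phi> z)"
      by (intro mult_right_mono power_mono) auto
    then show ?thesis using C(2)[OF S, of z] by (simp add: power_mult_distrib)
  qed
  with C(1) show thesis by (rule that)
qed

lemma tf_shift_gauss_measurable: "(\<lambda>(z, t). tf_shift z gauss t) \<in> borel_measurable borel"
  unfolding tf_shift_def cis_conv_exp case_prod_unfold
  by (intro borel_measurable_continuous_onI continuous_intros continuous_on_compose2[OF continuous_on_gauss]) auto

text \<open>Joint measurability of the atoms in \<open>(z, t)\<close> makes the parameter integral
  measurable. A merely measurable \<open>h\<close> is allowed, so that the fact covers
  \<open>M1\<close> as well as Schwartz functions.\<close>

lemma borel_measurable_atom_integral:
  fixes h :: "real ^ 'd::finite \<Rightarrow> complex"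
  assumes [measurable]: "h \<in> borel_measurable borel"
  shows "(\<lambda>z. \<integral>t. h t * tf_shift z gauss t \<partial>lborel) \<in> borel_measurable borel"
proof -
  have "(\<lambda>(z, t). tf_shift z gauss t) \<in> borel_measurable (borel \<Otimes>\<^sub>M (lborel :: (real ^ 'd) measure))"
    using tf_shift_gauss_measurable by (simp add: borel_prod[symmetric] cong: measurable_cong_sets)
  then have "(\<lambda>(z, t). h t * tf_shift z gauss t) \<in> borel_measurable (borel \<Otimes>\<^sub>M (lborel :: (real ^ 'd) measure))"
    by (simp add: case_prod_unfold)
  then show ?thesis by (rule lborel.borel_measurable_lebesgue_integral)
qed

lemma atom_transform_rapid:
  fixes \<phi> :: "real ^ 'd::finite \<Rightarrow> complex"
  assumes S: "\<phi> \<in> schwartz_space"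
  shows "rapid_weight (atom_transform \<phi>)"
proof -
  have m: "atom_transform \<phi> \<in> borel_measurable borel"
    unfolding atom_transform_def using schwartz_continuous[OF S, of "[]"]
    by (intro borel_measurable_atom_integral borel_measurable_continuous_onI) simp
  have "integrable lborel (\<lambda>z. (1 + norm z) ^ M * norm (atom_transform \<phi> z))" for M
  proof -
    obtain C n where C: "0 \<le> C" "\<And>\<phi> z. \<phi> \<in> schwartz_space \<Longrightarrow>
      (1 + norm (z :: 'd phase)) ^ (2 * DIM('d phase) + M) * norm (atom_transform \<phi> z) \<le> C * total_seminorm n \<phi>"
      by (rule atom_transform_decay) blast
    show ?thesis
      by (rule integrable_poly_decay(1)[where C = "C * total_seminorm n \<phi>"])
        (use m C(2)[OF S] in \<open>simp_all add: power_add mult.assoc abs_mult add_nonneg_nonneg\<close>)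
  qed
  with m show ?thesis by (simp add: rapid_weight_def)
qed

lemma atom_transform_integral_bound:
  obtains C n where "0 \<le> C" "\<And>\<phi>. \<phi> \<in> schwartz_space \<Longrightarrow>
    (\<integral>z. norm (atom_transform \<phi> (z :: 'd::finite phase)) \<partial>lborel) \<le> C * total_seminorm n \<phi>"
proof -
  obtain C n where C: "0 \<le> C" "\<And>\<phi> z. \<phi> \<in> schwartz_space \<Longrightarrow>
    (1 + norm (z :: 'd phase)) ^ (2 * DIM('d phase)) * norm (atom_transform \<phi> z) \<le> C * total_seminorm n \<phi>"
    by (rule atom_transform_decay) blast
  let ?J = "\<integral>z. inverse ((1 + norm (z :: 'd phase)) ^ (2 * DIM('d phase))) \<partial>lborel"
  have "(\<integral>z. norm (atom_transform \<phi> (z :: 'd phase)) \<partial>lborel) \<le> (C * ?J) * total_seminorm n \<phi>"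
      if S: "\<phi> \<in> schwartz_space" for \<phi>
    using integrable_poly_decay(2)[OF rapid_weight_measurable[OF atom_transform_rapid[OF S]] C(2)[OF S]]
        by (simp add: mult_ac)
  moreover have "0 \<le> ?J" by (rule Bochner_Integration.integral_nonneg) simp
  ultimately show thesis using C(1) by (intro that[of "C * ?J" n]) auto
qed

section \<open>Inversion\<close>

lemma gauss_zero [simp]: "gauss 0 = 1"
  by (simp add: gauss_def)

lemma gauss_minus: "gauss (- x) = gauss x"
  by (simp add: gauss_def)

lemma norm_gauss_le: "norm (gauss x) \<le> 1"
  by (simp add: gauss_def)

lemma gauss_measurable [measurable]: "gauss \<in> borel_measurable borel"
  by (rule borel_measurable_continuous_onI[OF continuous_on_gauss])

lemma integrable_gauss: "integrable lborel gauss"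
  using gauss_fourier(1)[of 0] by simp

lemma integral_gauss: "(\<integral>x. gauss x \<partial>(lborel :: (real ^ 'd::finite) measure)) = 1"
  using gauss_fourier(2)[of 0] by simp

lemma gauss_fourier_scaled:
  fixes y :: "real ^ 'd::finite"
  assumes "0 < \<epsilon>"
  shows "integrable lborel (\<lambda>w. cis (2 * pi * (w \<bullet> y)) * gauss (\<epsilon> *\<^sub>R w))"
    and "(\<integral>w. cis (2 * pi * (w \<bullet> y)) * gauss (\<epsilon> *\<^sub>R w) \<partial>lborel)
        = inverse (\<epsilon> ^ DIM(real ^ 'd)) *\<^sub>R gauss ((1 / \<epsilon>) *\<^sub>R y)"
proof -
  let ?f = "\<lambda>v. cis (2 * pi * (v \<bullet> ((1 / \<epsilon>) *\<^sub>R y))) * gauss v"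
  have eq: "?f (\<epsilon> *\<^sub>R w) = cis (2 * pi * (w \<bullet> y)) * gauss (\<epsilon> *\<^sub>R w)" for w
    using assms by simp
  have i: "integrable lborel ?f" by (rule gauss_fourier(1))
  show "integrable lborel (\<lambda>w. cis (2 * pi * (w \<bullet> y)) * gauss (\<epsilon> *\<^sub>R w))"
    using lborel_integrable_scale[OF i assms] unfolding eq .
  have "(\<integral>v. ?f v \<partial>lborel) = \<epsilon> ^ DIM(real ^ 'd) *\<^sub>R (\<integral>w. ?f (\<epsilon> *\<^sub>R w) \<partial>lborel)"
    by (rule lborel_integral_scale[OF _ assms]) (use i in auto)
  then have "gauss ((1 / \<epsilon>) *\<^sub>R y) = \<epsilon> ^ DIM(real ^ 'd) *\<^sub>R (\<integral>w. cis (2 * pi * (w \<bullet> y)) * gauss (\<epsilon> *\<^sub>R w) \<partial>lborel)"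
    unfolding eq gauss_fourier(2) .
  then show "(\<integral>w. cis (2 * pi * (w \<bullet> y)) * gauss (\<epsilon> *\<^sub>R w) \<partial>lborel)
      = inverse (\<epsilon> ^ DIM(real ^ 'd)) *\<^sub>R gauss ((1 / \<epsilon>) *\<^sub>R y)"
    using assms by simp
qed

text \<open>Gaussian summation of the Fourier integral.\<close>

lemma fourier_inversion:
  fixes u :: "real ^ 'd::finite \<Rightarrow> complex"
  assumes cont: "continuous_on UNIV u" and bdd: "\<And>s. norm (u s) \<le> B" and int: "integrable lborel u"
    and int': "integrable lborel (\<lambda>w. \<integral>s. u s * cis (2 * pi * (w \<bullet> s)) \<partial>lborel)"
  shows "(\<integral>w. (\<integral>s. u s * cis (2 * pi * (w \<bullet> s)) \<partial>lborel) * cis (- (2 * pi * (w \<bullet> t))) \<partial>lborel) = u t"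
proof -
  let ?U = "\<lambda>w. \<integral>s. u s * cis (2 * pi * (w \<bullet> s)) \<partial>lborel"
  have [measurable]: "u \<in> borel_measurable borel" by (rule borel_measurable_continuous_onI[OF cont])
  have [measurable]: "?U \<in> borel_measurable borel" using int' by simp
  have [measurable]: "(\<lambda>x. cis (f x)) \<in> borel_measurable M" if [measurable]: "f \<in> borel_measurable M"
      for f :: "'z \<Rightarrow> real" and M
    unfolding cis_conv_exp by measurable
  define \<epsilon> where "\<epsilon> n = inverse (real (Suc n))" for n
  have \<epsilon>: "0 < \<epsilon> n" for n by (simp add: \<epsilon>_def)
  have \<epsilon>0: "\<epsilon> \<longlonglongrightarrow> 0" unfolding \<epsilon>_def[abs_def] by (rule LIMSEQ_inverse_real_of_nat)
  have g1: "(\<lambda>n. gauss (\<epsilon> n *\<^sub>R w)) \<longlonglongrightarrow> 1" for w :: "real ^ 'd"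
  proof -
    have "(\<lambda>n. \<epsilon> n *\<^sub>R w) \<longlonglongrightarrow> 0 *\<^sub>R w" by (intro tendsto_intros \<epsilon>0)
    then have "(\<lambda>n. gauss (\<epsilon> n *\<^sub>R w)) \<longlonglongrightarrow> gauss (0 *\<^sub>R w)"
      by (rule continuous_on_tendsto_compose[OF continuous_on_gauss]) auto
    then show ?thesis by simp
  qed
  \<comment> \<open>The Fourier integral regularised by a Gaussian that spreads out as
    \<open>\<epsilon> n\<close> tends to zero; its limit is computed in two ways.\<close>
  define I where "I n = (\<integral>w. ?U w * cis (- (2 * pi * (w \<bullet> t))) * gauss (\<epsilon> n *\<^sub>R w) \<partial>lborel)" for n
  have L1: "I \<longlonglongrightarrow> (\<integral>w. ?U w * cis (- (2 * pi * (w \<bullet> t))) \<partial>lborel)"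
    unfolding I_def
  proof (rule integral_dominated_convergence[where w = "\<lambda>w. norm (?U w)"])
    show "AE w in lborel. (\<lambda>n. ?U w * cis (- (2 * pi * (w \<bullet> t))) * gauss (\<epsilon> n *\<^sub>R w))
        \<longlonglongrightarrow> ?U w * cis (- (2 * pi * (w \<bullet> t)))"
      by (rule AE_I2) (use tendsto_mult[OF tendsto_const g1] in fastforce)
    show "AE w in lborel. norm (?U w * cis (- (2 * pi * (w \<bullet> t))) * gauss (\<epsilon> n *\<^sub>R w)) \<le> norm (?U w)" for n
      by (rule AE_I2) (simp add: norm_mult mult_left_le norm_gauss_le)
  qed (use int' in \<open>auto\<close>)
  have I: "I n = (\<integral>v. u (t + \<epsilon> n *\<^sub>R v) * gauss v \<partial>lborel)" for n
  proof -
    let ?e = "\<epsilon> n"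
    let ?f = "\<lambda>w s. u s * (cis (2 * pi * (w \<bullet> (s - t))) * gauss (?e *\<^sub>R w))"
    have gi: "integrable lborel (\<lambda>w :: real ^ 'd. gauss (?e *\<^sub>R w))"
      by (rule lborel_integrable_scale[OF integrable_gauss \<epsilon>])
    \<comment> \<open>The double integral converges absolutely only through the Gaussian factor in
      \<open>w\<close>: the rest of the integrand has modulus \<open>norm (u s)\<close> for every
      \<open>w\<close>.\<close>
    have prod: "integrable (lborel \<Otimes>\<^sub>M lborel) (\<lambda>(w, s). ?f w s)"
    proof (rule lborel_pair.Fubini_integrable)
      show "(\<lambda>(w, s). ?f w s) \<in> borel_measurable (lborel \<Otimes>\<^sub>M lborel)" by measurable
      have "integrable lborel (\<lambda>w :: real ^ 'd. norm (gauss (?e *\<^sub>R w)) * (\<integral>s. norm (u s) \<partial>lborel))"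
        by (intro integrable_mult_left integrable_norm gi)
      then show "integrable lborel (\<lambda>w. \<integral>s. norm (case (w, s) of (w, s) \<Rightarrow> ?f w s) \<partial>lborel)"
        using gi by (simp add: norm_mult mult_ac)
      show "AE w in lborel. integrable lborel (\<lambda>s. case (w, s) of (w, s) \<Rightarrow> ?f w s)"
      proof (rule AE_I2)
        fix w :: "real ^ 'd"
        show "integrable lborel (\<lambda>s. case (w, s) of (w, s) \<Rightarrow> ?f w s)"
          by (rule Bochner_Integration.integrable_bound[OF int]) (auto simp: norm_mult mult_left_le norm_gauss_le)
      qed
    qed
    have "I n = (\<integral>w. \<integral>s. ?f w s \<partial>lborel \<partial>lborel)"
      unfolding I_def
    proof (rule Bochner_Integration.integral_cong[OF refl])
      fix w
      have "?U w * cis (- (2 * pi * (w \<bullet> t))) * gauss (?e *\<^sub>R w)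
          = (\<integral>s. u s * cis (2 * pi * (w \<bullet> s)) * (cis (- (2 * pi * (w \<bullet> t))) * gauss (?e *\<^sub>R w)) \<partial>lborel)"
        by (simp only: mult.assoc[symmetric] integral_mult_left_zero)
      also have "\<dots> = (\<integral>s. ?f w s \<partial>lborel)"
        by (rule Bochner_Integration.integral_cong[OF refl])
          (simp add: inner_diff_right right_diff_distrib cis_mult[symmetric] cis_divide[symmetric] divide_inverse mult.assoc)
      finally show "?U w * cis (- (2 * pi * (w \<bullet> t))) * gauss (?e *\<^sub>R w) = (\<integral>s. ?f w s \<partial>lborel)" .
    qed
    also have "\<dots> = (\<integral>s. \<integral>w. ?f w s \<partial>lborel \<partial>lborel)"
      by (rule lborel_pair.Fubini_integral[OF prod, symmetric])
    also have "\<dots> = (\<integral>s. u s * (inverse (?e ^ DIM(real ^ 'd)) *\<^sub>R gauss ((1 / ?e) *\<^sub>R (s - t))) \<partial>lborel)"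
      by (simp only: integral_mult_right_zero gauss_fourier_scaled(2)[OF \<epsilon>])
    also have "\<dots> = (\<integral>s. u (t + s) * (inverse (?e ^ DIM(real ^ 'd)) *\<^sub>R gauss ((1 / ?e) *\<^sub>R s)) \<partial>lborel)"
      by (subst lborel_integral_shift[where a = t, symmetric]) auto
    also have "\<dots> = ?e ^ DIM(real ^ 'd) *\<^sub>R (\<integral>v. u (t + ?e *\<^sub>R v) * (inverse (?e ^ DIM(real ^ 'd)) *\<^sub>R gauss ((1 / ?e) *\<^sub>R (?e *\<^sub>R v))) \<partial>lborel)"
      by (rule lborel_integral_scale[OF _ \<epsilon>]) measurable
    also have "\<dots> = (\<integral>v. u (t + ?e *\<^sub>R v) * gauss v \<partial>lborel)"
      using \<epsilon>[of n] by (simp add: mult_scaleR_right)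
    finally show ?thesis .
  qed
  \<comment> \<open>The regularised integral is an average of \<open>u\<close> around
    \<open>t\<close> against a Gaussian of total mass 1, which shrinks to the value at
    \<open>t\<close> by continuity.\<close>
  have "(\<lambda>n. \<integral>v. u (t + \<epsilon> n *\<^sub>R v) * gauss v \<partial>lborel) \<longlonglongrightarrow> (\<integral>v. u t * gauss v \<partial>(lborel :: (real ^ 'd) measure))"
  proof (rule integral_dominated_convergence[where w = "\<lambda>v :: real ^ 'd. B * norm (gauss v)"])
    show "AE v in lborel. (\<lambda>n. u (t + \<epsilon> n *\<^sub>R v) * gauss v) \<longlonglongrightarrow> u t * gauss v"
    proof (rule AE_I2)
      fix v
      have "(\<lambda>n. t + \<epsilon> n *\<^sub>R v) \<longlonglongrightarrow> t + 0 *\<^sub>R v" by (intro tendsto_intros \<epsilon>0)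
      then have "(\<lambda>n. u (t + \<epsilon> n *\<^sub>R v)) \<longlonglongrightarrow> u (t + 0 *\<^sub>R v)"
        by (rule continuous_on_tendsto_compose[OF cont]) auto
      then show "(\<lambda>n. u (t + \<epsilon> n *\<^sub>R v) * gauss v) \<longlonglongrightarrow> u t * gauss v"
        by (intro tendsto_mult tendsto_const) simp
    qed
    show "AE v in lborel. norm (u (t + \<epsilon> n *\<^sub>R v) * gauss v) \<le> B * norm (gauss v)" for n
      by (rule AE_I2) (simp add: norm_mult mult_right_mono bdd)
  qed (auto intro!: integrable_mult_right integrable_norm integrable_gauss)
  then have L2: "I \<longlonglongrightarrow> u t"
    unfolding I[abs_def, symmetric] using integral_gauss[where 'd = 'd] by simp
  show ?thesis by (rule LIMSEQ_unique[OF L1 L2])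
qed

text \<open>For fixed position \<open>x\<close> the frequency integral is Fourier inversion of
  \<phi> times the Gaussian centred at \<open>x\<close>, multiplied once more by that Gaussian. What
  remains is \<open>\<phi> t\<close> times a squared Gaussian, whose integral over \<open>x\<close>
  is the constant.\<close>

lemma atom_transform_inversion:
  fixes \<phi> :: "real ^ 'd::finite \<Rightarrow> complex"
  assumes S: "\<phi> \<in> schwartz_space"
  shows "(\<integral>z. atom_transform \<phi> z * tf_atom z t \<partial>lborel) =
    complex_of_real (\<integral>t. (norm (gauss t :: complex))\<^sup>2 \<partial>(lborel :: (real ^ 'd) measure)) * \<phi> t"
proof -
  let ?V = "\<lambda>z. atom_transform \<phi> z * tf_atom z t"
  have c\<phi>: "continuous_on UNIV \<phi>" using schwartz_continuous[OF S, of "[]"] by simp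
  have inner: "(\<integral>w. ?V (x, w) \<partial>lborel) = \<phi> t * (gauss (t - x) * gauss (t - x))" for x
  proof -
    let ?u = "\<lambda>s. \<phi> s * gauss (s - x)"
    have b\<phi>: "norm (\<phi> s) \<le> schwartz_seminorm 0 [] \<phi>" for s
      using schwartz_bound[OF S, of s 0 "[]"] by simp
    have U: "atom_transform \<phi> (x, w) = (\<integral>s. ?u s * cis (2 * pi * (w \<bullet> s)) \<partial>lborel)" for w
      by (simp add: atom_transform_def tf_shift_def mult_ac)
    have "(\<integral>w. (\<integral>s. ?u s * cis (2 * pi * (w \<bullet> s)) \<partial>lborel) * cis (- (2 * pi * (w \<bullet> t))) \<partial>lborel) = ?u t"
    proof (rule fourier_inversion)
      show "continuous_on UNIV ?u"
        by (intro continuous_intros c\<phi> continuous_on_compose2[OF continuous_on_gauss]) auto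
      show "norm (?u s) \<le> schwartz_seminorm 0 [] \<phi>" for s
        using mult_mono[OF b\<phi>[of s] norm_gauss_le[of "s - x"] schwartz_seminorm_nonneg[OF S]] by (simp add: norm_mult)
      show "integrable lborel ?u"
      proof (rule Bochner_Integration.integrable_bound)
        show "integrable lborel (\<lambda>s. schwartz_seminorm 0 [] \<phi> * norm (gauss (- x + s)))"
          by (intro integrable_mult_right integrable_norm lborel_integrable_shift integrable_gauss)
        show "?u \<in> borel_measurable lborel"
          using borel_measurable_continuous_onI[OF c\<phi>] by simp
        show "AE s in lborel. norm (?u s) \<le> norm (schwartz_seminorm 0 [] \<phi> * norm (gauss (- x + s)))"
          by (rule AE_I2) (simp add: norm_mult abs_mult schwartz_seminorm_nonneg[OF S] mult_right_mono b\<phi>)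
      qed
      obtain C n where C: "0 \<le> C" "\<And>\<phi> z. \<phi> \<in> schwartz_space \<Longrightarrow>
        (1 + norm (z :: 'd phase)) ^ (2 * DIM(real ^ 'd)) * norm (atom_transform \<phi> z) \<le> C * total_seminorm n \<phi>"
        by (rule atom_transform_decay) blast
      show "integrable lborel (\<lambda>w. \<integral>s. ?u s * cis (2 * pi * (w \<bullet> s)) \<partial>lborel)"
        unfolding U[symmetric]
      proof (rule integrable_poly_decay(1))
        note [measurable] = rapid_weight_measurable[OF atom_transform_rapid[OF S]]
        show "(\<lambda>w. atom_transform \<phi> (x, w)) \<in> borel_measurable borel" by measurable
        fix w :: "real ^ 'd"
        have "norm w \<le> norm (x, w)" using norm_snd_le[of w x] by simp
        then have "(1 + norm w) ^ (2 * DIM(real ^ 'd)) * norm (atom_transform \<phi> (x, w))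
            \<le> (1 + norm (x, w)) ^ (2 * DIM(real ^ 'd)) * norm (atom_transform \<phi> (x, w))"
          by (intro mult_right_mono power_mono) auto
        also have "\<dots> \<le> C * total_seminorm n \<phi>" by (rule C(2)[OF S])
        finally show "(1 + norm w) ^ (2 * DIM(real ^ 'd)) * norm (atom_transform \<phi> (x, w)) \<le> C * total_seminorm n \<phi>" .
      qed
    qed
    note inv = this
    have "(\<integral>w. ?V (x, w) \<partial>lborel) = (\<integral>w. (\<integral>s. ?u s * cis (2 * pi * (w \<bullet> s)) \<partial>lborel) * cis (- (2 * pi * (w \<bullet> t))) * gauss (t - x) \<partial>lborel)"
      by (rule Bochner_Integration.integral_cong[OF refl], unfold U) (simp add: tf_shift_def cis_cnj gauss_def mult.assoc)
    also have "\<dots> = ?u t * gauss (t - x)" unfolding integral_mult_left_zero inv ..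
    finally show ?thesis by (simp add: mult_ac)
  qed
  have "integrable lborel ?V"
    using tf_class_weight_integrable[OF atom_transform_rapid[OF S] tf_atom_class, of t] by simp
  then have "integrable (lborel \<Otimes>\<^sub>M lborel) ?V" by (simp add: lborel_prod)
  from lborel_pair.integral_fst'[OF this]
  have "(\<integral>z. ?V z \<partial>lborel) = (\<integral>x. \<integral>w. ?V (x, w) \<partial>lborel \<partial>lborel)" by (simp add: lborel_prod)
  also have "\<dots> = \<phi> t * (\<integral>x. gauss (t - x) * gauss (t - x) \<partial>lborel)"
    unfolding inner by (rule integral_mult_right_zero)
  also have "(\<integral>x. gauss (t - x) * gauss (t - x) \<partial>lborel) = (\<integral>x. gauss (- t + x) * gauss (- t + x) \<partial>lborel)"
    by (simp add: gauss_minus[of "t - x" for x, symmetric])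
  also have "\<dots> = (\<integral>x. gauss x * gauss x \<partial>(lborel :: (real ^ 'd) measure))"
    by (rule lborel_integral_shift[of "\<lambda>x. gauss x * gauss x"]) measurable
  also have "\<dots> = (\<integral>x. complex_of_real ((norm (gauss x :: complex))\<^sup>2) \<partial>(lborel :: (real ^ 'd) measure))"
    by (rule Bochner_Integration.integral_cong) (auto simp: gauss_def power2_eq_square)
  also have "\<dots> = complex_of_real (\<integral>t. (norm (gauss t :: complex))\<^sup>2 \<partial>(lborel :: (real ^ 'd) measure))"
    by (rule integral_complex_of_real)
  finally show ?thesis by (simp add: mult.commute)
qed

text \<open>Since \<open>gauss (sqrt 2 *\<^sub>R t)\<close> is the square of \<open>gauss t\<close>,
  rescaling the integral of the Gaussian, which is 1, shows that the constant times a power of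
  \<open>sqrt 2\<close> equals 1.\<close>

lemma gauss_norm_pos:
  "complex_of_real (\<integral>t. (norm (gauss t :: complex))\<^sup>2 \<partial>(lborel :: (real ^ 'd::finite) measure)) \<noteq> 0"
proof -
  let ?d = "DIM(real ^ 'd)"
  have "1 = sqrt 2 ^ ?d *\<^sub>R (\<integral>t. gauss (sqrt 2 *\<^sub>R t) \<partial>(lborel :: (real ^ 'd) measure))"
    using lborel_integral_scale[of "gauss :: real ^ 'd \<Rightarrow> complex" "sqrt 2"] integral_gauss[where 'd = 'd] by simp
  also have "(\<integral>t. gauss (sqrt 2 *\<^sub>R t) \<partial>(lborel :: (real ^ 'd) measure))
      = (\<integral>x. complex_of_real ((norm (gauss x :: complex))\<^sup>2) \<partial>(lborel :: (real ^ 'd) measure))"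
    by (rule Bochner_Integration.integral_cong) (auto simp: gauss_def exp_double[symmetric] simp flip: of_real_power)
  also have "\<dots> = complex_of_real (\<integral>t. (norm (gauss t :: complex))\<^sup>2 \<partial>(lborel :: (real ^ 'd) measure))"
    by (rule integral_complex_of_real)
  finally show ?thesis by auto
qed

text \<open>The functional \<open>f\<close> applied to both sides of the inversion formula for
  \<phi>. It recovers \<open>f\<close> from its values on atoms, hence carries bounds and limits
  from the atoms to all test functions.\<close>

lemma tempered_reconstruction:
  fixes f :: "'d::finite dist"
  assumes f: "f \<in> tempered_distributions" and S: "\<phi> \<in> schwartz_space"
  shows "(\<integral>z. atom_transform \<phi> z * f (tf_atom z) \<partial>lborel) =
    complex_of_real (\<integral>t. (norm (gauss t :: complex))\<^sup>2 \<partial>(lborel :: (real ^ 'd) measure)) * f \<phi>"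
  using tempered_weighted_integral(1)[OF f atom_transform_rapid[OF S]]
  unfolding atom_transform_inversion[OF S] by (simp add: tempered_cmult[OF f S])

section \<open>Compactness\<close>

lemma stft_dist_gauss: "stft_dist gauss f z = f (tf_atom z)"
  by (simp add: stft_dist_def bracket_def)

lemma tempered_atom_continuous:
  assumes "f \<in> tempered_distributions"
  shows "continuous_on UNIV (\<lambda>z. f (tf_atom z))"
proof -
  obtain C M where "0 \<le> C" "\<And>z y. norm (f (tf_atom z) - f (tf_atom y)) \<le> C * (1 + norm z + norm y) ^ M * norm (z - y)"
    by (rule tempered_atom_lipschitz[OF assms]) blast
  from this(2) show ?thesis by (rule continuous_on_lipschitz_poly)
qed

lemma tempered_atom_bound:
  obtains C n where "0 \<le> C" "\<And>f B \<phi>. (f :: 'd::finite dist) \<in> tempered_distributions \<Longrightarrow>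
    (\<And>z. norm (f (tf_atom z)) \<le> B) \<Longrightarrow> \<phi> \<in> schwartz_space \<Longrightarrow> norm (f \<phi>) \<le> B * (C * total_seminorm n \<phi>)"
proof -
  let ?c = "complex_of_real (\<integral>t. (norm (gauss t :: complex))\<^sup>2 \<partial>(lborel :: (real ^ 'd) measure))"
  obtain C n where C: "0 \<le> C" "\<And>\<phi>. \<phi> \<in> schwartz_space \<Longrightarrow>
    (\<integral>z. norm (atom_transform \<phi> (z :: 'd phase)) \<partial>lborel) \<le> C * total_seminorm n \<phi>"
    by (rule atom_transform_integral_bound) blast
  have bound: "norm (f \<phi>) \<le> B * ((C / norm ?c) * total_seminorm n \<phi>)"
    if f: "f \<in> tempered_distributions" and B: "\<And>z. norm (f (tf_atom z)) \<le> B" and S: "\<phi> \<in> schwartz_space"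
        for f :: "'d dist" and B \<phi>
  proof -
    have B0: "0 \<le> B" using B[of 0] norm_ge_zero order_trans by blast
    have "norm ?c * norm (f \<phi>) = norm (\<integral>z. atom_transform \<phi> z * f (tf_atom z) \<partial>lborel)"
      unfolding tempered_reconstruction[OF f S] by (simp add: norm_mult)
    also have "\<dots> \<le> B * (\<integral>z. (1 + norm z) ^ 0 * norm (atom_transform \<phi> z) \<partial>lborel)"
      by (rule rapid_weight_integrable_mult(2)[OF atom_transform_rapid[OF S] borel_measurable_continuous_onI[OF tempered_atom_continuous[OF f]]])
        (simp add: B)
    also have "\<dots> \<le> B * (C * total_seminorm n \<phi>)"
      using C(2)[OF S] B0 by (intro mult_left_mono) auto
    finally have le: "norm (f \<phi>) * norm ?c \<le> B * (C * total_seminorm n \<phi>)" by (simp only: mult.commute)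
    have "0 < norm ?c" using gauss_norm_pos[where 'd = 'd] by (simp only: zero_less_norm_iff not_False_eq_True)
    with le have "norm (f \<phi>) \<le> B * (C * total_seminorm n \<phi>) / norm ?c" by (simp only: pos_le_divide_eq)
    then show ?thesis by (simp only: times_divide_eq_right times_divide_eq_left)
  qed
  show thesis
  proof (rule that)
    show "0 \<le> C / norm ?c" using C(1) by simp
    show "norm (f \<phi>) \<le> B * ((C / norm ?c) * total_seminorm n \<phi>)"
      if "f \<in> tempered_distributions" "\<And>z. norm (f (tf_atom z)) \<le> B" "\<phi> \<in> schwartz_space" for f :: "'d dist" and B \<phi>
      using bound[OF that] .
  qed
qed

lemma tempered_atom_equicontinuous:
  obtains C M where "0 \<le> C" "\<And>f z y. (f :: 'd::finite dist) \<in> tempered_distributions \<Longrightarrow>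
    (\<And>z. norm (f (tf_atom z)) \<le> 1) \<Longrightarrow> norm (f (tf_atom z) - f (tf_atom y))
        \<le> C * (1 + norm z + norm y) ^ M * norm (z - y)"
proof -
  obtain C n where C: "0 \<le> C" "\<And>f B \<phi>. (f :: 'd dist) \<in> tempered_distributions \<Longrightarrow>
    (\<And>z. norm (f (tf_atom z)) \<le> B) \<Longrightarrow> \<phi> \<in> schwartz_space \<Longrightarrow> norm (f \<phi>) \<le> B * (C * total_seminorm n \<phi>)"
    by (rule tempered_atom_bound) blast
  obtain D M where D: "0 \<le> D" "\<And>z y :: 'd phase. total_seminorm n (\<lambda>t. tf_atom z t - tf_atom y t)
      \<le> D * (1 + norm z + norm y) ^ M * norm (z - y)"
    by (rule tf_atom_lipschitz) blast
  have lip: "norm (f (tf_atom z) - f (tf_atom y)) \<le> (C * D) * (1 + norm z + norm y) ^ M * norm (z - y)"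
    if f: "f \<in> tempered_distributions" and B: "\<And>z. norm (f (tf_atom z)) \<le> 1" for f :: "'d dist" and z y
    using C(2)[OF f B schwartz_diff[OF tf_atom_schwartz tf_atom_schwartz], of z y] mult_left_mono[OF D(2)[of z y] C(1)]
    by (simp add: tempered_diff[OF f] tf_atom_schwartz mult.assoc)
  show thesis
  proof (rule that)
    show "0 \<le> C * D" using C(1) D(1) by simp
    show "norm (f (tf_atom z) - f (tf_atom y)) \<le> (C * D) * (1 + norm z + norm y) ^ M * norm (z - y)"
      if "f \<in> tempered_distributions" "\<And>z. norm (f (tf_atom z)) \<le> 1" for f :: "'d dist" and z y
      using lip[OF that] .
  qed
qed

text \<open>The set where the bound fails is open and null, hence empty. This turns the essential
  supremum in the norm of \<open>Minf\<close> into a bound at every point.\<close>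

lemma AE_continuous_le_everywhere:
  fixes g :: "'a::euclidean_space \<Rightarrow> real"
  assumes "continuous_on UNIV g" "AE z in lborel. g z \<le> B"
  shows "g z \<le> B"
proof (rule ccontr)
  assume "\<not> g z \<le> B"
  let ?A = "{z. B < g z}"
  have o: "open ?A" using assms(1) by (intro open_Collect_less continuous_on_const)
  obtain N where N: "\<And>z. z \<in> space lborel - N \<Longrightarrow> g z \<le> B" "N \<in> null_sets lborel"
    by (rule AE_E3[OF assms(2)]) (rule that; simp)
  have "?A \<subseteq> N" using N(1) by (force simp: not_le)
  then have "?A \<in> null_sets lborel"
    by (rule null_sets_subset[OF N(2), rotated]) (use borel_open[OF o] in simp)
  then have "negligible ?A" by (simp add: negligible_iff_null_sets null_sets_completionI)
  moreover have "z \<in> ?A" using \<open>\<not> g z \<le> B\<close> by simp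
  ultimately show False using open_not_negligible[OF o] by blast
qed

lemma MinfD:
  assumes "f \<in> Minf"
  shows "f \<in> tempered_distributions" and "\<exists>B. \<forall>z. norm (f (tf_atom z)) \<le> B"
proof -
  show f: "f \<in> tempered_distributions" using assms by (simp add: Minf_def)
  let ?B = "enn2real (Minf_norm f)"
  have fin: "Minf_norm f < \<infinity>" using assms by (simp add: Minf_def)
  have "AE z in lborel. ennreal (norm (f (tf_atom z))) \<le> Minf_norm f"
    unfolding Minf_norm_def stft_dist_gauss by (rule esssup_AE)
  then have "AE z in lborel. norm (f (tf_atom z)) \<le> ?B"
  proof eventually_elim
    case (elim z)
    then show ?case using fin enn2real_mono[of "ennreal (norm (f (tf_atom z)))" "Minf_norm f"] by simp
  qed
  from AE_continuous_le_everywhere[OF continuous_on_norm[OF tempered_atom_continuous[OF f]] this]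
  show "\<exists>B. \<forall>z. norm (f (tf_atom z)) \<le> B" by blast
qed

lemma MinfI:
  assumes f: "f \<in> tempered_distributions" and B: "\<And>z. norm (f (tf_atom z)) \<le> B"
  shows "f \<in> Minf"
proof -
  have "(\<lambda>z. ennreal (norm (f (tf_atom z)))) \<in> borel_measurable lborel"
    using borel_measurable_continuous_onI[OF tempered_atom_continuous[OF f]] by simp
  then have "Minf_norm f \<le> ennreal B"
    unfolding Minf_norm_def stft_dist_gauss by (rule esssup_I) (auto intro!: AE_I2 ennreal_leI B)
  then show ?thesis using f by (auto simp: Minf_def intro: order_le_less_trans)
qed

lemma tempered_bounded_subsequence:
  fixes f :: "nat \<Rightarrow> 'd::finite dist"
  assumes f: "\<And>k. f k \<in> tempered_distributions" and b: "\<And>k z. norm (f k (tf_atom z)) \<le> 1"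
  obtains r F where "strict_mono r" "F \<in> Minf" "\<And>z. (\<lambda>k. f (r k) (tf_atom z)) \<longlonglongrightarrow> F (tf_atom z)"
proof -
  let ?c = "complex_of_real (\<integral>t. (norm (gauss t :: complex))\<^sup>2 \<partial>(lborel :: (real ^ 'd) measure))"
  obtain C M where C: "0 \<le> C" "\<And>f z y. (f :: 'd dist) \<in> tempered_distributions \<Longrightarrow>
    (\<And>z. norm (f (tf_atom z)) \<le> 1) \<Longrightarrow> norm (f (tf_atom z) - f (tf_atom y))
        \<le> C * (1 + norm z + norm y) ^ M * norm (z - y)"
    by (rule tempered_atom_equicontinuous) blast
  obtain D :: "'d phase set" where D: "countable D" "\<And>X. open X \<Longrightarrow> X \<noteq> {} \<Longrightarrow> \<exists>d\<in>D. d \<in> X"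
    by (rule countable_dense_setE) blast
  \<comment> \<open>The diagonal argument gives convergence only on the countable dense set
    \<open>D\<close>; equicontinuity extends it to all of phase space.\<close>
  obtain r where r: "strict_mono (r :: nat \<Rightarrow> nat)" "\<And>z. z \<in> D \<Longrightarrow> \<exists>l. (\<lambda>k. f (r k) (tf_atom z)) \<longlonglongrightarrow> l"
    by (rule function_convergent_subsequence[OF D(1), of "\<lambda>k z. f k (tf_atom z)" 1]) (use b in blast)+
  have "Cauchy (\<lambda>k. f (r k) (tf_atom z))" for z
  proof (rule metric_CauchyI)
    fix e :: real assume e: "0 < e"
    \<comment> \<open>A modulus of continuity at \<open>z\<close> common to all \<open>f k\<close>.
      It is continuous in \<open>y\<close> and vanishes at \<open>z\<close>, so the set where it is
      below \<open>e / 3\<close> is an open neighbourhood of \<open>z\<close> and meets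
      \<open>D\<close>.\<close>
    let ?g = "\<lambda>y. C * (1 + norm z + norm y) ^ M * norm (z - y)"
    have o: "open {y. ?g y < e / 3}" by (intro open_Collect_less continuous_intros)
    have "z \<in> {y. ?g y < e / 3}" using e by simp
    then have "{y. ?g y < e / 3} \<noteq> {}" by blast
    from D(2)[OF o this] obtain d where d: "d \<in> D" "?g d < e / 3" by blast
    from r(2)[OF d(1)] have "Cauchy (\<lambda>k. f (r k) (tf_atom d))" using LIMSEQ_imp_Cauchy by blast
    then obtain N where N: "\<And>m n. m \<ge> N \<Longrightarrow> n \<ge> N \<Longrightarrow> dist (f (r m) (tf_atom d)) (f (r n) (tf_atom d)) < e / 3"
      using e unfolding Cauchy_def by (metis divide_pos_pos zero_less_numeral)
    have "dist (f (r m) (tf_atom z)) (f (r n) (tf_atom z)) < e" if "m \<ge> N" "n \<ge> N" for m n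
    proof -
      have 1: "dist (f (r k) (tf_atom z)) (f (r k) (tf_atom d)) < e / 3" for k
        using C(2)[OF f b, of "r k" z d] d(2) by (simp add: dist_norm)
      have "dist (f (r m) (tf_atom z)) (f (r n) (tf_atom z)) \<le>
        dist (f (r m) (tf_atom z)) (f (r m) (tf_atom d)) + dist (f (r m) (tf_atom d)) (f (r n) (tf_atom d))
            + dist (f (r n) (tf_atom z)) (f (r n) (tf_atom d))"
        by metric
      then show ?thesis using 1[of m] 1[of n] N[OF that] by linarith
    qed
    then show "\<exists>N. \<forall>m\<ge>N. \<forall>n\<ge>N. dist (f (r m) (tf_atom z)) (f (r n) (tf_atom z)) < e" by blast
  qed
  then have "convergent (\<lambda>k. f (r k) (tf_atom z))" for z by (rule Cauchy_convergent)
  then have L: "(\<lambda>k. f (r k) (tf_atom z)) \<longlonglongrightarrow> lim (\<lambda>k. f (r k) (tf_atom z))" for z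
    by (simp add: convergent_LIMSEQ_iff)
  \<comment> \<open>From atoms to all test functions: the reconstruction formula writes
    \<open>f (r k) \<phi>\<close> as an integral of the convergent transforms, dominated by the
    integrable \<open>norm (atom_transform \<phi> z)\<close>.\<close>
  have conv: "convergent (\<lambda>k. f (r k) \<phi>)" if S: "\<phi> \<in> schwartz_space" for \<phi>
  proof -
    let ?U = "atom_transform \<phi>"
    note [measurable] = rapid_weight_measurable[OF atom_transform_rapid[OF S]]
    have [measurable]: "(\<lambda>z. f (r k) (tf_atom z)) \<in> borel_measurable borel" for k
      by (rule borel_measurable_continuous_onI[OF tempered_atom_continuous[OF f]])
    have "(\<lambda>k. \<integral>z. ?U z * f (r k) (tf_atom z) \<partial>lborel) \<longlonglongrightarrow> (\<integral>z. ?U z * lim (\<lambda>k. f (r k) (tf_atom z)) \<partial>lborel)"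
    proof (rule integral_dominated_convergence[where w = "\<lambda>z. norm (?U z)"])
      have [measurable]: "(\<lambda>z. lim (\<lambda>k. f (r k) (tf_atom z))) \<in> borel_measurable borel"
        by (rule borel_measurable_LIMSEQ_metric[OF _ L]) measurable
      show "(\<lambda>z. ?U z * lim (\<lambda>k. f (r k) (tf_atom z))) \<in> borel_measurable lborel" by measurable
      show "(\<lambda>z. ?U z * f (r k) (tf_atom z)) \<in> borel_measurable lborel" for k by measurable
      show "integrable lborel (\<lambda>z. norm (?U z))"
          using rapid_weight_integrable[OF atom_transform_rapid[OF S], of 0] by simp
      show "AE z in lborel. (\<lambda>k. ?U z * f (r k) (tf_atom z)) \<longlonglongrightarrow> ?U z * lim (\<lambda>k. f (r k) (tf_atom z))"
        by (rule AE_I2) (intro tendsto_mult tendsto_const L)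
      show "AE z in lborel. norm (?U z * f (r k) (tf_atom z)) \<le> norm (?U z)" for k
        by (rule AE_I2) (simp add: norm_mult mult_left_le b)
    qed
    then have "(\<lambda>k. ?c * f (r k) \<phi>) \<longlonglongrightarrow> (\<integral>z. ?U z * lim (\<lambda>k. f (r k) (tf_atom z)) \<partial>lborel)"
      unfolding tempered_reconstruction[OF f S] .
    from tendsto_mult[OF tendsto_const[of "1 / ?c"] this] have "(\<lambda>k. f (r k) \<phi>)
        \<longlonglongrightarrow> 1 / ?c * (\<integral>z. ?U z * lim (\<lambda>k. f (r k) (tf_atom z)) \<partial>lborel)"
      using gauss_norm_pos[where 'd = 'd] by simp
    then show ?thesis by (rule convergentI)
  qed
  \<comment> \<open>The value zero outside the Schwartz space is the convention that
    \<open>tempered_distributions\<close> demands.\<close>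
  define F where "F \<phi> = (if \<phi> \<in> schwartz_space then lim (\<lambda>k. f (r k) \<phi>) else 0)" for \<phi>
  have F: "(\<lambda>k. f (r k) \<phi>) \<longlonglongrightarrow> F \<phi>" if "\<phi> \<in> schwartz_space" for \<phi>
    using conv[OF that] that by (simp add: F_def convergent_LIMSEQ_iff)
  obtain K n where K: "0 \<le> K" "\<And>f B \<phi>. (f :: 'd dist) \<in> tempered_distributions \<Longrightarrow>
    (\<And>z. norm (f (tf_atom z)) \<le> B) \<Longrightarrow> \<phi> \<in> schwartz_space \<Longrightarrow> norm (f \<phi>) \<le> B * (K * total_seminorm n \<phi>)"
    by (rule tempered_atom_bound) blast
  have FT: "F \<in> tempered_distributions"
  proof (rule tempered_distributionsI)
    fix \<phi> \<psi> :: "real ^ 'd \<Rightarrow> complex" assume S: "\<phi> \<in> schwartz_space" "\<psi> \<in> schwartz_space"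
    have "(\<lambda>k. f (r k) (\<lambda>t. \<phi> t + \<psi> t)) \<longlonglongrightarrow> F \<phi> + F \<psi>"
      unfolding tempered_add[OF f S] by (intro tendsto_add F S)
    then show "F (\<lambda>t. \<phi> t + \<psi> t) = F \<phi> + F \<psi>" by (rule LIMSEQ_unique[OF F[OF schwartz_add[OF S]]])
  next
    fix c and \<phi> :: "real ^ 'd \<Rightarrow> complex" assume S: "\<phi> \<in> schwartz_space"
    have "(\<lambda>k. f (r k) (\<lambda>t. c * \<phi> t)) \<longlonglongrightarrow> c * F \<phi>"
      unfolding tempered_cmult[OF f S] by (intro tendsto_mult tendsto_const F S)
    then show "F (\<lambda>t. c * \<phi> t) = c * F \<phi>" by (rule LIMSEQ_unique[OF F[OF schwartz_cmult[OF S]]])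
  next
    fix \<phi> :: "real ^ 'd \<Rightarrow> complex" assume S: "\<phi> \<in> schwartz_space"
    \<comment> \<open>The bound has the same \<open>K\<close> and \<open>n\<close> for all members
      of the sequence, so it passes to the limit; this is where continuity of \<open>F\<close> comes
      from.\<close>
    show "norm (F \<phi>) \<le> K * total_seminorm n \<phi>"
      by (rule LIMSEQ_le_const2[OF tendsto_norm[OF F[OF S]]]) (use K(2)[OF f b S] in simp)
  qed (simp add: F_def)
  have "F \<in> Minf"
    by (rule MinfI[OF FT, of 1]) (rule LIMSEQ_le_const2[OF tendsto_norm[OF F[OF tf_atom_schwartz]]], simp add: b)
  then show thesis using r(1) F[OF tf_atom_schwartz] that by blast
qed

section \<open>From pointwise to weak-star convergence\<close>

lemma M1_stft_integrable:
  assumes "h \<in> M1"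
  shows "integrable lborel (stft gauss h)"
proof (rule integrableI_bounded)
  have [measurable]: "h \<in> borel_measurable borel" using assms by (simp add: M1_def)
  have [measurable]: "cnj \<in> borel_measurable borel" by (intro borel_measurable_continuous_onI continuous_intros)
  have "(\<lambda>z. cnj (\<integral>t. cnj (h t) * tf_shift z gauss t \<partial>lborel)) \<in> borel_measurable borel"
    by (rule measurable_compose[OF borel_measurable_atom_integral]) measurable
  moreover have "stft gauss h = (\<lambda>z. cnj (\<integral>t. cnj (h t) * tf_shift z gauss t \<partial>lborel))"
    unfolding stft_def Bochner_Integration.integral_cnj[symmetric] by simp
  ultimately show "stft gauss h \<in> borel_measurable lborel" by simp
  show "(\<integral>\<^sup>+z. ennreal (norm (stft gauss h z)) \<partial>lborel) < \<infinity>"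
    using assms by (simp add: M1_def M1_norm_def)
qed

text \<open>Convergence may be tested on generating sets: finite intersections preserve eventual
  membership, and for a union one member containing the limit suffices.\<close>

lemma limitin_topology_generated_by:
  assumes "l \<in> \<Union>\<B>" "\<And>U. U \<in> \<B> \<Longrightarrow> l \<in> U \<Longrightarrow> eventually (\<lambda>k. f k \<in> U) F"
  shows "limitin (topology_generated_by \<B>) f l F"
  unfolding limitin_def
proof (intro conjI allI impI)
  show "l \<in> topspace (topology_generated_by \<B>)" using assms(1) by (simp add: topology_generated_by_topspace)
  fix U assume U: "openin (topology_generated_by \<B>) U \<and> l \<in> U"
  then have "generate_topology_on \<B> U" by (simp add: openin_topology_generated_by_iff)
  then have "l \<in> U \<longrightarrow> eventually (\<lambda>k. f k \<in> U) F"
  proof induction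
    case (UN K)
    show ?case
    proof
      assume "l \<in> \<Union>K"
      then obtain k where k: "k \<in> K" "l \<in> k" by blast
      then have "eventually (\<lambda>j. f j \<in> k) F" using UN.IH by blast
      then show "eventually (\<lambda>j. f j \<in> \<Union>K) F" by eventually_elim (use k in blast)
    qed
  qed (auto simp: assms(2) eventually_conj_iff)
  with U show "eventually (\<lambda>k. f k \<in> U) F" by blast
qed

text \<open>Dominated convergence in the integral that defines \<open>dual_pairing\<close>: the
  uniform bound 1 makes the modulus of the transform of \<open>h\<close> a majorant, and that is
  integrable because \<open>h\<close> is in \<open>M1\<close>.\<close>

lemma limitin_weak_star:
  fixes f :: "nat \<Rightarrow> 'd::finite dist"
  assumes f: "\<And>k. f k \<in> Minf" and b: "\<And>k z. norm (f k (tf_atom z)) \<le> 1" and F: "F \<in> Minf"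
    and lim: "\<And>z. (\<lambda>k. f k (tf_atom z)) \<longlonglongrightarrow> F (tf_atom z)"
  shows "limitin weak_star_topology f F sequentially"
  unfolding weak_star_topology_def
proof (rule limitin_topology_generated_by)
  \<comment> \<open>A witness that some generating set contains \<open>F\<close>, so that
    \<open>F\<close> is a point of the topological space.\<close>
  have "(\<lambda>t. 0) \<in> (M1 :: (real ^ 'd \<Rightarrow> complex) set)"
    by (simp add: M1_def M1_norm_def stft_def)
  then show "F \<in> \<Union>{{f \<in> Minf. dual_pairing f h \<in> U} |h U. h \<in> M1 \<and> open U}"
    using F by (auto intro!: exI[of _ "{f \<in> Minf. dual_pairing f (\<lambda>t. 0) \<in> UNIV}"])
  fix V assume "V \<in> {{f \<in> Minf. dual_pairing f h \<in> U} |h U. h \<in> M1 \<and> open U}" "F \<in> V"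
  then obtain h U where V: "V = {f \<in> Minf. dual_pairing f h \<in> U}" "h \<in> M1" "open U" "dual_pairing F h \<in> U"
    by auto
  note int = M1_stft_integrable[OF V(2)]
  have m: "(\<lambda>z. G (tf_atom z)) \<in> borel_measurable borel" if "G \<in> Minf" for G :: "'d dist"
    by (rule borel_measurable_continuous_onI[OF tempered_atom_continuous[OF MinfD(1)[OF that]]])
  have "cnj \<in> borel_measurable borel" by (intro borel_measurable_continuous_onI continuous_intros)
  with int have [measurable]: "(\<lambda>z. cnj (stft gauss h z)) \<in> borel_measurable borel"
    by (auto intro: measurable_compose)
  have "(\<lambda>k. \<integral>z. f k (tf_atom z) * cnj (stft gauss h z) \<partial>lborel) \<longlonglongrightarrow> (\<integral>z. F (tf_atom z) * cnj (stft gauss h z) \<partial>lborel)"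
  proof (rule integral_dominated_convergence[where w = "\<lambda>z. norm (stft gauss h z)"])
    show "AE z in lborel. (\<lambda>k. f k (tf_atom z) * cnj (stft gauss h z)) \<longlonglongrightarrow> F (tf_atom z) * cnj (stft gauss h z)"
      by (rule AE_I2) (intro tendsto_mult tendsto_const lim)
    show "AE z in lborel. norm (f k (tf_atom z) * cnj (stft gauss h z)) \<le> norm (stft gauss h z)" for k
      by (rule AE_I2) (simp add: norm_mult mult_left_le_one_le b)
    show "integrable lborel (\<lambda>z. norm (stft gauss h z))" by (rule integrable_norm[OF int])
    show "(\<lambda>z. F (tf_atom z) * cnj (stft gauss h z)) \<in> borel_measurable lborel" using m[OF F] by measurable
    show "(\<lambda>z. f k (tf_atom z) * cnj (stft gauss h z)) \<in> borel_measurable lborel" for k using m[OF f] by measurable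
  qed
  then have "(\<lambda>k. dual_pairing (f k) h) \<longlonglongrightarrow> dual_pairing F h"
    unfolding dual_pairing_def stft_dist_gauss using gauss_norm_pos[where 'd = 'd]
        by (intro tendsto_divide tendsto_const)
  then have "eventually (\<lambda>k. dual_pairing (f k) h \<in> U) sequentially"
    by (rule topological_tendstoD) (use V in auto)
  then show "eventually (\<lambda>k. f k \<in> V) sequentially"
    by eventually_elim (use V f in auto)
qed

section \<open>Lattice shifts and the choice of normalised elements\<close>

text \<open>Covariance of the transform: the transposed shift takes the atom at \<open>z\<close> to
  the atom at \<open>z - \<mu>\<close> up to a phase factor. The phase does not depend on the time
  variable, so it leaves \<open>f\<close> by linearity and has modulus 1.\<close>

lemma norm_tf_shift_dist_atom:
  assumes "f \<in> tempered_distributions"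
  shows "norm (tf_shift_dist \<mu> f (tf_atom z)) = norm (f (tf_atom (z - \<mu>)))"
proof -
  have "tf_shift_dist \<mu> f (tf_atom z) = f (\<lambda>s. cis (2 * pi * ((snd \<mu> - snd z) \<bullet> fst \<mu>)) * tf_atom (z - \<mu>) s)"
    unfolding tf_shift_dist_def
  proof (rule arg_cong[where f = f], rule ext)
    fix s
    have "cis (2 * pi * (snd \<mu> \<bullet> (s + fst \<mu>))) * cis (- (2 * pi * (snd z \<bullet> (s + fst \<mu>)))) =
        cis (2 * pi * ((snd \<mu> - snd z) \<bullet> fst \<mu>)) * cis (- (2 * pi * (snd (z - \<mu>) \<bullet> s)))"
      unfolding cis_mult by (rule arg_cong[where f = cis]) (simp add: inner_diff_left inner_add_right algebra_simps)
    then show "cis (2 * pi * (snd \<mu> \<bullet> (s + fst \<mu>))) * tf_atom z (s + fst \<mu>) =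
        cis (2 * pi * ((snd \<mu> - snd z) \<bullet> fst \<mu>)) * tf_atom (z - \<mu>) s"
      by (simp add: tf_shift_def cis_cnj diff_diff_eq2 mult.assoc[symmetric])
  qed
  also have "norm \<dots> = norm (f (tf_atom (z - \<mu>)))"
    unfolding tempered_cmult[OF assms tf_atom_schwartz] by (simp add: norm_mult)
  finally show ?thesis .
qed

text \<open>In lattice coordinates every point differs from an integer vector by a vector with
  entries in the unit interval. Its norm is at most the number of coordinates, and the basis map
  enlarges norms by at most the factor \<open>K\<close>.\<close>

lemma lattice_fundamental_domain:
  fixes \<Lambda> :: "'d::finite phase set"
  assumes "is_lattice \<Lambda>"
  obtains R where "\<And>z. \<exists>\<mu>\<in>\<Lambda>. norm (z + \<mu>) \<le> R"
proof -
  obtain A :: "real ^ ('d + 'd) ^ ('d + 'd)" where A: "invertible A"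
    and \<Lambda>: "\<Lambda> = {phase_point (A *v k) | k. \<forall>i. k $ i \<in> \<int>}"
    using assms unfolding is_lattice_def by blast
  obtain A' where A': "A ** A' = mat 1" using A unfolding invertible_def by blast
  let ?p = "\<lambda>v. phase_point (A *v v)"
  have "linear ?p"
    by (rule linearI) (simp_all add: phase_point_def matrix_vector_right_distrib vec_eq_iff
        scaleR_matrix_vector_assoc[symmetric] matrix_vector_mult_scaleR)
  then obtain K where K: "0 < K" "\<And>v. norm (?p v) \<le> K * norm v"
    using linear_bounded_pos by blast
  have "\<exists>\<mu>\<in>\<Lambda>. norm (z + \<mu>) \<le> K * CARD('d + 'd)" for z
  proof -
    define y :: "real ^ ('d + 'd)" where "y = (\<chi> j. case j of Inl i \<Rightarrow> fst z $ i | Inr i \<Rightarrow> snd z $ i)"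
    have y: "phase_point y = z" by (simp add: phase_point_def y_def prod_eq_iff vec_eq_iff)
    define v where "v = A' *v y"
    have z: "?p v = z" unfolding v_def matrix_vector_mul_assoc A' by (simp add: y)
    \<comment> \<open>The sign is negative because the lattice point is added to \<open>z\<close>:
      \<open>v + k\<close> consists of the fractional parts.\<close>
    define k :: "real ^ ('d + 'd)" where "k = (\<chi> i. - real_of_int \<lfloor>v $ i\<rfloor>)"
    have "?p k \<in> \<Lambda>" unfolding \<Lambda> by (auto simp: k_def intro!: exI[of _ k])
    moreover have "norm (z + ?p k) \<le> K * CARD('d + 'd)"
    proof -
      have "z + ?p k = ?p (v + k)" using z linear_add[OF \<open>linear ?p\<close>] by simp
      also have "norm \<dots> \<le> K * norm (v + k)" by (rule K(2))
      also have "norm (v + k) \<le> (\<Sum>i\<in>UNIV. \<bar>(v + k) $ i\<bar>)" by (rule norm_le_l1_cart)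
      also have "\<dots> \<le> (\<Sum>i\<in>(UNIV :: ('d + 'd) set). 1)"
      proof (rule sum_mono)
        fix i show "\<bar>(v + k) $ i\<bar> \<le> 1" unfolding k_def by simp linarith
      qed
      finally show ?thesis using K(1) by simp
    qed
    ultimately show ?thesis by blast
  qed
  then show thesis by (rule that)
qed

lemma normalized_element:
  assumes R: "\<And>z. \<exists>\<mu>\<in>\<Lambda>. norm (z + \<mu>) \<le> R" and W: "Minf_subspace W" "W \<noteq> {\<lambda>\<phi>. 0}"
    and inv: "\<And>\<mu> f. \<mu> \<in> \<Lambda> \<Longrightarrow> f \<in> W \<Longrightarrow> tf_shift_dist \<mu> f \<in> W"
  obtains f z where "f \<in> W" "\<And>z. norm (f (tf_atom z)) \<le> 1" "norm z \<le> R" "1 / 2 \<le> norm (f (tf_atom z))"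
proof -
  have sub: "\<And>f. f \<in> W \<Longrightarrow> f \<in> Minf" "\<And>c f. f \<in> W \<Longrightarrow> (\<lambda>\<phi>. c * f \<phi>) \<in> W" "(\<lambda>\<phi>. 0) \<in> W"
    using W(1) by (auto simp: Minf_subspace_def)
  from W(2) sub(3) obtain h where h: "h \<in> W" "h \<noteq> (\<lambda>\<phi>. 0)" by blast
  have hT: "h \<in> tempered_distributions" by (rule MinfD(1)[OF sub(1)[OF h(1)]])
  obtain B where B: "\<And>z. norm (h (tf_atom z)) \<le> B" using MinfD(2)[OF sub(1)[OF h(1)]] by blast
  then have bdd: "bdd_above (range (\<lambda>z. norm (h (tf_atom z))))" by (auto simp: bdd_above_def)
  define s where "s = (SUP z. norm (h (tf_atom z)))"
  have le: "norm (h (tf_atom z)) \<le> s" for z unfolding s_def by (rule cSUP_upper[OF _ bdd]) simp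
  have "0 < s"
  proof (rule ccontr)
    assume "\<not> 0 < s"
    then have 0: "norm (h (tf_atom z)) \<le> 0" for z using le[of z] by linarith
    \<comment> \<open>With the bound \<open>B = 0\<close> the estimate by values on atoms says that
      a distribution vanishing on all atoms is zero.\<close>
    obtain C n where "\<And>f B \<phi>. f \<in> tempered_distributions \<Longrightarrow>
      (\<And>z. norm (f (tf_atom z)) \<le> B) \<Longrightarrow> \<phi> \<in> schwartz_space \<Longrightarrow>
          norm (f \<phi>) \<le> B * (C * total_seminorm n (\<phi> :: real ^ 'a \<Rightarrow> complex))"
      by (rule tempered_atom_bound) blast
    from this[OF hT 0] have "h \<phi> = 0" for \<phi>
      using tempered_outside[OF hT, of \<phi>] by (cases "\<phi> \<in> schwartz_space") auto
    then show False using h(2) by auto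
  qed
  \<comment> \<open>The supremum need not be attained, so a point with more than half of it is
    chosen.\<close>
  then have "\<exists>z\<in>UNIV. s / 2 < norm (h (tf_atom z))"
    using less_cSUP_iff[OF UNIV_not_empty bdd, of "s / 2"] by (simp only: s_def[symmetric]) simp
  then obtain z0 where z0: "s / 2 < norm (h (tf_atom z0))" by blast
  \<comment> \<open>The shift by \<mu> moves the near-maximum from \<open>z0\<close> to
    \<open>z0 + \<mu>\<close> in the ball of radius \<open>R\<close>; dividing by \<open>s\<close>
    makes the supremum 1.\<close>
  obtain \<mu> where \<mu>: "\<mu> \<in> \<Lambda>" "norm (z0 + \<mu>) \<le> R" using R by blast
  define f where "f = (\<lambda>\<phi>. complex_of_real (1 / s) * tf_shift_dist \<mu> h \<phi>)"
  have n: "norm (f (tf_atom z)) = norm (h (tf_atom (z - \<mu>))) / s" for z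
    using \<open>0 < s\<close> norm_tf_shift_dist_atom[OF hT, of \<mu> z] by (simp add: f_def norm_mult norm_divide)
  show thesis
  proof (rule that)
    show "f \<in> W" unfolding f_def by (intro sub inv \<mu> h)
    show "norm (f (tf_atom z)) \<le> 1" for z unfolding n using le \<open>0 < s\<close> by simp
    show "norm (z0 + \<mu>) \<le> R" by (rule \<mu>)
    show "1 / 2 \<le> norm (f (tf_atom (z0 + \<mu>)))" unfolding n using z0 \<open>0 < s\<close> by (simp add: field_simps)
  qed
qed

theorem lemma10:
  fixes \<Lambda> :: "'d::finite phase set"
    and W :: "nat \<Rightarrow> 'd dist set"
  assumes "is_lattice \<Lambda>"
    and "\<And>n. n \<ge> 1 \<Longrightarrow> Minf_subspace (W n)"
    and "\<And>n. n \<ge> 1 \<Longrightarrow> closedin weak_star_topology (W n)"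
    and "\<And>n. n \<ge> 1 \<Longrightarrow> W n \<supseteq> W (n + 1)"
    and "\<And>n. n \<ge> 1 \<Longrightarrow> W (n + 1) \<noteq> {\<lambda>\<phi>. 0}"
    and "\<And>n z f. n \<ge> 1 \<Longrightarrow> z \<in> \<Lambda> \<Longrightarrow> f \<in> W n \<Longrightarrow> tf_shift_dist z f \<in> W n"
  shows "(\<Inter>n\<in>{1..}. W n) \<noteq> {\<lambda>\<phi>. 0}"
proof -
  obtain R where R: "\<And>z. \<exists>\<mu>\<in>\<Lambda>. norm (z + \<mu>) \<le> R"
    by (rule lattice_fundamental_domain[OF assms(1)]) blast
  \<comment> \<open>The index is \<open>Suc k + 1\<close> because nontriviality is assumed for
    \<open>W (n + 1)\<close> with \<open>n\<close> at least 1.\<close>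
  have "\<exists>f z. f \<in> W (Suc k + 1) \<and> (\<forall>z. norm (f (tf_atom z)) \<le> 1) \<and> norm z \<le> R \<and> 1 / 2 \<le> norm (f (tf_atom z))" for k
  proof -
    have 1: "Minf_subspace (W (Suc k + 1))" by (rule assms(2)) simp
    have 2: "W (Suc k + 1) \<noteq> {\<lambda>\<phi>. 0}" by (rule assms(5)) simp
    show ?thesis
    proof (rule normalized_element[OF R 1 2])
      show "tf_shift_dist \<mu> f \<in> W (Suc k + 1)" if "\<mu> \<in> \<Lambda>" "f \<in> W (Suc k + 1)" for \<mu> f
        by (rule assms(6)[OF _ that]) simp
      fix f z
      assume "f \<in> W (Suc k + 1)" "\<And>z. norm (f (tf_atom z)) \<le> 1" "norm z \<le> R" "1 / 2 \<le> norm (f (tf_atom z))"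
      then show ?thesis by (intro exI[of _ f] exI[of _ z]) simp
    qed
  qed
  then have "\<exists>g. \<forall>k. fst (g k) \<in> W (Suc k + 1) \<and> (\<forall>z. norm (fst (g k) (tf_atom z)) \<le> 1) \<and>
      norm (snd (g k)) \<le> R \<and> 1 / 2 \<le> norm (fst (g k) (tf_atom (snd (g k))))"
    by (intro choice allI) (simp add: split_paired_Ex)
  then obtain g where g: "\<And>k. fst (g k) \<in> W (Suc k + 1)" "\<And>k z. norm (fst (g k) (tf_atom z)) \<le> 1"
    "\<And>k. norm (snd (g k)) \<le> R" "\<And>k. 1 / 2 \<le> norm (fst (g k) (tf_atom (snd (g k))))" by blast
  \<comment> \<open>The points of large modulus stay in a fixed ball, so along a subsequence
    \<open>p\<close> they converge. The elements are reindexed by \<open>p\<close> before the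
    subsequence for the distributions is taken.\<close>
  have "bounded (range (\<lambda>k. snd (g k)))" using g(3) by (auto simp: bounded_iff)
  then obtain z0 p where p: "strict_mono p" "((\<lambda>k. snd (g k)) \<circ> p) \<longlonglongrightarrow> z0"
    using bounded_imp_convergent_subsequence by blast
  define f z where "f k = fst (g (p k))" and "z k = snd (g (p k))" for k
  have f1: "norm (f k (tf_atom y)) \<le> 1" for k y unfolding f_def by (rule g(2))
  have f2: "1 / 2 \<le> norm (f k (tf_atom (z k)))" for k unfolding f_def z_def by (rule g(4))
  have z: "z \<longlonglongrightarrow> z0" using p(2) by (simp add: z_def[abs_def] o_def)
  have mono: "W (Suc n) \<subseteq> W (Suc m)" if "m \<le> n" for m n
    using that by (induction rule: dec_induct) (use assms(4) in \<open>auto simp: Suc_le_eq\<close>)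
  \<comment> \<open>Since \<open>n \<le> k \<le> p k\<close>, the element chosen from
    \<open>W (Suc (p k) + 1)\<close> lies in \<open>W (Suc n)\<close> by nesting.\<close>
  have fW: "f k \<in> W (Suc n)" if "n \<le> k" for k n
    using g(1)[of "p k"] mono[of n "Suc (p k)"] strict_mono_imp_increasing[OF p(1), of k] that by (auto simp: f_def)
  have fM: "f k \<in> Minf" for k
    using fW[of k k] assms(2)[of "Suc k"] by (auto simp: Minf_subspace_def)
  have fT: "f k \<in> tempered_distributions" for k by (rule MinfD(1)[OF fM])
  obtain r F where r: "strict_mono r" "F \<in> Minf" "\<And>z. (\<lambda>k. f (r k) (tf_atom z)) \<longlonglongrightarrow> F (tf_atom z)"
    by (rule tempered_bounded_subsequence[of f, OF fT f1]) blast
  have lim: "limitin weak_star_topology (\<lambda>k. f (r k)) F sequentially"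
    by (rule limitin_weak_star[of "\<lambda>k. f (r k)" F, OF fM f1 r(2,3)])
  \<comment> \<open>Each \<open>W n\<close> contains a tail of the sequence and is weak-star closed,
    so it contains the limit.\<close>
  have "F \<in> W n" if "1 \<le> n" for n
  proof (rule limitin_closedin[OF lim assms(3)[OF that]])
    obtain m where m: "n = Suc m" using \<open>1 \<le> n\<close> by (cases n) auto
    show "eventually (\<lambda>k. f (r k) \<in> W n) sequentially"
      using eventually_ge_at_top[of m]
    proof eventually_elim
      case (elim k)
      then show ?case using fW[of m "r k"] strict_mono_imp_increasing[OF r(1), of k] m by auto
    qed
  qed simp
  then have FW: "F \<in> (\<Inter>n\<in>{1..}. W n)" by auto
  \<comment> \<open>The lower bound holds at moving points, while convergence is known at fixed
    ones. The common modulus of continuity lets each \<open>z (r k)\<close> be replaced by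
    \<open>z0\<close> at the cost of an error that tends to zero.\<close>
  have "1 / 2 \<le> norm (F (tf_atom z0))"
  proof -
    obtain C M where C: "0 \<le> C" "\<And>f z y. (f :: 'd dist) \<in> tempered_distributions \<Longrightarrow>
      (\<And>z. norm (f (tf_atom z)) \<le> 1) \<Longrightarrow> norm (f (tf_atom z) - f (tf_atom y))
          \<le> C * (1 + norm z + norm y) ^ M * norm (z - y)"
      by (rule tempered_atom_equicontinuous) blast
    have zr: "(\<lambda>k. z (r k)) \<longlonglongrightarrow> z0" using LIMSEQ_subseq_LIMSEQ[OF z r(1)] by (simp add: o_def)
    have "(\<lambda>k. C * (1 + norm (z (r k)) + norm z0) ^ M * norm (z (r k) - z0))
        \<longlonglongrightarrow> C * (1 + norm z0 + norm z0) ^ M * norm (z0 - z0)"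
      by (intro tendsto_intros zr)
    then have "(\<lambda>k. C * (1 + norm (z (r k)) + norm z0) ^ M * norm (z (r k) - z0)) \<longlonglongrightarrow> 0" by simp
    from tendsto_add[OF this tendsto_norm[OF r(3)[of z0]]]
    have "(\<lambda>k. C * (1 + norm (z (r k)) + norm z0) ^ M * norm (z (r k) - z0) + norm (f (r k) (tf_atom z0)))
        \<longlonglongrightarrow> norm (F (tf_atom z0))" by simp
    then show ?thesis
    proof (rule LIMSEQ_le_const)
      have "1 / 2 \<le> C * (1 + norm (z (r k)) + norm z0) ^ M * norm (z (r k) - z0) + norm (f (r k) (tf_atom z0))" for k
        using f2[of "r k"] C(2)[OF fT f1, of "r k" "z (r k)" z0] norm_triangle_sub[of "f (r k) (tf_atom (z (r
            k)))" "f (r k) (tf_atom z0)"] by linarith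
      then show "\<exists>N. \<forall>k\<ge>N. 1 / 2 \<le> C * (1 + norm (z (r k)) + norm z0) ^ M * norm (z (r k) - z0) + norm (f (r k) (tf_atom z0))" by blast
    qed
  qed
  then have "F \<noteq> (\<lambda>\<phi>. 0)" by auto
  with FW show ?thesis by blast
qed

end
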